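(* (i) Let $\mathcal{H}$ be a Hilbert space and $A$ a bounded or unbounded self-adjoint operator on $\mathcal{H}$. Let $U_t=\mathrm{e}^{-itA}$ be the unitary evolution generated by $A$. If $\lambda>0$, then $$(A-i\lambda)^{-1}=i(1-\mathrm{e}^{-\lambda}U_1)^{-1}-i\sum_{k=1}^{\infty}\frac1{2^k}\big(1+\mathrm{e}^{-\lambda/2^{k}}U_{2^{-k}}\big)^{-1}=i\sum_{j=0}^{\infty}\mathrm{e}^{-j\lambda}U_{j}-i\lim_{\ell\to\infty}\sum_{k=1}^{\ell}\sum_{j=0}^{\infty}2^{-k}(-1)^j\mathrm{e}^{-j\lambda/2^k}U_{j2^{-k}},$$ with convergence in the strong operator topology. For $\lambda<0$ the corresponding formulas are obtained by taking adjoints (complex conjugation) in the formulas for $|\lambda|$. (ii) Assume $A$ is a positive (thus self-adjoint) operator on $\mathcal{H}$ with $0\notin\sigma(A)$, and let $T_t=\mathrm{e}^{-tA}$, $t\ge0$, be the semigroup generated by $A$. Then $$A^{-1}=(1-T_1)^{-1}-\sum_{k=1}^{\infty}2^{-k}(1+T_{1/2^k})^{-1}=\sum_{j=1}^{\infty}T_{j}-\lim_{\ell\to\infty}\sum_{k=1}^{\ell}\sum_{j=1}^{\infty}2^{-k}(-1)^jT_{j/2^k},$$ with convergence in operator norm. More generally, for real $s<1$, $s\notin\mathbb{Z}$, $$\pi A^{s-1}=\Gamma(s)\sin(\pi s)\left[\mathrm{Li}_s(T_1)-\sum_{k=1}^{\infty}2^{-k(1-s)}\,\mathrm{Li}_s(-T_{1/2^k})\right]$$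 with convergence in operator norm.
   Context: For $|z|<1$ the polylogarithm is $\mathrm{Li}_s(z)=\sum_{k=1}^\infty k^{-s}z^k$; $\mathrm{Li}_s$ of an operator of norm less than $1$ is defined by the same series (equivalently by functional calculus). Functions of a self-adjoint operator are defined by the spectral theorem. *)

theory Defs
  imports "HOL-Analysis.Analysis"
begin

text \<open>
  Complex Hilbert spaces. The real inner product, and with it the norm and the topology, is that of
  the underlying real Hilbert space, i.e. the real part of the complex one. The complex inner
  product is conjugate linear in its first argument.
\<close>

class chilbert_space = real_inner + banach +
  fixes scaleC :: "complex \<Rightarrow> 'a \<Rightarrow> 'a"  (infixr "*\<^sub>C" 75)
    and cinner :: "'a \<Rightarrow> 'a \<Rightarrow> complex"
  assumes scaleC_add_right: "a *\<^sub>C (x + y) = a *\<^sub>C x + a *\<^sub>C y"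
    and scaleC_add_left: "(a + b) *\<^sub>C x = a *\<^sub>C x + b *\<^sub>C x"
    and scaleC_scaleC: "a *\<^sub>C b *\<^sub>C x = (a * b) *\<^sub>C x"
    and scaleR_scaleC: "r *\<^sub>R x = complex_of_real r *\<^sub>C x"
    and cinner_commute: "cinner x y = cnj (cinner y x)"
    and cinner_add_left: "cinner (x + y) z = cinner x z + cinner y z"
    and cinner_scaleC_left: "cinner (a *\<^sub>C x) y = cnj a * cinner x y"
    and inner_eq_Re_cinner: "inner x y = Re (cinner x y)"

text \<open>
  A (possibly unbounded) operator is given by its domain \<open>D\<close> and a function \<open>A\<close>, whose values
  outside \<open>D\<close> are irrelevant.
\<close>

definition csubspace :: "'a::chilbert_space set \<Rightarrow> bool" where
  "csubspace D \<longleftrightarrow>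
     0 \<in> D \<and> (\<forall>x\<in>D. \<forall>y\<in>D. x + y \<in> D) \<and> (\<forall>c. \<forall>x\<in>D. c *\<^sub>C x \<in> D)"

definition clinear_on :: "'a::chilbert_space set \<Rightarrow> ('a \<Rightarrow> 'a) \<Rightarrow> bool" where
  "clinear_on D A \<longleftrightarrow> csubspace D \<and>
     (\<forall>x\<in>D. \<forall>y\<in>D. A (x + y) = A x + A y) \<and> (\<forall>c. \<forall>x\<in>D. A (c *\<^sub>C x) = c *\<^sub>C A x)"

definition op_graph :: "'a set \<Rightarrow> ('a \<Rightarrow> 'a) \<Rightarrow> ('a \<times> 'a) set" where
  "op_graph D A = {(x, A x) | x. x \<in> D}"

definition adjoint_graph :: "'a::chilbert_space set \<Rightarrow> ('a \<Rightarrow> 'a) \<Rightarrow> ('a \<times> 'a) set" where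
  "adjoint_graph D A = {(y, z). \<forall>x\<in>D. cinner y (A x) = cinner z x}"

definition self_adjoint :: "'a::chilbert_space set \<Rightarrow> ('a \<Rightarrow> 'a) \<Rightarrow> bool" where
  "self_adjoint D A \<longleftrightarrow>
     clinear_on D A \<and> closure D = UNIV \<and> adjoint_graph D A = op_graph D A"

text \<open>The imaginary part of \<open>cinner x (A x)\<close> vanishes by self-adjointness.\<close>

definition positive_operator :: "'a::chilbert_space set \<Rightarrow> ('a \<Rightarrow> 'a) \<Rightarrow> bool" where
  "positive_operator D A \<longleftrightarrow> self_adjoint D A \<and> (\<forall>x\<in>D. 0 \<le> Re (cinner x (A x)))"

text \<open>The inverse of \<open>A - z\<close>; it is meaningful for \<open>z\<close> in the resolvent set.\<close>

definition resolvent ::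
    "'a::chilbert_space set \<Rightarrow> ('a \<Rightarrow> 'a) \<Rightarrow> complex \<Rightarrow> 'a \<Rightarrow> 'a" where
  "resolvent D A z = inv_into D (\<lambda>x. A x - z *\<^sub>C x)"

definition resolvent_set :: "'a::chilbert_space set \<Rightarrow> ('a \<Rightarrow> 'a) \<Rightarrow> complex set" where
  "resolvent_set D A =
     {z. bij_betw (\<lambda>x. A x - z *\<^sub>C x) D UNIV \<and> bounded_linear (resolvent D A z)}"

definition spectrum :: "'a::chilbert_space set \<Rightarrow> ('a \<Rightarrow> 'a) \<Rightarrow> complex set" where
  "spectrum D A = - resolvent_set D A"

definition is_adjoint :: "('a::chilbert_space \<Rightarrow> 'a) \<Rightarrow> ('a \<Rightarrow> 'a) \<Rightarrow> bool" where
  "is_adjoint B C \<longleftrightarrow> (\<forall>x y. cinner (B x) y = cinner x (C y))"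

text \<open>Projection-valued measures on the Borel sets of the real line.\<close>

definition orth_projection :: "('a::chilbert_space \<Rightarrow> 'a) \<Rightarrow> bool" where
  "orth_projection P \<longleftrightarrow> clinear_on UNIV P \<and> (\<forall>x. P (P x) = P x) \<and> is_adjoint P P"

definition pvm :: "(real set \<Rightarrow> 'a::chilbert_space \<Rightarrow> 'a) \<Rightarrow> bool" where
  "pvm E \<longleftrightarrow>
     (\<forall>S\<in>sets borel. orth_projection (E S)) \<and>
     (\<forall>x. E UNIV x = x) \<and>
     (\<forall>S :: nat \<Rightarrow> real set. range S \<subseteq> sets borel \<longrightarrow> disjoint_family S \<longrightarrow>
        (\<forall>x. (\<lambda>n. E (S n) x) sums E (\<Union>n. S n) x))"

text \<open>The scalar measure \<open>S \<mapsto> \<parallel>E S x\<parallel>\<^sup>2 = \<langle>x, E S x\<rangle>\<close>.\<close>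

definition pvm_measure :: "(real set \<Rightarrow> 'a::chilbert_space \<Rightarrow> 'a) \<Rightarrow> 'a \<Rightarrow> real measure" where
  "pvm_measure E x = measure_of UNIV (sets borel) (\<lambda>S. ennreal ((norm (E S x))\<^sup>2))"

definition pvm_simple_integral ::
    "(real set \<Rightarrow> 'a::chilbert_space \<Rightarrow> 'a) \<Rightarrow> (real \<Rightarrow> complex) \<Rightarrow> 'a \<Rightarrow> 'a" where
  "pvm_simple_integral E s x = (\<Sum>v\<in>range s. v *\<^sub>C E (s -` {v}) x)"

text \<open>
  \<open>has_pvm_integral E f x y\<close> says that \<open>x\<close> lies in the domain of the operator \<open>\<integral> f dE\<close>, i.e. that
  \<open>f\<close> is square integrable for the scalar measure of \<open>x\<close>, and that this operator maps \<open>x\<close> to \<open>y\<close>.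
  The map from simple functions \<open>s\<close> to \<open>(\<integral> s dE) x\<close> is isometric for the \<open>L\<^sup>2\<close> norm, so it extends
  to square integrable functions by taking limits. Simple functions are bounded and the scalar
  measure is finite, hence the limit \<open>f\<close> below is automatically square integrable, and \<open>y\<close> does not
  depend on the approximating sequence.
\<close>

definition has_pvm_integral ::
    "(real set \<Rightarrow> 'a::chilbert_space \<Rightarrow> 'a) \<Rightarrow> (real \<Rightarrow> complex) \<Rightarrow> 'a \<Rightarrow> 'a \<Rightarrow> bool" where
  "has_pvm_integral E f x y \<longleftrightarrow> f \<in> borel_measurable borel \<and>
     (\<exists>s :: nat \<Rightarrow> real \<Rightarrow> complex. (\<forall>n. simple_function borel (s n)) \<and>
        (\<lambda>n. \<integral>\<^sup>+ a. ennreal ((cmod (f a - s n a))\<^sup>2) \<partial>pvm_measure E x) \<longlonglongrightarrow> 0 \<and>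
        (\<lambda>n. pvm_simple_integral E (s n) x) \<longlonglongrightarrow> y)"

text \<open>
  The spectral measure of a self-adjoint operator, \<open>A = \<integral> a dE(a)\<close> with equality of domains. By the
  spectral theorem it exists and is unique on the Borel sets; its values on other sets are never
  used.
\<close>

definition spectral_measure ::
    "'a::chilbert_space set \<Rightarrow> ('a \<Rightarrow> 'a) \<Rightarrow> real set \<Rightarrow> 'a \<Rightarrow> 'a" where
  "spectral_measure D A = (SOME E. pvm E \<and>
     (\<forall>x y. has_pvm_integral E complex_of_real x y \<longleftrightarrow> (x, y) \<in> op_graph D A))"

text \<open>
  The operator \<open>f(A)\<close>. It is applied below only to functions \<open>f\<close> that are bounded on the spectrum
  of \<open>A\<close>, so that \<open>f(A)\<close> is everywhere defined and bounded, and \<^const>\<open>Blinfun\<close> is applied to a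
  bounded linear function.
\<close>

definition op_fun ::
    "'a::chilbert_space set \<Rightarrow> ('a \<Rightarrow> 'a) \<Rightarrow> (real \<Rightarrow> complex) \<Rightarrow> 'a \<Rightarrow> 'a" where
  "op_fun D A f x = (THE y. has_pvm_integral (spectral_measure D A) f x y)"

definition unitary_evolution ::
    "'a::chilbert_space set \<Rightarrow> ('a \<Rightarrow> 'a) \<Rightarrow> real \<Rightarrow> 'a \<Rightarrow>\<^sub>L 'a" where
  "unitary_evolution D A t =
     Blinfun (op_fun D A (\<lambda>a. exp (- \<i> * complex_of_real t * complex_of_real a)))"

definition op_semigroup ::
    "'a::chilbert_space set \<Rightarrow> ('a \<Rightarrow> 'a) \<Rightarrow> real \<Rightarrow> 'a \<Rightarrow>\<^sub>L 'a" where
  "op_semigroup D A t = Blinfun (op_fun D A (\<lambda>a. complex_of_real (exp (- t * a))))"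

text \<open>
  Real powers of a positive operator with \<open>0\<close> not in its spectrum; the values of \<open>a powr r\<close> for
  \<open>a \<le> 0\<close> do not matter, as the spectral measure vanishes there.
\<close>

definition op_powr ::
    "'a::chilbert_space set \<Rightarrow> ('a \<Rightarrow> 'a) \<Rightarrow> real \<Rightarrow> 'a \<Rightarrow>\<^sub>L 'a" where
  "op_powr D A r = Blinfun (op_fun D A (\<lambda>a. complex_of_real (a powr r)))"

text \<open>Inverses, powers and polylogarithms of bounded operators.\<close>

definition blinfun_inv :: "('a::chilbert_space \<Rightarrow>\<^sub>L 'a) \<Rightarrow> ('a \<Rightarrow>\<^sub>L 'a)" where
  "blinfun_inv B = Blinfun (inv (blinfun_apply B))"

definition blinfun_pow :: "('a::chilbert_space \<Rightarrow>\<^sub>L 'a) \<Rightarrow> nat \<Rightarrow> ('a \<Rightarrow>\<^sub>L 'a)" where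
  "blinfun_pow B k = ((\<lambda>C. B o\<^sub>L C) ^^ k) id_blinfun"

text \<open>The series converges in operator norm if \<open>norm B < 1\<close>.\<close>

definition op_polylog :: "real \<Rightarrow> ('a::chilbert_space \<Rightarrow>\<^sub>L 'a) \<Rightarrow> ('a \<Rightarrow>\<^sub>L 'a)" where
  "op_polylog s B = (\<Sum>k. real (Suc k) powr (- s) *\<^sub>R blinfun_pow B (Suc k))"

end

theory Submission
  imports Defs
begin

text \<open>
  With \<open>w = \<lambda> + \<i>a\<close>, respectively \<open>w = a\<close>, repeated use of
  \<open>1/(1 - q\<^sup>2) = (1/(1 - q) + 1/(1 + q))/2\<close> for \<open>q = exp (-w/2\<^sup>k)\<close> gives
  \<open>1/(1 - exp (-w)) - (\<Sum>k=1..n. 2\<^sup>-\<^sup>k/(1 + exp (-w/2\<^sup>k))) = 2\<^sup>-\<^sup>n/(1 - exp (-w/2\<^sup>n))\<close>,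
  which tends to \<open>1/w\<close>; it is bounded on a vertical line and converges uniformly on \<open>[\<epsilon>, \<infinity>)\<close>.
  Likewise the duplication formula \<open>Li\<^sub>s(q) + Li\<^sub>s(-q) = 2\<^bsup>1-s\<^esup> Li\<^sub>s(q\<^sup>2)\<close> makes the sum of
  polylogarithms telescope to \<open>2\<^bsup>-n(1-s)\<^esup> Li\<^sub>s(exp (-a/2\<^sup>n))\<close>, whose limit is \<open>\<Gamma>(1-s) a\<^bsup>s-1\<^esup>\<close>, and
  the reflection formula removes \<open>\<Gamma>(1-s)\<close>. The functional calculus turns these scalar limits into
  strong limits, respectively norm limits.

  The spectral theorem is obtained from \<open>C = A(1 + A\<^sup>2)\<^sup>-\<^sup>1\<close>, a bounded operator with the same sign as
  \<open>A\<close>: the projection onto \<open>{A \<le> t}\<close> is read off from the sign of the operator \<open>C\<close> of \<open>A - t\<close>. The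
  resulting spectral family extends to all Borel sets by a Dynkin class argument.
\<close>

subsection \<open>Commuting positive operators on real Hilbert spaces\<close>

text \<open>The construction of the spectral family uses only the real inner product, polynomials in
  \<open>C\<close> and strong limits of them. Hence \<open>A\<close> itself and every bounded
  operator commuting with \<open>A\<close> commute with the projections obtained. Multiplication by
  \<open>\<i>\<close> is such an operator, and this restores complex linearity. Sign information
  passes from the bounded \<open>C\<close> to the unbounded \<open>A\<close> through the identity
  \<open>A = C + A C A\<close> of quadratic forms on the domain. The two parts differ in their mode
  of convergence for a concrete reason. In (i) the telescoped expression is periodic in
  \<open>a\<close> with period \<open>2 * pi * 2^n\<close>, while its limit decays at infinity, so
  convergence is not uniform on the line; a bound along the vertical line and dominated convergence
  give strong limits. In (ii) the spectrum lies in \<open>[\<epsilon>, \<infinity>)\<close>. The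
  polylogarithm still needs care for large \<open>a\<close>, where \<open>exp (-a/2^n)\<close> need
  not be near the singularity at 1: there both the remainder and its limit are small, because of a
  power prefactor.\<close>

lemma closed_subspace_orthogonal_projection:
  fixes M :: "'b::{real_inner,banach} set"
  assumes M: "subspace M" "closed M"
  shows "\<exists>y\<in>M. \<forall>z\<in>M. inner (x - y) z = 0"
proof -
  define d where "d = (INF y\<in>M. (norm (x - y))\<^sup>2)"
  have ne: "M \<noteq> {}"
    using subspace_0[OF M(1)] by blast
  have bdd: "bdd_below ((\<lambda>y. (norm (x - y))\<^sup>2) ` M)"
    by (rule bdd_belowI[of _ 0]) auto
  have d_le: "d \<le> (norm (x - y))\<^sup>2" if "y \<in> M" for y
    unfolding d_def using that bdd by (rule cINF_lower[rotated])
  have "\<exists>y\<in>M. (norm (x - y))\<^sup>2 < d + inverse (real (Suc n))" for n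
    using cINF_less_iff[OF ne bdd, of "d + inverse (real (Suc n))"] unfolding d_def by auto
  then obtain y where y: "\<And>n. y n \<in> M" "\<And>n. (norm (x - y n))\<^sup>2 < d + inverse (real (Suc n))"
    by metis
  \<comment> \<open>Parallelogram law for \<open>x - y n\<close> and \<open>x - y m\<close>. The
    midpoint of \<open>y n\<close> and \<open>y m\<close> lies in \<open>M\<close>, so the squared
    norm of the sum is at least \<open>4 * d\<close>.\<close>
  have close: "(norm (y n - y m))\<^sup>2 \<le> 2 * inverse (real (Suc n)) + 2 * inverse (real (Suc m))" for n m
  proof -
    have "(1/2) *\<^sub>R (y n + y m) \<in> M"
      using M(1) y(1) by (intro subspace_mul subspace_add) auto
    from d_le[OF this] have "4 * d \<le> (norm ((x - y n) + (x - y m)))\<^sup>2"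
    proof -
      have "(x - y n) + (x - y m) = 2 *\<^sub>R (x - (1/2) *\<^sub>R (y n + y m))"
        by (simp add: algebra_simps scaleR_2)
      then have "(norm ((x - y n) + (x - y m)))\<^sup>2 = 4 * (norm (x - (1/2) *\<^sub>R (y n + y m)))\<^sup>2"
        by (simp only: norm_scaleR power_mult_distrib) simp
      then show ?thesis
        using d_le[OF \<open>(1/2) *\<^sub>R (y n + y m) \<in> M\<close>] by simp
    qed
    moreover have "(norm ((x - y n) + (x - y m)))\<^sup>2 + (norm (y n - y m))\<^sup>2
        = 2 * (norm (x - y n))\<^sup>2 + 2 * (norm (x - y m))\<^sup>2"
      unfolding power2_norm_eq_inner by (simp add: inner_commute algebra_simps)
    ultimately show ?thesis
      using y(2)[of n] y(2)[of m] by linarith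
  qed
  have "Cauchy y"
  proof (rule metric_CauchyI)
    fix e :: real assume e: "0 < e"
    then obtain N where N: "inverse (real (Suc N)) < e\<^sup>2 / 4"
      using reals_Archimedean[of "e\<^sup>2/4"] by auto
    have "dist (y m) (y n) < e" if "m \<ge> N" "n \<ge> N" for m n
    proof -
      have "inverse (real (Suc m)) \<le> inverse (real (Suc N))" "inverse (real (Suc n)) \<le> inverse (real (Suc N))"
        using that by (auto intro!: le_imp_inverse_le)
      then have "(norm (y m - y n))\<^sup>2 < e\<^sup>2"
        using close[of m n] N by linarith
      then show ?thesis
        using e by (simp add: dist_norm power_less_imp_less_base)
    qed
    then show "\<exists>M. \<forall>m\<ge>M. \<forall>n\<ge>M. dist (y m) (y n) < e" by blast
  qed
  then obtain l where l: "y \<longlonglongrightarrow> l"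
    using Cauchy_convergent convergent_def by blast
  have lM: "l \<in> M"
    using closed_sequentially[OF M(2) _ l] y(1) by blast
  have "(\<lambda>n. (norm (x - y n))\<^sup>2) \<longlonglongrightarrow> (norm (x - l))\<^sup>2"
    by (intro tendsto_intros l)
  moreover have "(\<lambda>n. d + inverse (real (Suc n))) \<longlonglongrightarrow> d + 0"
    by (intro tendsto_intros LIMSEQ_inverse_real_of_nat)
  ultimately have ld: "(norm (x - l))\<^sup>2 \<le> d"
    by (auto intro!: LIMSEQ_le[of "\<lambda>n. (norm (x - y n))\<^sup>2" _ "\<lambda>n. d + inverse (real (Suc n))"]
        less_imp_le[OF y(2)] simp del: of_nat_Suc)
  have "inner (x - l) z = 0" if z: "z \<in> M" for z
  proof (cases "z = 0")
    case False
    \<comment> \<open>\<open>t *\<^sub>R z\<close> is the component of \<open>x - l\<close> along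
      \<open>z\<close>; moving \<open>l\<close> by it would strictly reduce the distance unless the
      inner product vanishes.\<close>
    define t where "t = inner (x - l) z / (norm z)\<^sup>2"
    have "l + t *\<^sub>R z \<in> M"
      using M(1) lM z by (intro subspace_add subspace_mul)
    from d_le[OF this] ld have "(norm (x - l))\<^sup>2 \<le> (norm (x - l - t *\<^sub>R z))\<^sup>2"
      by (simp only: diff_diff_eq)
    also have "\<dots> = (norm (x - l))\<^sup>2 - 2 * t * inner (x - l) z + t\<^sup>2 * (norm z)\<^sup>2"
      unfolding power2_norm_eq_inner by (simp add: inner_commute algebra_simps power2_eq_square)
    also have "\<dots> = (norm (x - l))\<^sup>2 - (inner (x - l) z)\<^sup>2 / (norm z)\<^sup>2"
      using False by (simp add: t_def field_simps power2_eq_square)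
    finally have "(inner (x - l) z)\<^sup>2 / (norm z)\<^sup>2 \<le> 0" by simp
    then show ?thesis
      using False by (simp add: divide_le_0_iff)
  qed simp
  then show ?thesis using lM by blast
qed

definition sym_op :: "('b::real_inner \<Rightarrow> 'b) \<Rightarrow> bool" where
  "sym_op B \<longleftrightarrow> bounded_linear B \<and> (\<forall>x y. inner (B x) y = inner x (B y))"

lemma sym_op_linear: "sym_op B \<Longrightarrow> linear B"
  unfolding sym_op_def by (simp add: bounded_linear.linear)

lemma sym_op_bounded_linear: "sym_op B \<Longrightarrow> bounded_linear B"
  unfolding sym_op_def by simp

lemma sym_opD: "sym_op B \<Longrightarrow> inner (B x) y = inner x (B y)"
  unfolding sym_op_def by simp

text \<open>Positivity of the form at \<open>B x - x\<close> bounds twice the squared norm of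
  \<open>B x\<close> by the values of the form at \<open>B x\<close> and at \<open>x\<close>. Each
  of these is at most the corresponding squared norm.\<close>

lemma sym_op_contraction:
  fixes B :: "'b::real_inner \<Rightarrow> 'b"
  assumes B: "linear B" and sym: "\<And>x y. inner (B x) y = inner x (B y)"
    and pos: "\<And>x. 0 \<le> inner x (B x)" and le: "\<And>x. inner x (B x) \<le> inner x x"
  shows "norm (B x) \<le> norm x"
proof -
  have "0 \<le> inner (B x - x) (B (B x - x))" by (rule pos)
  then have "2 * inner (B x) (B x) \<le> inner (B x) (B (B x)) + inner x (B x)"
    using sym[of "x" "B x"] by (simp add: linear_diff[OF B] inner_diff_left inner_diff_right inner_commute)
  then have "inner (B x) (B x) \<le> inner x x"
    using le[of "B x"] le[of x] by linarith
  then show ?thesis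
    by (simp add: norm_le)
qed

text \<open>The classical argument of F. Riesz: a positive contraction is a strongly convergent sum of
  squares of polynomials in itself.\<close>

lemma commuting_positive_contraction:
  fixes A B :: "'b::real_inner \<Rightarrow> 'b"
  assumes A: "sym_op A" and B: "sym_op B"
    and posA: "\<And>x. 0 \<le> inner x (A x)" and leA: "\<And>x. inner x (A x) \<le> inner x x"
    and posB: "\<And>x. 0 \<le> inner x (B x)"
    and comm: "\<And>x. A (B x) = B (A x)"
  shows "0 \<le> inner x (A (B x))"
proof -
  \<comment> \<open>Each step splits off a square, \<open>R = R^2 + (R - R^2)\<close>, so that
    \<open>A\<close> is the sum of the squares of the first \<open>n\<close> operators plus the
    remainder \<open>S n\<close>.\<close>
  define S where "S = rec_nat A (\<lambda>_ R x. R x - R (R x))"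
  have S0: "S 0 = A" and SS: "S (Suc n) = (\<lambda>x. S n x - S n (S n x))" for n
    by (simp_all add: S_def)
  have S: "linear (S n) \<and> (\<forall>x y. inner (S n x) y = inner x (S n y)) \<and> (\<forall>x. 0 \<le> inner x (S n x)) \<and>
      (\<forall>x. inner x (S n x) \<le> inner x x) \<and> (\<forall>x. S n (B x) = B (S n x))" for n
  proof (induction n)
    case 0
    then show ?case
      using A posA leA comm by (auto simp: S0 sym_op_def bounded_linear.linear)
  next
    case (Suc n)
    let ?R = "S n"
    from Suc have lin: "linear ?R" and sym: "\<And>x y. inner (?R x) y = inner x (?R y)"
      and pos: "\<And>x. 0 \<le> inner x (?R x)" and le: "\<And>x. inner x (?R x) \<le> inner x x"
      and com: "\<And>x. ?R (B x) = B (?R x)" by blast+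
    note ld = linear_diff[OF lin]
    \<comment> \<open>The identity \<open>R - R^2 = R (1 - R) R + (1 - R) R (1 - R)\<close> shows
      that the remainder stays positive.\<close>
    have 1: "inner x (?R x - ?R (?R x)) = inner (?R x) (?R x - ?R (?R x)) + inner (x - ?R x) (?R (x - ?R x))" for x
      using sym[of x "?R x"] sym[of x "?R (?R x)"] sym[of x x]
      by (simp add: ld inner_diff_left inner_diff_right inner_commute)
    have "0 \<le> inner x (?R x - ?R (?R x))" for x
      unfolding 1 using pos[of "x - ?R x"] le[of "?R x"] by (simp add: inner_diff_right)
    moreover have "inner x (?R x - ?R (?R x)) \<le> inner x x" for x
      using le[of x] sym[of x "?R x"] by (simp add: inner_diff_right) (smt (verit) inner_ge_zero)
    moreover have "linear (\<lambda>x. ?R x - ?R (?R x))"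
      by (intro linear_compose_sub lin linear_compose[OF lin lin, unfolded o_def])
    moreover have "B (?R x - ?R (?R x)) = B (?R x) - B (?R (?R x))" for x
      by (rule linear_diff[OF sym_op_linear[OF B]])
    ultimately show ?case
      by (simp add: SS com inner_diff_left inner_diff_right sym)
  qed
  have bl: "norm (S n x) \<le> norm x" for n x
    using sym_op_contraction[of "S n"] S[of n] by blast
  have sum_eq: "(\<Sum>k<n. S k (S k x)) = A x - S n x" for n x
    by (induction n) (auto simp: S0 SS algebra_simps)
  have "(\<Sum>k<n. (norm (S k x))\<^sup>2) \<le> (norm x)\<^sup>2" for n
  proof -
    have "(\<Sum>k<n. (norm (S k x))\<^sup>2) = inner x (\<Sum>k<n. S k (S k x))"
      using S by (simp add: inner_sum_right power2_norm_eq_inner)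
    also have "\<dots> \<le> (norm x)\<^sup>2"
      using leA[of x] S[of n] unfolding sum_eq power2_norm_eq_inner inner_diff_right
      by (smt (verit))
    finally show ?thesis .
  qed
  then have "summable (\<lambda>k. (norm (S k x))\<^sup>2)"
    by (intro summableI_nonneg_bounded[of _ "(norm x)\<^sup>2"]) auto
  then have "(\<lambda>k. sqrt ((norm (S k x))\<^sup>2)) \<longlonglongrightarrow> sqrt 0"
    by (intro tendsto_real_sqrt summable_LIMSEQ_zero)
  then have "(\<lambda>k. norm (S k x)) \<longlonglongrightarrow> 0" by simp
  then have S0': "(\<lambda>k. S k x) \<longlonglongrightarrow> 0"
    by (rule tendsto_norm_zero_cancel)
  have "(\<lambda>n. inner (B x) (A x - S n x)) \<longlonglongrightarrow> inner (B x) (A x - 0)"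
    by (intro tendsto_intros S0')
  moreover have "0 \<le> inner (B x) (A x - S n x)" for n
  proof -
    \<comment> \<open>One factor \<open>S k\<close> moves to the left and past \<open>B\<close>, so
      every square contributes a value of the positive form of \<open>B\<close>.\<close>
    have "inner (B x) (S k (S k x)) = inner (S k x) (B (S k x))" for k
      using S[of k] by (metis inner_commute)
    then have "0 \<le> inner (B x) (\<Sum>k<n. S k (S k x))"
      unfolding inner_sum_right by (intro sum_nonneg) (simp add: posB)
    then show ?thesis unfolding sum_eq .
  qed
  ultimately have "0 \<le> inner (B x) (A x)"
    using LIMSEQ_le_const[of _ "inner (B x) (A x)" 0] by simp
  then show ?thesis
    using sym_opD[OF A, of "x" "B x"] by (simp add: inner_commute)
qed

lemma commuting_positive:
  fixes A B :: "'b::real_inner \<Rightarrow> 'b"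
  assumes A: "sym_op A" and B: "sym_op B"
    and posA: "\<And>x. 0 \<le> inner x (A x)" and posB: "\<And>x. 0 \<le> inner x (B x)"
    and comm: "\<And>x. A (B x) = B (A x)"
  shows "0 \<le> inner x (A (B x))"
proof -
  obtain K where K: "K > 0" "\<And>x. norm (A x) \<le> norm x * K"
    using bounded_linear.pos_bounded[OF sym_op_bounded_linear[OF A]] by blast
  define A' where "A' = (\<lambda>x. (1/K) *\<^sub>R A x)"
  have "0 \<le> inner x (A' (B x))"
  proof (rule commuting_positive_contraction[where A = A' and B = B])
    show "sym_op A'"
      using A unfolding A'_def sym_op_def by (auto intro: bounded_linear_scaleR_right bounded_linear_compose)
    show "inner x (A' x) \<le> inner x x" for x
    proof -
      have "inner x (A x) \<le> norm x * norm (A x)" by (rule norm_cauchy_schwarz)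
      also have "\<dots> \<le> norm x * (norm x * K)" by (intro mult_left_mono K) auto
      finally show ?thesis
        using K(1) by (simp add: A'_def field_simps norm_eq_sqrt_inner)
    qed
    show "A' (B x) = B (A' x)" for x
      by (simp add: A'_def comm linear_scale[OF sym_op_linear[OF B]])
  qed (use B posB posA K in \<open>auto simp: A'_def\<close>)
  then show ?thesis
    using K(1) by (simp add: A'_def zero_le_divide_iff)
qed

subsection \<open>The sign of a symmetric contraction\<close>

text \<open>The Newton--Schulz iteration \<open>x \<mapsto> (3x - x\<^sup>3)/2\<close>, which converges to \<open>sgn x\<close> on \<open>[-1, 1]\<close>.\<close>

primrec sign_iter :: "('b::real_inner \<Rightarrow> 'b) \<Rightarrow> nat \<Rightarrow> 'b \<Rightarrow> 'b" where
  "sign_iter C 0 = C"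
| "sign_iter C (Suc n) = (\<lambda>x. (3/2) *\<^sub>R sign_iter C n x
     - (1/2) *\<^sub>R sign_iter C n (sign_iter C n (sign_iter C n x)))"

definition sign_op :: "('b::real_inner \<Rightarrow> 'b) \<Rightarrow> 'b \<Rightarrow> 'b" where
  "sign_op C x = lim (\<lambda>n. sign_iter C n x)"

text \<open>The projection onto the spectral subspace \<open>{C \<le> 0}\<close>, namely \<open>1 - (s\<^sup>2 + s)/2\<close> with \<open>s = sgn C\<close>.\<close>

definition nonpos_proj :: "('b::real_inner \<Rightarrow> 'b) \<Rightarrow> 'b \<Rightarrow> 'b" where
  "nonpos_proj C x = x - (1/2) *\<^sub>R (sign_op C (sign_op C x) + sign_op C x)"

locale sym_contraction =
  fixes C :: "'b::{real_inner,banach} \<Rightarrow> 'b"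
  assumes C: "sym_op C" and contr: "\<And>x. norm (C x) \<le> norm x"
begin

abbreviation "X \<equiv> sign_iter C"
text \<open>The defect of \<open>X n\<close> from being an involution. Its positivity expresses that
  \<open>X n\<close> is a contraction, and in terms of it the iteration reads
  \<open>X (Suc n) = X n (1 + W n / 2)\<close>.\<close>

definition W where "W n x = x - X n (X n x)"

lemma sym_X: "sym_op (X n)"
proof (induction n)
  case 0 then show ?case using C by simp
next
  case (Suc n)
  then have "bounded_linear (X n)" and s: "\<And>x y. inner (X n x) y = inner x (X n y)"
    by (auto simp: sym_op_def)
  then have "bounded_linear (X (Suc n))"
    unfolding sign_iter.simps
    by (intro bounded_linear_sub bounded_linear_const_scaleR bounded_linear_ident
        bounded_linear_compose[OF \<open>bounded_linear (X n)\<close>])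
  moreover have "inner (X (Suc n) x) y = inner x (X (Suc n) y)" for x y
    by (simp add: inner_diff_left inner_diff_right s)
  ultimately show ?case
    unfolding sym_op_def by blast
qed

lemmas linX = sym_op_linear[OF sym_X]
lemmas symX = sym_opD[OF sym_X]

text \<open>With \<open>w = 1 - x^2\<close> one has
  \<open>1 - (x * (2 + w) / 2)^2 = (3 * w^2 + w^3) / 4\<close>. The coefficients are nonnegative and
  every power is at least 2, which is why positivity of \<open>W n\<close> is inherited.\<close>

lemma W_Suc: "W (Suc n) x = (1/4) *\<^sub>R W n (3 *\<^sub>R W n x + W n (W n x))"
proof -
  note l = linear_diff[OF linX[of n]] linear_add[OF linX[of n]] linear_scale[OF linX[of n]]
  show ?thesis
    \<comment> \<open>Pairing with an arbitrary vector turns the claim into an identity between real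
      numbers that is linear in finitely many inner products.\<close>
    apply (rule vector_eq_rdot[THEN iffD1], rule allI)
    apply (simp only: W_def sign_iter.simps l inner_add_left inner_diff_left inner_scaleR_left)
    apply (simp add: field_simps)
    done
qed

lemma sym_W: "sym_op (W n)"
  using sym_X[of n] unfolding sym_op_def W_def
  by (auto intro!: bounded_linear_sub bounded_linear_ident bounded_linear_compose[of "X n" "X n"]
      simp: inner_diff_left inner_diff_right)

lemmas symW = sym_opD[OF sym_W]

lemma pos_W: "0 \<le> inner x (W n x)"
proof (induction n arbitrary: x)
  case 0
  have "inner (C x) (C x) \<le> inner x x"
    using contr[of x] by (simp add: norm_le)
  then show ?case
    using sym_opD[OF C, of x "C x"] by (simp add: W_def inner_diff_right)
next
  case (Suc n)
  have "inner x (W (Suc n) x) = (1/4) * (3 * inner (W n x) (W n x) + inner (W n x) (W n (W n x)))"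
    unfolding W_Suc by (simp add: symW[symmetric] inner_add_right)
  also have "\<dots> \<ge> 0"
    using Suc[of "W n x"] by (intro mult_nonneg_nonneg add_nonneg_nonneg) auto
  finally show ?case .
qed

lemma X_contr: "norm (X n x) \<le> norm x"
  using pos_W[of x n] by (simp add: W_def inner_diff_right symX[symmetric] norm_le)

lemma X_Suc: "X (Suc n) x = X n x + (1/2) *\<^sub>R X n (W n x)"
  apply (rule vector_eq_rdot[THEN iffD1], rule allI)
  apply (simp only: W_def sign_iter.simps linear_diff[OF linX] inner_add_left inner_diff_left inner_scaleR_left)
  apply (simp add: field_simps)
  done

text \<open>A domain \<open>D\<close> is allowed so that the same argument covers the unbounded
  operator \<open>A\<close> as well as bounded operators, for which \<open>D\<close> is the whole
  space.\<close>

lemma X_intertwine: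
  assumes T: "subspace D" "\<And>x y. x \<in> D \<Longrightarrow> y \<in> D \<Longrightarrow> T (x + y) = T x + T y"
      "\<And>c x. x \<in> D \<Longrightarrow> T (c *\<^sub>R x) = c *\<^sub>R T x"
    and CT: "\<And>x. x \<in> D \<Longrightarrow> C x \<in> D \<and> T (C x) = C (T x)"
    and x: "x \<in> D"
  shows "X n x \<in> D \<and> T (X n x) = X n (T x)"
  using x
proof (induction n arbitrary: x)
  case 0 then show ?case using CT by simp
next
  case (Suc n)
  have Tm: "T (- y) = - T y" if "y \<in> D" for y
    using T(3)[OF that, of "-1"] by simp
  then have Td: "T (y - z) = T y - T z" if "y \<in> D" "z \<in> D" for y z
    using T(2)[OF that(1), of "- z"] that subspace_neg[OF T(1) that(2)] by simp
  have 1: "X n x \<in> D" "X n (X n (X n x)) \<in> D"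
    and 2: "T (X n x) = X n (T x)" "T (X n (X n (X n x))) = X n (X n (X n (T x)))"
    using Suc.IH[OF Suc.prems] Suc.IH[of "X n x"] Suc.IH[of "X n (X n x)"] by auto
  show ?case
    using 1 by (simp add: Td[OF subspace_mul[OF T(1)] subspace_mul[OF T(1)]] T(3) 2
        subspace_diff[OF T(1)] subspace_mul[OF T(1)])
qed

lemma bounded_linear_intertwine:
  assumes "bounded_linear K" "\<And>x. K (C x) = C (K x)"
  shows "K (X n x) = X n (K x)"
  using X_intertwine[of UNIV K x n] assms
  by (simp add: linear_add[OF bounded_linear.linear] linear_scale[OF bounded_linear.linear])

lemma X_C: "X n (C x) = C (X n x)"
  using bounded_linear_intertwine[OF sym_op_bounded_linear[OF C]] by metis

lemma X_comm: "X m (X n x) = X n (X m x)"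
  using bounded_linear_intertwine[OF sym_op_bounded_linear[OF sym_X[of m]], of n x] X_C by metis

lemma W_X_comm: "W m (X n x) = X n (W m x)"
  unfolding W_def by (simp add: X_comm[of m n] linear_diff[OF linX])

text \<open>Passing from \<open>m\<close> to \<open>Suc m\<close> adds half of
  \<open>X n X m W m\<close> to \<open>X n X m\<close>. By induction \<open>X n X m\<close> is
  positive, and it commutes with the positive \<open>W m\<close>, so
  \<open>commuting_positive\<close> makes the added term positive.\<close>

lemma XX_ge: "n \<le> m \<Longrightarrow> inner (X n x) (X n x) \<le> inner x (X n (X m x))"
proof (induction m arbitrary: x rule: dec_induct)
  case base then show ?case by (simp add: symX)
next
  case (step m)
  have "0 \<le> inner x ((\<lambda>x. X n (X m x)) (W m x))"
  proof (rule commuting_positive[OF _ sym_W])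
    show "sym_op (\<lambda>x. X n (X m x))"
      using sym_X[of n] sym_X[of m] unfolding sym_op_def
      by (auto intro: bounded_linear_compose[of "X n" "X m"] simp: X_comm[of m n])
    show "0 \<le> inner x (X n (X m x))" for x
      using step.IH[of x] inner_ge_zero order_trans by blast
  qed (auto simp: pos_W W_X_comm)
  then show ?case
    using step.IH[of x]
    by (simp add: X_Suc linear_add[OF linX] linear_scale[OF linX] inner_add_right del: sign_iter.simps)
qed

lemma X_norm_mono: "n \<le> m \<Longrightarrow> norm (X n x) \<le> norm (X m x)"
proof -
  assume "n \<le> m"
  have "(norm (X n x))\<^sup>2 \<le> inner (X n x) (X m x)"
    using XX_ge[OF \<open>n \<le> m\<close>, of x] unfolding symX[symmetric] power2_norm_eq_inner .
  also have "\<dots> \<le> norm (X n x) * norm (X m x)" by (rule norm_cauchy_schwarz)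
  finally show ?thesis
    by (cases "norm (X n x) = 0") (auto simp: power2_eq_square)
qed

text \<open>In the expanded square the mixed term is controlled by \<open>XX_ge\<close>. A bounded
  increasing sequence of squared norms therefore forces the vectors themselves to be Cauchy.\<close>

lemma X_diff_bound: "n \<le> m \<Longrightarrow> (norm (X m x - X n x))\<^sup>2 \<le> (norm (X m x))\<^sup>2 - (norm (X n x))\<^sup>2"
  using XX_ge[of n m x] symX[of n x "X m x"] inner_commute[of "X m x" "X n x"]
  unfolding power2_norm_eq_inner by (simp add: inner_diff_left inner_diff_right)

lemma X_convergent: "(\<lambda>n. X n x) \<longlonglongrightarrow> sign_op C x"
proof -
  have "incseq (\<lambda>n. (norm (X n x))\<^sup>2)"
    by (auto simp: incseq_def intro!: power_mono X_norm_mono)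
  moreover have "\<forall>n. (norm (X n x))\<^sup>2 \<le> (norm x)\<^sup>2"
    by (auto intro!: power_mono X_contr)
  ultimately obtain L where "(\<lambda>n. (norm (X n x))\<^sup>2) \<longlonglongrightarrow> L"
    by (rule incseq_convergent) 
  then have c: "Cauchy (\<lambda>n. (norm (X n x))\<^sup>2)"
    using LIMSEQ_imp_Cauchy by blast
  have "Cauchy (\<lambda>n. X n x)"
  proof (rule metric_CauchyI)
    fix e :: real assume e: "0 < e"
    obtain N where N: "\<And>m n. m \<ge> N \<Longrightarrow> n \<ge> N \<Longrightarrow> \<bar>(norm (X m x))\<^sup>2 - (norm (X n x))\<^sup>2\<bar> < e\<^sup>2"
      using metric_CauchyD[OF c, of "e\<^sup>2"] e by (auto simp: dist_real_def)
    have *: "norm (X m x - X n x) < e" if "m \<ge> n" "n \<ge> N" for m n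
    proof -
      have "(norm (X m x - X n x))\<^sup>2 < e\<^sup>2"
        using X_diff_bound[OF that(1), of x] N[of m n] that by linarith
      then show ?thesis using e by (simp add: power_less_imp_less_base)
    qed
    then have "\<forall>m\<ge>N. \<forall>n\<ge>N. dist (X m x) (X n x) < e"
      by (metis dist_commute dist_norm linear)
    then show "\<exists>M. \<forall>m\<ge>M. \<forall>n\<ge>M. dist (X m x) (X n x) < e" by blast
  qed
  then show ?thesis
    unfolding sign_op_def using Cauchy_convergent convergent_LIMSEQ_iff by blast
qed

abbreviation "S \<equiv> sign_op C"

lemma S_contr: "norm (S x) \<le> norm x"
  using LIMSEQ_le_const2[OF tendsto_norm[OF X_convergent]] X_contr by blast

lemma S_linear: "linear S"
proof
  show "S (x + y) = S x + S y" for x y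
    using LIMSEQ_unique[OF X_convergent[of "x + y"] tendsto_eq_rhs[OF _ refl]]
      tendsto_add[OF X_convergent[of x] X_convergent[of y]] by (simp add: linear_add[OF linX])
  show "S (r *\<^sub>R x) = r *\<^sub>R S x" for r x
    using LIMSEQ_unique[OF X_convergent[of "r *\<^sub>R x"]]
      tendsto_scaleR[OF tendsto_const[of r] X_convergent[of x]] by (simp add: linear_scale[OF linX])
qed

lemma S_sym_op: "sym_op S"
  unfolding sym_op_def
proof (intro conjI allI)
  show "bounded_linear S"
    by (rule bounded_linear_intro[where K=1])
      (auto simp: linear_add[OF S_linear] linear_scale[OF S_linear] S_contr)
  show "inner (S x) y = inner x (S y)" for x y
    using LIMSEQ_unique[OF tendsto_inner[OF X_convergent[of x] tendsto_const[of y]]]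
      tendsto_inner[OF tendsto_const[of x] X_convergent[of y]] by (simp add: symX)
qed

text \<open>The iterates are uniformly contractive, so the argument may vary with \<open>n\<close>;
  in this way the cubes of \<open>X n\<close> converge strongly to the cube of
  \<open>S\<close>.\<close>

lemma X_convergent_comp:
  assumes "y \<longlonglongrightarrow> l" shows "(\<lambda>n. X n (y n)) \<longlonglongrightarrow> S l"
proof -
  have "(\<lambda>n. norm (y n - l)) \<longlonglongrightarrow> 0"
    using assms by (simp add: LIM_zero tendsto_norm_zero)
  then have "(\<lambda>n. X n (y n - l)) \<longlonglongrightarrow> 0"
    by (rule tendsto_0_le[where K=1]) (auto simp: X_contr)
  from tendsto_add[OF this X_convergent[of l]] show ?thesis
    by (simp add: linear_diff[OF linX])
qed

text \<open>The strong limit is a fixed point of the iteration,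
  \<open>s = (3 * s - s^3) / 2\<close>.\<close>

lemma S_cube: "S (S (S x)) = S x"
proof -
  have "(\<lambda>n. X (Suc n) x) \<longlonglongrightarrow> (3/2) *\<^sub>R S x - (1/2) *\<^sub>R S (S (S x))"
    unfolding sign_iter.simps by (intro tendsto_intros X_convergent_comp X_convergent)
  moreover have "(\<lambda>n. X (Suc n) x) \<longlonglongrightarrow> S x"
    by (rule LIMSEQ_Suc[OF X_convergent])
  ultimately have e: "S x = (3/2) *\<^sub>R S x - (1/2) *\<^sub>R S (S (S x))"
    using LIMSEQ_unique by blast
  have *: "b = a" if "a = (3/2) * a - (1/2) * b" for a b :: real
    using that by linarith
  have "inner (S (S (S x))) z = inner (S x) z" for z
    by (rule *) (use arg_cong[OF e, of "\<lambda>u. inner u z"] in \<open>unfold inner_diff_left inner_scaleR_left\<close>)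
  then show ?thesis
    using vector_eq_rdot by blast
qed

text \<open>\<open>C S\<close> plays the role of the absolute value of \<open>C\<close>. By
  \<open>XX_ge\<close> with first index 0, \<open>C (X n)\<close> dominates \<open>C^2\<close>, and
  positivity survives the limit.\<close>

lemma C_S_pos: "0 \<le> inner x (C (S x))"
proof -
  have "(\<lambda>n. inner x (C (X n x))) \<longlonglongrightarrow> inner x (C (S x))"
    by (intro tendsto_intros bounded_linear.tendsto[OF sym_op_bounded_linear[OF C]] X_convergent)
  moreover have "0 \<le> inner x (C (X n x))" for n
    using XX_ge[of 0 n x] inner_ge_zero[of "X 0 x"] by (simp only: sign_iter.simps) linarith
  ultimately show ?thesis
    by (intro LIMSEQ_le_const) auto
qed

text \<open>The norms of \<open>X n x\<close> increase from that of \<open>C x\<close>, so a zero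
  limit forces \<open>C x = 0\<close>; conversely all iterates vanish on the kernel of
  \<open>C\<close>.\<close>

lemma S_eq_0_iff: "S x = 0 \<longleftrightarrow> C x = 0"
proof
  assume "S x = 0"
  then have "(\<lambda>n. norm (X n x)) \<longlonglongrightarrow> 0"
    using tendsto_norm[OF X_convergent[of x]] by simp
  moreover have "norm (X 0 x) \<le> norm (X n x)" for n
    by (rule X_norm_mono) simp
  ultimately have "norm (X 0 x) \<le> 0"
    by (intro LIMSEQ_le_const) auto
  then show "C x = 0" by simp
next
  assume 0: "C x = 0"
  have "X n x = 0" for n
    by (induction n) (auto simp: 0 linear_0[OF linX])
  then show "S x = 0"
    using LIMSEQ_unique[OF X_convergent[of x]] by simp
qed

abbreviation "P \<equiv> nonpos_proj C"

lemma P_sym_op: "sym_op P"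
  using S_sym_op unfolding sym_op_def nonpos_proj_def
  by (auto intro!: bounded_linear_sub bounded_linear_ident bounded_linear_const_scaleR bounded_linear_add
      bounded_linear_compose[of S S] simp: inner_diff_left inner_diff_right inner_add_left inner_add_right)

lemma P_idem: "P (P x) = P x"
proof -
  note l = linear_diff[OF S_linear] linear_add[OF S_linear] linear_scale[OF S_linear]
  show ?thesis
    apply (rule vector_eq_rdot[THEN iffD1], rule allI)
    apply (simp only: nonpos_proj_def l S_cube inner_add_left inner_diff_left inner_scaleR_left)
    apply (simp add: field_simps)
    done
qed

lemma P_C_kernel: "C x = 0 \<Longrightarrow> P x = x"
  by (simp add: nonpos_proj_def S_eq_0_iff[symmetric] linear_0[OF S_linear])

text \<open>On the range of \<open>P\<close> one has \<open>S (S x) = - S x\<close>. As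
  \<open>S\<close> annihilates \<open>x - S (S x)\<close>, so does \<open>C\<close>; hence
  \<open>C x = C (S (S x)) = - C (S x)\<close>, and \<open>C S\<close> is positive.\<close>

lemma P_range_nonpos:
  assumes "P x = x" shows "inner x (C x) \<le> 0"
proof -
  have 1: "S x = - S (S x)"
    using assms by (simp add: nonpos_proj_def) (metis add_eq_0_iff)
  have "S (x - S (S x)) = 0"
    by (simp add: linear_diff[OF S_linear] S_cube)
  then have "C x = C (S (S x))"
    using S_eq_0_iff[of "x - S (S x)"] by (simp add: linear_diff[OF sym_op_linear[OF C]])
  also have "S (S x) = - S x"
    using minus_equation_iff[THEN iffD1, OF 1[symmetric]] by (rule sym)
  finally have "C x = - C (S x)"
    by (simp add: linear_neg[OF sym_op_linear[OF C]])
  then show ?thesis using C_S_pos[of x] by simp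
qed

text \<open>Applying \<open>S\<close> to \<open>x = (S (S x) + S x) / 2\<close> and using
  \<open>S_cube\<close> gives \<open>S x = x\<close>, so the form of \<open>C\<close> at
  \<open>x\<close> is that of \<open>C S\<close>.\<close>

lemma P_kernel_nonneg:
  assumes "P x = 0" shows "0 \<le> inner x (C x)"
proof -
  have x: "x = (1/2) *\<^sub>R (S (S x) + S x)"
    using assms by (simp add: nonpos_proj_def)
  have "S x = (1/2) *\<^sub>R (S (S (S x)) + S (S x))"
    by (subst x) (simp add: linear_add[OF S_linear] linear_scale[OF S_linear])
  then have "S x = x"
    using x by (simp add: S_cube add.commute)
  then show ?thesis using C_S_pos[of x] by simp
qed

text \<open>The hypothesis \<open>closedT\<close>, that the graph of \<open>T\<close> is closed,
  carries the relation from the polynomials \<open>X n\<close> to their strong limit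
  \<open>S\<close>, including membership in \<open>D\<close>.\<close>

lemma P_intertwine:
  assumes T: "subspace D" "\<And>x y. x \<in> D \<Longrightarrow> y \<in> D \<Longrightarrow> T (x + y) = T x + T y"
      "\<And>c x. x \<in> D \<Longrightarrow> T (c *\<^sub>R x) = c *\<^sub>R T x"
    and closedT: "\<And>z x y. \<lbrakk>\<And>n. z n \<in> D; z \<longlonglongrightarrow> x; (\<lambda>n. T (z n)) \<longlonglongrightarrow> y\<rbrakk> \<Longrightarrow> x \<in> D \<and> T x = y"
    and CT: "\<And>x. x \<in> D \<Longrightarrow> C x \<in> D \<and> T (C x) = C (T x)"
    and x: "x \<in> D"
  shows "P x \<in> D \<and> T (P x) = P (T x)"
proof -
  have X: "X n z \<in> D \<and> T (X n z) = X n (T z)" if "z \<in> D" for z n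
    using X_intertwine[OF T CT that] .
  have SD: "S z \<in> D \<and> T (S z) = S (T z)" if "z \<in> D" for z
    by (rule closedT[of "\<lambda>n. X n z"]) (use X[OF that] X_convergent in auto)
  have Tm: "T (- y) = - T y" if "y \<in> D" for y
    using T(3)[OF that, of "-1"] by simp
  then have Td: "T (y - z) = T y - T z" if "y \<in> D" "z \<in> D" for y z
    using T(2)[OF that(1), of "- z"] that subspace_neg[OF T(1) that(2)] by simp
  show ?thesis
    using SD[OF x] SD[of "S x"] x
    by (auto simp: nonpos_proj_def Td T(2,3) subspace_diff[OF T(1)] subspace_mul[OF T(1)] subspace_add[OF T(1)])
qed

end

subsection \<open>The spectral family of an unbounded self-adjoint operator\<close>

text \<open>Self-adjointness for the real inner product alone; \<open>A_max\<close> is the inclusion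
  of the graph of the real adjoint in that of \<open>A\<close>. The complex structure enters again
  with \<open>F_orth\<close>.\<close>

locale real_self_adjoint =
  fixes D :: "'a::{real_inner,banach} set" and A :: "'a \<Rightarrow> 'a"
  assumes D: "subspace D" and dense: "closure D = UNIV"
    and A_add: "x \<in> D \<Longrightarrow> y \<in> D \<Longrightarrow> A (x + y) = A x + A y"
    and A_scale: "x \<in> D \<Longrightarrow> A (c *\<^sub>R x) = c *\<^sub>R A x"
    and A_sym: "x \<in> D \<Longrightarrow> y \<in> D \<Longrightarrow> inner (A x) y = inner x (A y)"
    and A_max: "(\<And>x. x \<in> D \<Longrightarrow> inner y (A x) = inner z x) \<Longrightarrow> y \<in> D \<and> A y = z"
begin

lemma A_diff: "x \<in> D \<Longrightarrow> y \<in> D \<Longrightarrow> A (x - y) = A x - A y"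
  using A_add[of x "- y"] A_scale[of y "-1"] subspace_neg[OF D, of y] by simp

lemma A_0: "A 0 = 0"
  using A_scale[OF subspace_0[OF D], of 0] by simp

lemma shift: "real_self_adjoint D (\<lambda>x. A x - t *\<^sub>R x)"
proof
  show "y \<in> D \<and> A y - t *\<^sub>R y = z" if "\<And>x. x \<in> D \<Longrightarrow> inner y (A x - t *\<^sub>R x) = inner z x" for y z
    using A_max[of y "z + t *\<^sub>R y"] that by (simp add: inner_diff_right inner_add_left algebra_simps)
qed (use D dense in \<open>auto simp: A_add A_scale A_sym inner_diff_left inner_diff_right algebra_simps\<close>)

text \<open>Adjoints are closed: the symmetry relation passes to the limit, and \<open>A_max\<close>
  reads off membership in the domain.\<close>

lemma closed_op:
  assumes z: "\<And>n. z n \<in> D" "z \<longlonglongrightarrow> x" "(\<lambda>n. A (z n)) \<longlonglongrightarrow> y"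
  shows "x \<in> D \<and> A x = y"
proof (rule A_max)
  fix u assume u: "u \<in> D"
  have "(\<lambda>n. inner (A (z n)) u) \<longlonglongrightarrow> inner y u"
    by (intro tendsto_intros z)
  moreover have "(\<lambda>n. inner (z n) (A u)) \<longlonglongrightarrow> inner x (A u)"
    by (intro tendsto_intros z)
  moreover have "(\<lambda>n. inner (A (z n)) u) = (\<lambda>n. inner (z n) (A u))"
    using A_sym[OF z(1) u] by simp
  ultimately show "inner x (A u) = inner y u"
    using LIMSEQ_unique by metis
qed

text \<open>Von Neumann's argument: project \<open>(x, 0)\<close> orthogonally onto the graph of \<open>A\<close>.\<close>

lemma ex_resolvent: "\<exists>u. u \<in> D \<and> A u \<in> D \<and> u + A (A u) = x"
proof -
  define G where "G = (\<lambda>u. (u, A u)) ` D"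
  have "subspace G"
  proof (rule subspaceI)
    show "0 \<in> G"
      unfolding G_def zero_prod_def by (rule image_eqI[of _ _ 0]) (auto simp: A_0 subspace_0[OF D])
    show "p + q \<in> G" if pq: "p \<in> G" "q \<in> G" for p q
    proof -
      obtain u v where "p = (u, A u)" "q = (v, A v)" "u \<in> D" "v \<in> D"
        using pq by (auto simp: G_def)
      then show ?thesis
        unfolding G_def by (intro image_eqI[of _ _ "u + v"]) (auto simp: A_add subspace_add[OF D])
    qed
    show "c *\<^sub>R p \<in> G" if p: "p \<in> G" for c p
    proof -
      obtain u where "p = (u, A u)" "u \<in> D"
        using p by (auto simp: G_def)
      then show ?thesis
        unfolding G_def by (intro image_eqI[of _ _ "c *\<^sub>R u"]) (auto simp: A_scale subspace_mul[OF D])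
    qed
  qed
  moreover have "closed G"
    unfolding closed_sequential_limits
  proof (intro allI impI)
    fix z l assume zl: "(\<forall>n. z n \<in> G) \<and> z \<longlonglongrightarrow> l"
    then have "(\<lambda>n. fst (z n)) \<longlonglongrightarrow> fst l" "(\<lambda>n. snd (z n)) \<longlonglongrightarrow> snd l"
      by (auto intro: tendsto_fst tendsto_snd)
    moreover have "fst (z n) \<in> D \<and> snd (z n) = A (fst (z n))" for n
    proof -
      have "z n \<in> G" using zl by blast
      then show ?thesis by (auto simp: G_def)
    qed
    ultimately have "fst l \<in> D \<and> A (fst l) = snd l"
      by (intro closed_op[of "\<lambda>n. fst (z n)"]) auto
    then show "l \<in> G"
      unfolding G_def by (intro image_eqI[of _ _ "fst l"]) (auto simp: prod_eq_iff)
  qed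
  ultimately obtain g where g: "g \<in> G" "\<And>z. z \<in> G \<Longrightarrow> inner ((x, 0) - g) z = 0"
    using closed_subspace_orthogonal_projection by metis
  then obtain u where u: "u \<in> D" "g = (u, A u)"
    by (auto simp: G_def)
  \<comment> \<open>Orthogonality of \<open>(x - u, - A u)\<close> to the graph is exactly the
    adjoint relation for the pair \<open>A u\<close>, \<open>x - u\<close>.\<close>
  have "inner (A u) (A v) = inner (x - u) v" if "v \<in> D" for v
  proof -
    have "(v, A v) \<in> G" using that by (auto simp: G_def)
    from g(2)[OF this] show ?thesis
      by (simp add: u inner_prod_def)
  qed
  then have "A u \<in> D \<and> A (A u) = x - u"
    by (intro A_max) auto
  then show ?thesis using u by (intro exI[of _ u]) auto
qed

definition res where "res x = (SOME u. u \<in> D \<and> A u \<in> D \<and> u + A (A u) = x)"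

lemma res: "res x \<in> D" "A (res x) \<in> D" "res x + A (A (res x)) = x"
  using someI_ex[OF ex_resolvent[of x]] unfolding res_def by blast+

lemma res_unique:
  assumes "u \<in> D" "A u \<in> D" "u + A (A u) = x" shows "res x = u"
proof -
  define v where "v = res x - u"
  have v: "v \<in> D" "A v \<in> D"
    using res[of x] assms D by (auto simp: v_def A_diff subspace_diff)
  have "v + A (A v) = (res x + A (A (res x))) - (u + A (A u))"
    using res(1,2)[of x] assms(1,2) by (simp add: v_def A_diff)
  then have "v + A (A v) = 0"
    using res(3)[of x] assms(3) by simp
  then have "inner v v + inner v (A (A v)) = 0"
    by (metis inner_add_right inner_zero_right)
  then have "inner v v + inner (A v) (A v) = 0"
    using A_sym[OF v] by simp
  then have "inner v v = 0"
    using inner_ge_zero[of v] inner_ge_zero[of "A v"] by linarith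
  then show ?thesis by (simp add: v_def)
qed

definition C where "C x = A (res x)"

lemma res_add: "res (x + y) = res x + res y"
  by (rule res_unique) (use res[of x] res[of y] D in \<open>auto simp: A_add subspace_add algebra_simps\<close>)

lemma res_scale: "res (c *\<^sub>R x) = c *\<^sub>R res x"
  by (rule res_unique)
    (use res[of x] D in \<open>auto simp: A_scale subspace_mul simp flip: scaleR_add_right\<close>)

lemma inner_res: "inner x y = inner (res x) y + inner (A (A (res x))) y"
  by (metis inner_add_left res(3))

text \<open>Pairing \<open>x = res x + A (A (res x))\<close> with \<open>res x\<close>. The
  contraction bounds for \<open>res\<close> and for \<open>C\<close> both follow from this
  identity.\<close>

lemma res_norm: "(norm (res x))\<^sup>2 + (norm (C x))\<^sup>2 = inner x (res x)"
proof -
  show ?thesis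
    using inner_res[of x "res x"] A_sym[OF res(2,1), of x x] by (simp add: C_def power2_norm_eq_inner)
qed

lemma res_contr: "norm (res x) \<le> norm x"
proof -
  have "(norm (res x))\<^sup>2 \<le> norm x * norm (res x)"
    using res_norm[of x] norm_cauchy_schwarz[of x "res x"] zero_le_power2[of "norm (C x)"] by linarith
  then show ?thesis
    by (cases "norm (res x) = 0") (auto simp: power2_eq_square)
qed

lemma C_contr: "norm (C x) \<le> norm x"
proof -
  have "(norm (C x))\<^sup>2 \<le> norm x * norm (res x)"
    using res_norm[of x] norm_cauchy_schwarz[of x "res x"] zero_le_power2[of "norm (res x)"] by linarith
  also have "\<dots> \<le> norm x * norm x" by (intro mult_left_mono res_contr) auto
  also have "\<dots> = (norm x)\<^sup>2" by (simp add: power2_eq_square)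
  finally show ?thesis
    by (rule power2_le_imp_le) simp
qed

lemma C_sym_op: "sym_op C"
  unfolding sym_op_def
proof (intro conjI allI)
  show "bounded_linear C"
    by (rule bounded_linear_intro[where K=1])
      (auto simp: C_def res_add res_scale A_add A_scale res C_contr[unfolded C_def])
  fix x y
  have "inner (C x) y = inner (A (res x)) (res y) + inner (A (res x)) (A (A (res y)))"
    unfolding C_def using inner_res[of y "A (res x)"] by (simp add: inner_commute)
  also have "\<dots> = inner (res x) (C y) + inner (A (A (res x))) (C y)"
    using A_sym res by (simp add: C_def)
  also have "\<dots> = inner x (C y)"
    by (rule inner_res[symmetric])
  finally show "inner (C x) y = inner x (C y)" .
qed

lemma C_sym_contraction: "sym_contraction C"
  by standard (auto simp: C_sym_op C_contr)

text \<open>\<open>A (res x)\<close> solves the equation that defines \<open>res (A x)\<close>, as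
  one sees by applying \<open>A\<close> to the equation for \<open>res x\<close>.\<close>

lemma C_A: assumes "x \<in> D" shows "C x = res (A x)" "C x \<in> D" "A (C x) = C (A x)"
proof -
  have "A (A (res x)) = x - res x" using res(3)[of x] by (metis add_diff_cancel_left')
  then have 1: "A (A (res x)) \<in> D" using assms res(1) D by (simp add: subspace_diff)
  have "A (res x) + A (A (A (res x))) = A x"
    using A_add[OF res(1)[of x] 1] res(3)[of x] by simp
  then show *: "C x = res (A x)"
    unfolding C_def by (rule res_unique[OF res(2)[of x] 1, symmetric])
  show "C x \<in> D" unfolding C_def by (rule res(2))
  show "A (C x) = C (A x)" by (simp only: *) (simp only: C_def)
qed

text \<open>Formally \<open>A = (1 + A^2) C = C + A C A\<close>. A sign of the form of
  \<open>C\<close> on an invariant subspace therefore becomes the same sign for the form of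
  \<open>A\<close>.\<close>

lemma inner_A_eq:
  assumes x: "x \<in> D" shows "inner x (A x) = inner x (C x) + inner (A x) (C (A x))"
proof -
  have "inner x (A x) = inner (res x) (A x) + inner (A (A (res x))) (A x)"
    by (rule inner_res)
  also have "inner (res x) (A x) = inner x (C x)"
    using A_sym[OF res(1) x] by (simp add: C_def inner_commute)
  also have "inner (A (A (res x))) (A x) = inner (A x) (C (A x))"
    using C_A[OF x] by (simp add: C_def inner_commute)
  finally show ?thesis .
qed

definition Q where "Q = nonpos_proj C"

definition commutes where
  "commutes K \<longleftrightarrow> bounded_linear K \<and> (\<forall>x\<in>D. K x \<in> D \<and> A (K x) = K (A x))"

lemma commutes_C:
  assumes K: "commutes K" shows "K (C x) = C (K x)"
proof -
  have l: "K (a + b) = K a + K b" for a b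
    using K by (simp add: commutes_def linear_add bounded_linear.linear)
  have *: "K (res x) \<in> D" "A (K (res x)) = K (A (res x))" "K (A (res x)) \<in> D"
    "A (K (A (res x))) = K (A (A (res x)))"
    using K res[of x] by (auto simp: commutes_def)
  have "res (K x) = K (res x)"
    by (rule res_unique) (use * res(3)[of x] in \<open>auto simp flip: l\<close>)
  then show ?thesis using * by (simp add: C_def)
qed

lemma Q_sym_op: "sym_op Q" and Q_idem: "Q (Q x) = Q x"
  unfolding Q_def
  by (rule sym_contraction.P_sym_op[OF C_sym_contraction] sym_contraction.P_idem[OF C_sym_contraction])+

lemma Q_commutes: "commutes Q"
  unfolding commutes_def
proof (intro conjI ballI)
  show "bounded_linear Q" by (rule sym_op_bounded_linear[OF Q_sym_op])
  fix x assume x: "x \<in> D"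
  have "nonpos_proj C x \<in> D \<and> A (nonpos_proj C x) = nonpos_proj C (A x)"
    by (rule sym_contraction.P_intertwine[OF C_sym_contraction D A_add A_scale closed_op])
      (use x C_A(2,3) in auto)
  then show "Q x \<in> D" "A (Q x) = Q (A x)" by (auto simp: Q_def)
qed

lemma commutes_Q:
  assumes K: "commutes K" shows "K (Q x) = Q (K x)"
proof -
  have bl: "bounded_linear K" using K by (simp add: commutes_def)
  have "nonpos_proj C x \<in> UNIV \<and> K (nonpos_proj C x) = nonpos_proj C (K x)"
  proof (rule sym_contraction.P_intertwine[OF C_sym_contraction subspace_UNIV])
    show "x \<in> UNIV \<and> K x = y" if "z \<longlonglongrightarrow> x" "(\<lambda>n. K (z n)) \<longlonglongrightarrow> y" for z x y
      using LIMSEQ_unique[OF bounded_linear.tendsto[OF bl that(1)] that(2)] by simp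
  qed (use bl commutes_C[OF K] in
      \<open>auto simp: linear_add[OF bounded_linear.linear] linear_scale[OF bounded_linear.linear]\<close>)
  then show ?thesis by (simp add: Q_def)
qed

text \<open>The kernel is counted with the nonpositive part; this choice is what makes the spectral
  family continuous from the right.\<close>

lemma Q_kernel: "x \<in> D \<Longrightarrow> A x = 0 \<Longrightarrow> Q x = x"
  unfolding Q_def using C_A(1)[of x] res_scale[of 0 0]
  by (intro sym_contraction.P_C_kernel[OF C_sym_contraction]) simp

lemma Q_range_nonpos: "x \<in> D \<Longrightarrow> Q x = x \<Longrightarrow> inner x (A x) \<le> 0"
  using sym_contraction.P_range_nonpos[OF C_sym_contraction, of x]
    sym_contraction.P_range_nonpos[OF C_sym_contraction, of "A x"] Q_commutes inner_A_eq[of x]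
  unfolding commutes_def Q_def[symmetric] by fastforce

lemma Q_kernel_nonneg:
  assumes "x \<in> D" "Q x = 0" shows "0 \<le> inner x (A x)"
proof -
  have "Q (A x) = 0"
    using Q_commutes assms A_0 unfolding commutes_def by metis
  then show ?thesis
    using sym_contraction.P_kernel_nonneg[OF C_sym_contraction, of x]
      sym_contraction.P_kernel_nonneg[OF C_sym_contraction, of "A x"] assms inner_A_eq[of x]
    unfolding Q_def[symmetric] by simp
qed

end

section \<open>Monotonicity, right continuity and limits of the spectral family\<close>

context real_self_adjoint
begin

definition F :: "real \<Rightarrow> 'a \<Rightarrow> 'a" where
  "F t = real_self_adjoint.Q D (\<lambda>x. A x - t *\<^sub>R x)"

text \<open>Because commutation with \<open>A - t\<close> is independent of \<open>t\<close>, an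
  operator commuting with \<open>A\<close> commutes with every \<open>F t\<close>; in particular the
  projections commute with one another.\<close>

lemma commutes_shift:
  "real_self_adjoint.commutes D (\<lambda>x. A x - t *\<^sub>R x) K \<longleftrightarrow> commutes K"
  unfolding commutes_def real_self_adjoint.commutes_def[OF shift]
  by (auto simp: linear_diff[OF bounded_linear.linear] linear_scale[OF bounded_linear.linear])

lemma F_sym_op: "sym_op (F t)" and F_idem: "F t (F t x) = F t x"
  unfolding F_def
  by (rule real_self_adjoint.Q_sym_op[OF shift] real_self_adjoint.Q_idem[OF shift])+

lemma F_commutes: "commutes (F t)"
  unfolding F_def using real_self_adjoint.Q_commutes[OF shift] commutes_shift by blast

lemma commutes_F: "commutes K \<Longrightarrow> K (F t x) = F t (K x)"
  unfolding F_def using real_self_adjoint.commutes_Q[OF shift] commutes_shift by blast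

lemma F_comm: "F s (F t x) = F t (F s x)"
  by (rule commutes_F[OF F_commutes])

lemmas F_linear = sym_op_linear[OF F_sym_op]
lemmas F_diff = linear_diff[OF F_linear]

lemma F_D: "x \<in> D \<Longrightarrow> F t x \<in> D" and F_A: "x \<in> D \<Longrightarrow> A (F t x) = F t (A x)"
  using F_commutes unfolding commutes_def by auto

lemma F_range: "x \<in> D \<Longrightarrow> F t x = x \<Longrightarrow> inner x (A x) \<le> t * inner x x"
  using real_self_adjoint.Q_range_nonpos[OF shift[of t], of x] unfolding F_def
  by (simp add: inner_diff_right)

lemma F_ker: "x \<in> D \<Longrightarrow> F t x = 0 \<Longrightarrow> t * inner x x \<le> inner x (A x)"
  using real_self_adjoint.Q_kernel_nonneg[OF shift[of t], of x] unfolding F_def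
  by (simp add: inner_diff_right)

lemma F_eigen: "x \<in> D \<Longrightarrow> A x = t *\<^sub>R x \<Longrightarrow> F t x = x"
  using real_self_adjoint.Q_kernel[OF shift[of t], of x] unfolding F_def by simp

lemma F_norm_sq: "inner x (F t x) = (norm (F t x))\<^sup>2"
  using sym_opD[OF F_sym_op, of t x "F t x"] by (simp add: F_idem power2_norm_eq_inner)

lemma F_contr: "norm (F t x) \<le> norm x"
proof -
  have "(norm (F t x))\<^sup>2 \<le> norm x * norm (F t x)"
    using F_norm_sq norm_cauchy_schwarz by metis
  then show ?thesis
    by (cases "norm (F t x) = 0") (auto simp: power2_eq_square)
qed

lemma dense_induct:
  assumes "closed {x. P x}" "\<And>x. x \<in> D \<Longrightarrow> P x" shows "P x"
proof -
  have "D \<subseteq> {x. P x}" using assms(2) by blast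
  then have "closure D \<subseteq> {x. P x}" by (rule closure_minimal[OF _ assms(1)])
  then show ?thesis using dense by auto
qed

lemma continuous_on_F [continuous_intros]:
  "continuous_on S f \<Longrightarrow> continuous_on S (\<lambda>x. F t (f x))"
  by (rule bounded_linear.continuous_on[OF sym_op_bounded_linear[OF F_sym_op]])

text \<open>A vector in the range of \<open>F s\<close> and in the kernel of \<open>F t\<close> has
  energy at most \<open>s\<close> and at least \<open>t\<close> times its squared norm, so it is
  zero when \<open>s < t\<close>.\<close>

lemma F_mono:
  assumes "s < t" shows "F t (F s x) = F s x"
proof (rule dense_induct[where x = x and P = "\<lambda>x. F t (F s x) = F s x"])
  show "closed {x. F t (F s x) = F s x}"
    by (intro closed_Collect_eq continuous_intros)
  fix x assume x: "x \<in> D"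
  define v where "v = F s x - F t (F s x)"
  have v: "v \<in> D" "F s v = v" "F t v = 0"
    using x D by (auto simp: v_def F_D subspace_diff F_diff F_idem F_comm[of s t])
  then have "t * inner v v \<le> s * inner v v"
    using F_range[of v s] F_ker[of v t] by linarith
  then have "v = 0"
    using assms by (simp add: mult_le_cancel_right)
  then show "F t (F s x) = F s x" by (simp add: v_def)
qed

lemma F_mono': "s \<le> t \<Longrightarrow> F t (F s x) = F s x"
  using F_mono F_idem by (cases "s = t") auto

lemma F_norm_mono: "s \<le> t \<Longrightarrow> norm (F s x) \<le> norm (F t x)"
  using F_contr[of s "F t x"] F_mono'[of s t x] by (simp add: F_comm)

lemma F_norm_diff: "s \<le> t \<Longrightarrow> (norm (F t x - F s x))\<^sup>2 = (norm (F t x))\<^sup>2 - (norm (F s x))\<^sup>2"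
  using sym_opD[OF F_sym_op, of t x "F s x"] F_mono'[of s t x] F_norm_sq[of x s]
  unfolding power2_norm_eq_inner by (simp add: inner_diff_left inner_diff_right inner_commute)

text \<open>Positivity of the form of \<open>T = A - a\<close> at \<open>u - x\<close> gives
  \<open>2\<langle>u, T x\<rangle> \<le> (b - a)(\<parallel>u\<parallel>\<^sup>2 + \<parallel>x\<parallel>\<^sup>2)\<close>, to be used for \<open>u = T x/(b - a)\<close>.\<close>

lemma F_Ioc_bound:
  assumes ab: "a < b" and x: "x \<in> D" "F a x = 0" "F b x = x"
  shows "norm (A x - a *\<^sub>R x) \<le> (b - a) * norm x"
proof -
  define T where "T x = A x - a *\<^sub>R x" for x
  define m where "m = b - a"
  have m: "m > 0" using ab by (simp add: m_def)
  have *: "2 * inner u (T x) \<le> m * (inner u u + inner x x)" if u: "u \<in> D" "F a u = 0" "F b u = u" for u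
  proof -
    have ux: "u - x \<in> D" "F a (u - x) = 0" using u x D by (auto simp: subspace_diff F_diff)
    have "0 \<le> inner (u - x) (T (u - x))"
      using F_ker[OF ux] by (simp add: T_def inner_diff_right)
    also have "\<dots> = inner u (T u) + inner x (T x) - 2 * inner u (T x)"
      using A_sym[OF u(1) x(1)] u x
      by (simp add: T_def A_diff inner_diff_left inner_diff_right algebra_simps inner_commute)
    also have "inner u (T u) \<le> m * inner u u"
      using F_range[OF u(1,3)] by (simp add: T_def m_def inner_diff_right algebra_simps)
    also have "inner x (T x) \<le> m * inner x x"
      using F_range[OF x(1,3)] by (simp add: T_def m_def inner_diff_right algebra_simps)
    finally show ?thesis by (simp add: algebra_simps)
  qed
  \<comment> \<open>\<open>T\<close> commutes with the projections, so \<open>T x\<close> belongs to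
    the spectral subspace of \<open>(a, b]\<close> like \<open>x\<close> itself.\<close>
  have Tx: "F b (T x) - F a (F b (T x)) = T x"
    using x F_A[OF x(1), of a] F_A[OF x(1), of b] A_0
    by (simp add: T_def F_diff linear_scale[OF F_linear] F_comm[of a b] linear_0[OF F_linear])
  \<comment> \<open>The inequality is wanted at a multiple of \<open>T x\<close>, which need not lie
    in \<open>D\<close>. Projecting the test vector keeps it in the subspace of
    \<open>(a, b]\<close>, and then density of \<open>D\<close> allows arbitrary
    \<open>u\<close>.\<close>
  have **: "2 * inner (F b u - F a (F b u)) (T x) \<le> m * (inner (F b u - F a (F b u)) (F b u - F a (F b u)) + inner x x)" for u
  proof (rule dense_induct[where x = u and P = "\<lambda>u. 2 * inner (F b u - F a (F b u)) (T x)
        \<le> m * (inner (F b u - F a (F b u)) (F b u - F a (F b u)) + inner x x)"])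
    show "closed {u. 2 * inner (F b u - F a (F b u)) (T x)
        \<le> m * (inner (F b u - F a (F b u)) (F b u - F a (F b u)) + inner x x)}"
      by (intro closed_Collect_le continuous_intros)
    fix u assume "u \<in> D"
    then show "2 * inner (F b u - F a (F b u)) (T x)
        \<le> m * (inner (F b u - F a (F b u)) (F b u - F a (F b u)) + inner x x)"
      using D by (intro *) (auto simp: F_D subspace_diff F_diff F_idem F_comm[of a b])
  qed
  have "2 * inner ((1/m) *\<^sub>R T x) (T x) \<le> m * (inner ((1/m) *\<^sub>R T x) ((1/m) *\<^sub>R T x) + inner x x)"
    using **[of "(1/m) *\<^sub>R T x"] Tx
    by (simp add: linear_scale[OF F_linear] flip: scaleR_diff_right)
  then have "inner (T x) (T x) \<le> m * m * inner x x"
    using m by (simp add: field_simps)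
  then have "(norm (T x))\<^sup>2 \<le> (m * norm x)\<^sup>2"
    unfolding power_mult_distrib power2_norm_eq_inner power2_eq_square[of m] .
  then have "norm (T x) \<le> m * norm x"
    by (rule power2_le_imp_le) (use m in auto)
  then show ?thesis
    unfolding T_def m_def .
qed

text \<open>The decreasing projections have a strong limit \<open>G\<close>. For \<open>y\<close> in
  the domain, the gap \<open>v = G y - F t y\<close> lies in the subspace of every interval
  \<open>(t, s n]\<close>, so \<open>F_Ioc_bound\<close> forces \<open>A v = t *\<^sub>R v\<close>;
  but then \<open>F_eigen\<close> puts \<open>v\<close> into the range of \<open>F t\<close>, where
  its projection is zero.\<close>

lemma F_right_continuous:
  assumes s: "decseq s" "s \<longlonglongrightarrow> t" "\<And>n. t < s n"
  shows "(\<lambda>n. F (s n) x) \<longlonglongrightarrow> F t x"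
proof -
  have "Cauchy (\<lambda>n. F (s n) y)" for y
  proof -
    have "decseq (\<lambda>n. (norm (F (s n) y))\<^sup>2)"
      using s(1) by (auto simp: decseq_def intro!: power_mono F_norm_mono)
    then have "Cauchy (\<lambda>n. (norm (F (s n) y))\<^sup>2)"
      using decseq_convergent[of "\<lambda>n. (norm (F (s n) y))\<^sup>2" 0] LIMSEQ_imp_Cauchy by (metis zero_le_power2)
    show ?thesis
    proof (rule metric_CauchyI)
      fix e :: real assume e: "0 < e"
      obtain N where N: "\<And>m n. m \<ge> N \<Longrightarrow> n \<ge> N \<Longrightarrow> \<bar>(norm (F (s m) y))\<^sup>2 - (norm (F (s n) y))\<^sup>2\<bar> < e\<^sup>2"
        using metric_CauchyD[OF \<open>Cauchy (\<lambda>n. (norm (F (s n) y))\<^sup>2)\<close>, of "e\<^sup>2"] e by (auto simp: dist_real_def)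
      have *: "norm (F (s m) y - F (s n) y) < e" if "m \<le> n" "m \<ge> N" for m n
      proof -
        have "(norm (F (s m) y - F (s n) y))\<^sup>2 < e\<^sup>2"
          using F_norm_diff[of "s n" "s m" y] decseqD[OF s(1) that(1)] N[of m n] that by linarith
        then show ?thesis using e by (simp add: power_less_imp_less_base)
      qed
      then have "\<forall>m\<ge>N. \<forall>n\<ge>N. dist (F (s m) y) (F (s n) y) < e"
        by (metis dist_commute dist_norm linear)
      then show "\<exists>M. \<forall>m\<ge>M. \<forall>n\<ge>M. dist (F (s m) y) (F (s n) y) < e" by blast
    qed
  qed
  then have lim: "(\<lambda>n. F (s n) y) \<longlonglongrightarrow> lim (\<lambda>n. F (s n) y)" for y
    using Cauchy_convergent convergent_LIMSEQ_iff by blast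
  define G where "G y = lim (\<lambda>n. F (s n) y)" for y
  note lim = lim[folded G_def]
  have G_D: "G y = F t y" if y: "y \<in> D" for y
  proof -
    have "G y \<in> D \<and> A (G y) = G (A y)"
      by (rule closed_op[of "\<lambda>n. F (s n) y"]) (use y lim F_D F_A in auto)
    define v where "v = G y - F t y"
    have v: "v \<in> D" using \<open>G y \<in> D \<and> _\<close> y D by (simp add: v_def F_D subspace_diff)
    have FtG: "F t (G y) = F t y"
    proof (rule LIMSEQ_unique)
      show "(\<lambda>n. F t (F (s n) y)) \<longlonglongrightarrow> F t (G y)"
        by (intro bounded_linear.tendsto[OF sym_op_bounded_linear[OF F_sym_op]] lim)
      show "(\<lambda>n. F t (F (s n) y)) \<longlonglongrightarrow> F t y"
        using F_mono[OF s(3)] by (simp add: F_comm[of t])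
    qed
    then have v1: "F t v = 0" by (simp add: v_def F_diff F_idem)
    have "F (s m) (G y) = G y" for m
    proof (rule LIMSEQ_unique)
      show "(\<lambda>n. F (s m) (F (s n) y)) \<longlonglongrightarrow> F (s m) (G y)"
        by (intro bounded_linear.tendsto[OF sym_op_bounded_linear[OF F_sym_op]] lim)
      have "\<forall>\<^sub>F n in sequentially. F (s n) y = F (s m) (F (s n) y)"
        using eventually_ge_at_top[of m]
        by (rule eventually_mono) (use F_mono'[OF decseqD[OF s(1)]] in auto)
      with lim show "(\<lambda>n. F (s m) (F (s n) y)) \<longlonglongrightarrow> G y"
        by (rule Lim_transform_eventually)
    qed
    then have v2: "F (s m) v = v" for m
      using F_mono[OF s(3)] by (simp add: v_def F_diff)
    have "norm (A v - t *\<^sub>R v) \<le> (s n - t) * norm v" for n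
      by (rule F_Ioc_bound[OF s(3) v v1 v2])
    moreover have "(\<lambda>n. (s n - t) * norm v) \<longlonglongrightarrow> (t - t) * norm v"
      by (intro tendsto_intros s)
    ultimately have "norm (A v - t *\<^sub>R v) \<le> (t - t) * norm v"
      by (intro LIMSEQ_le_const) auto
    then have "F t v = v"
      by (intro F_eigen v) auto
    then show ?thesis using v1 by (simp add: v_def)
  qed
  have Gdiff: "norm (G y - G z) \<le> norm (y - z)" for y z
  proof -
    have "(\<lambda>n. norm (F (s n) y - F (s n) z)) \<longlonglongrightarrow> norm (G y - G z)"
      by (intro tendsto_intros lim)
    then show ?thesis
      by (rule LIMSEQ_le_const2) (auto simp: F_contr simp flip: F_diff)
  qed
  have "G x = F t x"
  proof (rule dense_induct[where x = x and P = "\<lambda>x. G x = F t x"])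
    have "continuous_on UNIV G"
      unfolding continuous_on_iff using Gdiff
      by (metis UNIV_I dist_norm le_less_trans)
    then show "closed {x. G x = F t x}"
      by (intro closed_Collect_eq continuous_intros)
  qed (rule G_D)
  then show ?thesis using lim[of x] by simp
qed

lemma contraction_limit_dense:
  fixes G :: "nat \<Rightarrow> 'a \<Rightarrow> 'a"
  assumes lin: "\<And>n. linear (G n)" and bound: "\<And>n x. norm (G n x) \<le> norm x"
    and "\<And>x. x \<in> D \<Longrightarrow> (\<lambda>n. G n x) \<longlonglongrightarrow> 0"
  shows "(\<lambda>n. G n x) \<longlonglongrightarrow> 0"
proof (rule LIMSEQ_I)
  fix e :: real assume e: "e > 0"
  have "x \<in> closure D" using dense by simp
  then obtain y where y: "y \<in> D" "dist y x < e/2"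
    using e closure_approachable[of x D] by (metis half_gt_zero)
  obtain N where N: "\<And>n. n \<ge> N \<Longrightarrow> norm (G n y) < e/2"
    using LIMSEQ_D[OF assms(3)[OF y(1)], of "e/2"] e by auto
  have "norm (G n x - 0) < e" if "n \<ge> N" for n
  proof -
    have "G n x = G n y + G n (x - y)" by (simp add: linear_diff[OF lin])
    then have "norm (G n x) \<le> norm (G n y) + norm (G n (x - y))" by (metis norm_triangle_ineq)
    also have "\<dots> < e/2 + e/2"
      using N[OF that] bound[of n "x - y"] y(2) by (intro add_strict_mono) (auto simp: dist_norm norm_minus_commute)
    finally show ?thesis by simp
  qed
  then show "\<exists>no. \<forall>n\<ge>no. norm (G n x - 0) < e" by blast
qed

text \<open>On the range of \<open>F (- n)\<close> the form is at most \<open>- n\<close> times the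
  squared norm. With Cauchy-Schwarz the projected vector \<open>y\<close> satisfies
  \<open>n * norm y \<le> norm (A x)\<close>, which settles the dense domain;
  \<open>F_at_top\<close> is the mirror image.\<close>

lemma F_at_bot: "(\<lambda>n. F (- real n) x) \<longlonglongrightarrow> 0"
proof (rule contraction_limit_dense[OF F_linear F_contr])
  fix x assume x: "x \<in> D"
  have *: "real n * norm (F (- real n) x) \<le> norm (A x)" for n
  proof -
    let ?y = "F (- real n) x"
    have "real n * (norm ?y)\<^sup>2 \<le> - inner ?y (A ?y)"
      using F_range[of ?y "- real n"] x by (simp add: F_D F_idem power2_norm_eq_inner)
    also have "\<dots> \<le> norm ?y * norm (A ?y)"
      using norm_cauchy_schwarz[of "- ?y" "A ?y"] by simp
    also have "\<dots> \<le> norm ?y * norm (A x)"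
      using x by (intro mult_left_mono) (auto simp: F_A F_contr)
    finally show ?thesis
      by (cases "norm ?y = 0") (auto simp: power2_eq_square)
  qed
  have "norm (F (- real n) x) \<le> norm (A x) * inverse (real n)" if "n > 0" for n
    using *[of n] that by (simp add: field_simps)
  moreover have "(\<lambda>n. norm (A x) * inverse (real n)) \<longlonglongrightarrow> norm (A x) * 0"
    by (intro tendsto_intros lim_inverse_n)
  ultimately show "(\<lambda>n. F (- real n) x) \<longlonglongrightarrow> 0"
    using Lim_null_comparison[OF eventually_sequentiallyI[of 1 "\<lambda>n. norm (F (- real n) x) \<le> norm (A x) * inverse (real n)"]]
    by simp
qed

lemma F_at_top: "(\<lambda>n. F (real n) x) \<longlonglongrightarrow> x"
proof -
  have bound: "norm (x - F t x) \<le> norm x" for x t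
  proof -
    have "(norm (x - F t x))\<^sup>2 = (norm x)\<^sup>2 - (norm (F t x))\<^sup>2"
      using F_norm_sq[of x t] unfolding power2_norm_eq_inner
      by (simp add: inner_diff_left inner_diff_right inner_commute)
    then have "(norm (x - F t x))\<^sup>2 \<le> (norm x)\<^sup>2" by simp
    then show ?thesis by (rule power2_le_imp_le) simp
  qed
  have "(\<lambda>n. x - F (real n) x) \<longlonglongrightarrow> 0"
  proof (rule contraction_limit_dense[OF _ bound])
    show "linear (\<lambda>x. x - F (real n) x)" for n
      by (intro linear_compose_sub F_linear linear_ident)
    fix x assume x: "x \<in> D"
    have *: "real n * norm (x - F (real n) x) \<le> norm (A x)" for n
    proof -
      let ?y = "x - F (real n) x"
      have y: "?y \<in> D" using x D by (simp add: F_D subspace_diff)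
      have "real n * (norm ?y)\<^sup>2 \<le> inner ?y (A ?y)"
        using F_ker[of ?y "real n"] y by (simp add: F_diff F_idem power2_norm_eq_inner)
      also have "\<dots> \<le> norm ?y * norm (A ?y)"
        by (rule norm_cauchy_schwarz)
      also have "\<dots> \<le> norm ?y * norm (A x)"
        using x bound[of "A x"] by (intro mult_left_mono) (auto simp: A_diff F_D F_A)
      finally show ?thesis
        by (cases "norm ?y = 0") (auto simp: power2_eq_square)
    qed
    have "norm (x - F (real n) x) \<le> norm (A x) * inverse (real n)" if "n > 0" for n
      using *[of n] that by (simp add: field_simps)
    moreover have "(\<lambda>n. norm (A x) * inverse (real n)) \<longlonglongrightarrow> norm (A x) * 0"
      by (intro tendsto_intros lim_inverse_n)
    ultimately show "(\<lambda>n. x - F (real n) x) \<longlonglongrightarrow> 0"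
      using Lim_null_comparison[OF eventually_sequentiallyI[of 1 "\<lambda>n. norm (x - F (real n) x) \<le> norm (A x) * inverse (real n)"]]
      by simp
  qed
  from tendsto_diff[OF tendsto_const[of x] this] show ?thesis by simp
qed

end

subsection \<open>Complex Hilbert spaces\<close>

lemma cinner_scaleC_right: "cinner x (a *\<^sub>C y) = a * cinner x (y::'a::chilbert_space)"
  by (metis cinner_commute cinner_scaleC_left complex_cnj_cnj complex_cnj_mult)

lemma cinner_add_right: "cinner x (y + z) = cinner x y + cinner x (z::'a::chilbert_space)"
  by (metis cinner_add_left cinner_commute complex_cnj_add)

text \<open>Conjugate linearity in the first argument makes the real part of
  \<open>cinner (\<i> *\<^sub>C x) y\<close> equal to the imaginary part of
  \<open>cinner x y\<close>.\<close>

lemma cinner_eq_inner: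
  fixes x y :: "'a::chilbert_space"
  shows "cinner x y = Complex (inner x y) (inner (\<i> *\<^sub>C x) y)"
  by (simp add: inner_eq_Re_cinner cinner_scaleC_left complex_eq_iff)

lemma cinner_self: "cinner x x = complex_of_real ((norm (x::'a::chilbert_space))\<^sup>2)"
proof -
  have "Im (cinner x x) = - Im (cinner x x)"
    by (subst cinner_commute) simp
  then show ?thesis
    by (simp add: complex_eq_iff power2_norm_eq_inner inner_eq_Re_cinner)
qed

lemma norm_scaleC: "norm (a *\<^sub>C (x::'a::chilbert_space)) = cmod a * norm x"
proof -
  have "complex_of_real ((norm (a *\<^sub>C x))\<^sup>2) = cnj a * (a * complex_of_real ((norm x)\<^sup>2))"
    by (simp only: cinner_self[symmetric] cinner_scaleC_left cinner_scaleC_right mult.left_commute)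
  also have "\<dots> = complex_of_real ((cmod a * norm x)\<^sup>2)"
    using complex_norm_square[of a] by (simp add: power_mult_distrib mult.commute mult.left_commute)
  finally show ?thesis
    by (simp only: of_real_eq_iff) simp
qed

lemma bounded_bilinear_scaleC: "bounded_bilinear ((*\<^sub>C) :: complex \<Rightarrow> 'a::chilbert_space \<Rightarrow> 'a)"
proof
  show "(r *\<^sub>R a) *\<^sub>C b = r *\<^sub>R (a *\<^sub>C b)" for r a and b :: 'a
    by (simp add: scaleR_scaleC scaleC_scaleC scaleR_conv_of_real)
  show "a *\<^sub>C (r *\<^sub>R b) = r *\<^sub>R (a *\<^sub>C b)" for r a and b :: 'a
    by (simp add: scaleR_scaleC scaleC_scaleC mult.commute)
  show "\<exists>K. \<forall>a (b::'a). norm (a *\<^sub>C b) \<le> norm a * norm b * K"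
    by (rule exI[of _ 1]) (simp add: norm_scaleC)
qed (auto simp: scaleC_add_left scaleC_add_right)

interpretation scaleC: bounded_bilinear "(*\<^sub>C) :: complex \<Rightarrow> 'a::chilbert_space \<Rightarrow> 'a"
  by (rule bounded_bilinear_scaleC)

lemmas [tendsto_intros] = scaleC.tendsto

lemma scaleC_one [simp]: "1 *\<^sub>C (x::'a::chilbert_space) = x"
  using scaleR_scaleC[of 1 x] by simp

lemma scaleC_complex: "c *\<^sub>C (x::'a::chilbert_space) = Re c *\<^sub>R x + Im c *\<^sub>R (\<i> *\<^sub>C x)"
proof -
  have c: "c = complex_of_real (Re c) + complex_of_real (Im c) * \<i>"
    by (simp add: complex_eq_iff)
  show ?thesis
    by (simp only: scaleR_scaleC scaleC_scaleC scaleC_add_left[symmetric] c[symmetric])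
qed

lemma inner_i_scaleC: "inner (\<i> *\<^sub>C x) y = - inner x (\<i> *\<^sub>C (y::'a::chilbert_space))"
  by (simp add: inner_eq_Re_cinner cinner_scaleC_left cinner_scaleC_right)

lemma cinner_zero_right [simp]: "cinner x (0::'a::chilbert_space) = 0"
  using cinner_add_right[of x 0 0] by simp

lemma cinner_zero_left [simp]: "cinner (0::'a::chilbert_space) x = 0"
  using cinner_add_left[of 0 0 x] by simp

lemma tendsto_cinner [tendsto_intros]:
  fixes f g :: "'b \<Rightarrow> 'a::chilbert_space"
  assumes "(f \<longlongrightarrow> x) net" "(g \<longlongrightarrow> y) net"
  shows "((\<lambda>n. cinner (f n) (g n)) \<longlongrightarrow> cinner x y) net"
  unfolding cinner_eq_inner by (intro tendsto_intros assms)

text \<open>The bridge from the real theory. Commutation with \<open>\<i>\<close> gives complex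
  linearity, and by \<open>cinner_eq_inner\<close> it also upgrades real symmetry to the complex
  adjoint relation.\<close>

lemma orth_projection_iff:
  fixes P :: "'a::chilbert_space \<Rightarrow> 'a"
  shows "orth_projection P \<longleftrightarrow> sym_op P \<and> (\<forall>x. P (P x) = P x) \<and> (\<forall>x. P (\<i> *\<^sub>C x) = \<i> *\<^sub>C P x)"
    (is "?L \<longleftrightarrow> ?R")
proof
  assume L: ?L
  then have add: "P (x + y) = P x + P y" and sc: "P (c *\<^sub>C x) = c *\<^sub>C P x"
    and idem: "P (P x) = P x" and adj: "cinner (P x) y = cinner x (P y)" for x y c
    by (auto simp: orth_projection_def clinear_on_def is_adjoint_def)
  have "norm (P x) \<le> norm x * 1" for x
  proof -
    have "(norm (P x))\<^sup>2 = inner x (P x)"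
      by (simp add: power2_norm_eq_inner inner_eq_Re_cinner adj idem)
    also have "\<dots> \<le> norm x * norm (P x)" by (rule norm_cauchy_schwarz)
    finally show ?thesis
      by (cases "norm (P x) = 0") (auto simp: power2_eq_square)
  qed
  then have "bounded_linear P"
    by (intro bounded_linear_intro[where K = 1]) (auto simp: add sc scaleR_scaleC)
  then show ?R by (simp add: sym_op_def idem sc inner_eq_Re_cinner adj)
next
  assume R: ?R
  then have lin: "linear P" and sym: "\<And>x y. inner (P x) y = inner x (P y)"
    and i: "\<And>x. P (\<i> *\<^sub>C x) = \<i> *\<^sub>C P x" and idem: "\<And>x. P (P x) = P x"
    by (auto simp: sym_op_def bounded_linear.linear)
  have "P (c *\<^sub>C x) = c *\<^sub>C P x" for c x
    by (subst (1 2) scaleC_complex) (simp add: linear_add[OF lin] linear_scale[OF lin] i)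
  moreover have "cinner (P x) y = cinner x (P y)" for x y
    by (simp add: cinner_eq_inner sym flip: i)
  ultimately show ?L
    by (simp add: orth_projection_def clinear_on_def is_adjoint_def csubspace_def idem linear_add[OF lin])
qed

lemma orth_projectionD:
  assumes "orth_projection P"
  shows "P (x + y) = P x + P y" "P (x - y) = P x - P y" "P (c *\<^sub>C x) = c *\<^sub>C P x" "P (P x) = P x"
    "cinner (P x) y = cinner x (P y)" "inner (P x) y = inner x (P y)" "bounded_linear P"
    "norm (P x) \<le> norm x" "inner x (P x) = (norm (P x))\<^sup>2" "P 0 = 0"
    "(norm (x - P x))\<^sup>2 = (norm x)\<^sup>2 - (norm (P x))\<^sup>2"
proof -
  have 1: "sym_op P" "P (P x) = P x" for x
    using assms by (auto simp: orth_projection_iff)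
  show "P (x + y) = P x + P y" "P (x - y) = P x - P y" "P 0 = 0"
    using sym_op_linear[OF 1(1)] linear_add linear_diff linear_0 by blast+
  show "P (c *\<^sub>C x) = c *\<^sub>C P x" "P (P x) = P x" "cinner (P x) y = cinner x (P y)"
    using assms by (auto simp: orth_projection_def clinear_on_def is_adjoint_def)
  show "bounded_linear P" "inner (P x) y = inner x (P y)"
    using 1(1) by (auto simp: sym_op_def)
  show 2: "inner x (P x) = (norm (P x))\<^sup>2"
    using sym_opD[OF 1(1), of x "P x"] by (simp add: 1(2) power2_norm_eq_inner)
  show "(norm (x - P x))\<^sup>2 = (norm x)\<^sup>2 - (norm (P x))\<^sup>2"
    using 2 unfolding power2_norm_eq_inner
    by (simp add: inner_diff_left inner_diff_right inner_commute)
  then have "(norm (P x))\<^sup>2 \<le> (norm x)\<^sup>2"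
    using zero_le_power2[of "norm (x - P x)"] by linarith
  then show "norm (P x) \<le> norm x"
    by (rule power2_le_imp_le) simp
qed

text \<open>The difference \<open>K\<close> is symmetric with vanishing quadratic form, and the form
  at \<open>x + K x\<close> equals twice the squared norm of \<open>K x\<close>. Projections are
  thus identified through their scalar measures.\<close>

lemma orth_projection_eqI:
  assumes P: "orth_projection P" and Q: "orth_projection Q"
    and eq: "\<And>x. norm (P x) = norm (Q x)"
  shows "P x = Q x"
proof -
  define K where "K x = P x - Q x" for x
  have K0: "inner x (K x) = 0" for x
    using orth_projectionD(9)[OF P, of x] orth_projectionD(9)[OF Q, of x] eq[of x]
    by (simp add: K_def inner_diff_right)
  have K: "K (x + y) = K x + K y" and sym: "inner (K x) y = inner x (K y)" for x y
    using orth_projectionD(1,6)[OF P] orth_projectionD(1,6)[OF Q]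
    by (auto simp: K_def inner_diff_left inner_diff_right)
  have "0 = inner (x + K x) (K (x + K x))" by (simp add: K0)
  also have "\<dots> = inner x (K x) + inner x (K (K x)) + inner (K x) (K x) + inner (K x) (K (K x))"
    by (simp only: K inner_add_left inner_add_right)
  also have "\<dots> = 2 * inner (K x) (K x)"
    by (simp add: K0 flip: sym)
  finally show ?thesis by (simp add: K_def)
qed

subsection \<open>Integration with respect to a projection-valued measure\<close>

lemma cmod_add_squared_le: "(cmod (a + b))\<^sup>2 \<le> 2 * (cmod a)\<^sup>2 + 2 * (cmod b)\<^sup>2"
proof -
  have "(cmod (a + b))\<^sup>2 \<le> (cmod a + cmod b)\<^sup>2"
    by (intro power_mono norm_triangle_ineq) auto
  also have "\<dots> \<le> 2 * (cmod a)\<^sup>2 + 2 * (cmod b)\<^sup>2"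
    using sum_squares_bound[of "cmod a" "cmod b"] by (simp add: power2_sum)
  finally show ?thesis .
qed

locale projection_valued_measure =
  fixes E :: "real set \<Rightarrow> 'a::chilbert_space \<Rightarrow> 'a"
  assumes pvm: "pvm E"
begin

lemma proj: "S \<in> sets borel \<Longrightarrow> orth_projection (E S)"
  using pvm by (auto simp: pvm_def)

lemma E_UNIV [simp]: "E UNIV x = x"
  using pvm by (auto simp: pvm_def)

lemma E_sums:
  fixes S :: "nat \<Rightarrow> real set"
  assumes "range S \<subseteq> sets borel" "disjoint_family S"
  shows "(\<lambda>n. E (S n) x) sums E (\<Union>n. S n) x"
  using pvm assms by (auto simp: pvm_def)

lemmas E_add = orth_projectionD(1)[OF proj]
  and E_diff = orth_projectionD(2)[OF proj]
  and E_scaleC = orth_projectionD(3)[OF proj]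
  and E_idem = orth_projectionD(4)[OF proj]
  and E_cinner = orth_projectionD(5)[OF proj]
  and E_bounded_linear = orth_projectionD(7)[OF proj]
  and E_contr = orth_projectionD(8)[OF proj]
  and E_inner = orth_projectionD(9)[OF proj]
  and E_zero = orth_projectionD(10)[OF proj]

lemma E_empty [simp]: "E {} x = 0"
proof -
  have "(\<lambda>n. E {} x) sums E {} x"
    using E_sums[of "\<lambda>_. {}" x] by (simp add: disjoint_family_on_def)
  then have "(\<lambda>n::nat. E {} x) \<longlonglongrightarrow> 0"
    using sums_summable summable_LIMSEQ_zero by blast
  then show ?thesis by (simp add: tendsto_const_iff)
qed

lemma E_Un:
  assumes "S \<in> sets borel" "T \<in> sets borel" "S \<inter> T = {}"
  shows "E (S \<union> T) x = E S x + E T x"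
proof -
  have "(\<lambda>n. E (binaryset S T n) x) sums E (\<Union>n. binaryset S T n) x"
    using assms by (intro E_sums) (auto simp: range_binaryset_eq disjoint_family_on_def binaryset_def)
  moreover have "(\<lambda>n. E (binaryset S T n) x) sums (\<Sum>n\<in>{0,1}. E (binaryset S T n) x)"
    by (intro sums_finite) (auto simp: binaryset_def)
  ultimately show ?thesis
    using sums_unique2 by (force simp: UN_binaryset_eq binaryset_def)
qed

lemma E_UN:
  assumes "finite I" "\<And>i. i \<in> I \<Longrightarrow> S i \<in> sets borel" "disjoint_family_on S I"
  shows "E (\<Union>i\<in>I. S i) x = (\<Sum>i\<in>I. E (S i) x)"
  using assms
proof (induction I rule: finite_induct)
  case (insert i I)
  have "S i \<inter> (\<Union>i\<in>I. S i) = {}"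
    using insert.prems(2) insert.hyps by (fastforce simp: disjoint_family_on_def)
  moreover have "(\<Union>i\<in>I. S i) \<in> sets borel"
    using insert by (intro sets.finite_UN) auto
  ultimately have "E (S i \<union> (\<Union>i\<in>I. S i)) x = E (S i) x + E (\<Union>i\<in>I. S i) x"
    using insert.prems by (intro E_Un) auto
  then show ?case
    using insert by (auto simp: disjoint_family_on_def)
qed simp

text \<open>For a vector \<open>y\<close> in the range of \<open>E S\<close>, additivity and
  contractivity bound the squared norms of \<open>E S y\<close> and \<open>E T y\<close> together by
  that of \<open>y\<close>, which the first one already exhausts.\<close>

lemma E_disjoint:
  assumes "S \<in> sets borel" "T \<in> sets borel" "S \<inter> T = {}"
  shows "E T (E S x) = 0"
proof -
  let ?y = "E S x"
  have "inner ?y (E (S \<union> T) ?y) = (norm (E S ?y))\<^sup>2 + (norm (E T ?y))\<^sup>2"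
    using assms by (simp add: E_Un inner_add_right E_inner)
  moreover have "inner ?y (E (S \<union> T) ?y) \<le> (norm ?y)\<^sup>2"
    using assms E_inner[of "S \<union> T" ?y] E_contr[of "S \<union> T" ?y] by (simp add: power_mono)
  ultimately show ?thesis
    using assms by (simp add: E_idem)
qed

lemma E_Int:
  assumes [measurable]: "S \<in> sets borel" "T \<in> sets borel"
  shows "E S (E T x) = E (S \<inter> T) x"
proof -
  have "E S (E T x) = E S (E (T \<inter> S) x + E (T - S) x)"
    using E_Un[of "T \<inter> S" "T - S" x] by (simp add: Int_Diff_disjoint Int_Diff_Un)
  also have "\<dots> = E S (E (T \<inter> S) x)"
  proof -
    have "(T - S) \<inter> S = {}" by auto
    then show ?thesis using E_disjoint[of "T - S" S x] by (simp add: E_add)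
  qed
  also have "\<dots> = E (S \<inter> T) (E (T \<inter> S) x) + E (S - T) (E (T \<inter> S) x)"
    using E_Un[of "S \<inter> T" "S - T" "E (T \<inter> S) x"] by (simp add: Int_Diff_disjoint Int_Diff_Un)
  also have "E (S - T) (E (T \<inter> S) x) = 0"
    by (rule E_disjoint) auto
  finally show ?thesis by (simp add: Int_commute E_idem)
qed

abbreviation "\<mu> \<equiv> pvm_measure E"

lemma sets_mu [simp, measurable_cong]: "sets (\<mu> x) = sets borel"
  unfolding pvm_measure_def using sets.sigma_sets_eq[of "borel :: real measure"]
  by (simp add: sets_measure_of)

lemma space_mu [simp]: "space (\<mu> x) = UNIV"
  using sets_eq_imp_space_eq[OF sets_mu] by simp

lemma emeasure_mu:
  assumes "S \<in> sets borel"
  shows "emeasure (\<mu> x) S = ennreal ((norm (E S x))\<^sup>2)"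
proof (rule emeasure_measure_of[OF pvm_measure_def])
  show "sets borel \<subseteq> Pow UNIV" "S \<in> sets (\<mu> x)" using assms by auto
  show "positive (sets (\<mu> x)) (\<lambda>S. ennreal ((norm (E S x))\<^sup>2))"
    by (simp add: positive_def)
  show "countably_additive (sets (\<mu> x)) (\<lambda>S. ennreal ((norm (E S x))\<^sup>2))"
  proof (rule countably_additiveI)
    fix T :: "nat \<Rightarrow> real set"
    assume T: "range T \<subseteq> sets (\<mu> x)" "disjoint_family T" "\<Union> (range T) \<in> sets (\<mu> x)"
    have "(\<lambda>n. inner x (E (T n) x)) sums inner x (E (\<Union>n. T n) x)"
      using T by (intro bounded_linear.sums[OF bounded_linear_inner_right] E_sums) auto
    then have "(\<lambda>n. (norm (E (T n) x))\<^sup>2) sums (norm (E (\<Union>n. T n) x))\<^sup>2"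
      using T by (simp add: E_inner range_subsetD)
    then show "(\<Sum>n. ennreal ((norm (E (T n) x))\<^sup>2)) = ennreal ((norm (E (\<Union> (range T)) x))\<^sup>2)"
      by (intro sums_unique[symmetric]) simp
  qed
qed

text \<open>The squared seminorm of L2 for the scalar measure of \<open>x\<close>. Values in
  \<open>ennreal\<close> let the domain condition be written as
  \<open>sq x f < \<infinity>\<close>.\<close>

definition sq :: "'a \<Rightarrow> (real \<Rightarrow> complex) \<Rightarrow> ennreal" where
  "sq x f = (\<integral>\<^sup>+ a. ennreal ((cmod (f a))\<^sup>2) \<partial>\<mu> x)"

lemma sq_add_le:
  assumes [measurable]: "f \<in> borel_measurable borel" "g \<in> borel_measurable borel"
  shows "sq x (\<lambda>a. f a + g a) \<le> 2 * sq x f + 2 * sq x g"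
proof -
  have "sq x (\<lambda>a. f a + g a) \<le> (\<integral>\<^sup>+ a. 2 * ennreal ((cmod (f a))\<^sup>2) + 2 * ennreal ((cmod (g a))\<^sup>2) \<partial>\<mu> x)"
    unfolding sq_def
  proof (rule nn_integral_mono)
    fix a
    have "ennreal ((cmod (f a + g a))\<^sup>2) \<le> ennreal (2 * (cmod (f a))\<^sup>2 + 2 * (cmod (g a))\<^sup>2)"
      by (intro ennreal_leI cmod_add_squared_le)
    then show "ennreal ((cmod (f a + g a))\<^sup>2) \<le> 2 * ennreal ((cmod (f a))\<^sup>2) + 2 * ennreal ((cmod (g a))\<^sup>2)"
      by (simp add: ennreal_plus ennreal_mult')
  qed
  also have "\<dots> = 2 * sq x f + 2 * sq x g"
    unfolding sq_def by (subst nn_integral_add) (auto simp: nn_integral_cmult)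
  finally show ?thesis .
qed

lemma sq_minus_commute: "sq x (\<lambda>a. f a - g a) = sq x (\<lambda>a. g a - f a)"
  unfolding sq_def by (simp add: norm_minus_commute)

lemma sq_cmult: "f \<in> borel_measurable borel \<Longrightarrow> sq x (\<lambda>a. c * f a) = ennreal ((cmod c)\<^sup>2) * sq x f"
  unfolding sq_def by (simp add: norm_mult power_mult_distrib ennreal_mult nn_integral_cmult)

abbreviation "psi \<equiv> pvm_simple_integral E"

text \<open>The sum may be taken over the level sets of a finer simple function. With a pair of
  simple functions as \<open>\<phi>\<close> this gives a common partition, on which algebraic
  identities hold term by term.\<close>

lemma psi_comp:
  assumes \<phi>: "simple_function borel \<phi>"
  shows "psi (\<lambda>a. g (\<phi> a)) x = (\<Sum>p\<in>range \<phi>. g p *\<^sub>C E (\<phi> -` {p}) x)"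
proof -
  have fin: "finite (range \<phi>)"
    using simple_functionD(1)[OF \<phi>] by simp
  have [measurable]: "\<phi> -` {p} \<in> sets borel" for p
    using simple_functionD(2)[OF \<phi>, of "{p}"] by simp
  have "E ((\<lambda>a. g (\<phi> a)) -` {v}) x = (\<Sum>p | p \<in> range \<phi> \<and> g p = v. E (\<phi> -` {p}) x)" for v
  proof -
    have "(\<lambda>a. g (\<phi> a)) -` {v} = (\<Union>p\<in>{p \<in> range \<phi>. g p = v}. \<phi> -` {p})"
      by auto
    then show ?thesis
      using fin by (simp only:) (rule E_UN, auto simp: disjoint_family_on_def)
  qed
  then have "psi (\<lambda>a. g (\<phi> a)) x =
      (\<Sum>v\<in>range (\<lambda>a. g (\<phi> a)). \<Sum>p | p \<in> range \<phi> \<and> g p = v. g p *\<^sub>C E (\<phi> -` {p}) x)"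
    unfolding pvm_simple_integral_def by (simp add: scaleC.sum_right)
  also have "\<dots> = (\<Sum>p\<in>range \<phi>. g p *\<^sub>C E (\<phi> -` {p}) x)"
    using sum.image_gen[OF fin, of "\<lambda>p. g p *\<^sub>C E (\<phi> -` {p}) x" g]
    by (simp add: image_image)
  finally show ?thesis .
qed

lemma psi_add:
  assumes "simple_function borel s" "simple_function borel t"
  shows "psi (\<lambda>a. s a + t a) x = psi s x + psi t x"
proof -
  have \<phi>: "simple_function borel (\<lambda>a. (s a, t a))"
    by (rule simple_function_Pair[OF assms])
  show ?thesis
    using psi_comp[OF \<phi>, of "\<lambda>(u, v). u + v" x] psi_comp[OF \<phi>, of fst x] psi_comp[OF \<phi>, of snd x]
    by (simp add: case_prod_beta scaleC_add_left sum.distrib)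
qed

lemma psi_cmult:
  assumes "simple_function borel s"
  shows "psi (\<lambda>a. c * s a) x = c *\<^sub>C psi s x"
  using psi_comp[OF assms, of "\<lambda>v. c * v" x] psi_comp[OF assms, of "\<lambda>v. v" x]
  by (simp add: scaleC.sum_right scaleC_scaleC)

lemma psi_diff:
  assumes "simple_function borel s" "simple_function borel t"
  shows "psi (\<lambda>a. s a - t a) x = psi s x - psi t x"
  using psi_add[OF assms(1), of "\<lambda>a. - 1 * t a" x] psi_cmult[OF assms(2), of "-1" x]
    simple_function_mult[OF simple_function_const[of _ "-1"] assms(2)] scaleR_scaleC[of "-1" "psi t x"]
  by simp

lemma simple_vimage [measurable]: "simple_function borel s \<Longrightarrow> s -` {v} \<in> sets (borel :: real measure)"
  using simple_functionD(2)[of borel s "{v}"] by simp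

lemma psi_vector_add: "simple_function borel s \<Longrightarrow> psi s (x + y) = psi s x + psi s y"
  unfolding pvm_simple_integral_def
  by (simp add: E_add scaleC_add_right sum.distrib simple_vimage)

lemma psi_vector_scaleC: "simple_function borel s \<Longrightarrow> psi s (c *\<^sub>C x) = c *\<^sub>C psi s x"
  unfolding pvm_simple_integral_def
  by (simp add: E_scaleC scaleC.sum_right scaleC_scaleC mult.commute simple_vimage)

lemma psi_cinner:
  assumes s: "simple_function borel s"
  shows "cinner (psi s x) y = cinner x (psi (\<lambda>a. cnj (s a)) y)"
proof -
  have l: "cinner (\<Sum>v\<in>V. f v) y = (\<Sum>v\<in>V. cinner (f v) y)" for f :: "complex \<Rightarrow> 'a" and V
    by (induction V rule: infinite_finite_induct) (auto simp: cinner_add_left)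
  have r: "cinner x (\<Sum>v\<in>V. f v) = (\<Sum>v\<in>V. cinner x (f v))" for f :: "complex \<Rightarrow> 'a" and V
    by (induction V rule: infinite_finite_induct) (auto simp: cinner_add_right)
  show ?thesis
    unfolding psi_comp[OF s, of cnj] unfolding pvm_simple_integral_def l r
    by (simp add: cinner_scaleC_left cinner_scaleC_right E_cinner simple_vimage s)
qed

lemma psi_E:
  assumes s: "simple_function borel s" and S: "S \<in> sets borel"
  shows "psi (\<lambda>a. indicator S a * s a) x = E S (psi s x)"
proof -
  have ind: "simple_function borel (indicator S :: real \<Rightarrow> complex)"
    using S by (intro simple_function_indicator) simp
  have \<phi>: "simple_function borel (\<lambda>a. (indicator S a :: complex, s a))"
    by (rule simple_function_Pair[OF ind s])
  have fin: "finite (range (\<lambda>a. (indicator S a :: complex, s a)))"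
    using simple_functionD(1)[OF \<phi>] by simp
  have [measurable]: "(\<lambda>a. (indicator S a :: complex, s a)) -` {p} \<in> sets borel" for p
    using simple_functionD(2)[OF \<phi>, of "{p}"] by simp
  have "(fst p * snd p) *\<^sub>C E ((\<lambda>a. (indicator S a, s a)) -` {p}) x
      = E S (snd p *\<^sub>C E ((\<lambda>a. (indicator S a, s a)) -` {p}) x)"
    if "p \<in> range (\<lambda>a. (indicator S a :: complex, s a))" for p
  proof (cases "fst p = 1")
    case True
    then have "S \<inter> (\<lambda>a. (indicator S a, s a)) -` {p} = (\<lambda>a. (indicator S a, s a)) -` {p}"
      by (auto simp: indicator_def)
    then show ?thesis using True S by (simp add: E_scaleC E_Int)
  next
    case False
    then have "fst p = 0" using that by (auto simp: indicator_def split: if_splits)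
    then have "S \<inter> (\<lambda>a. (indicator S a, s a)) -` {p} = {}"
      by (auto simp: indicator_def)
    then show ?thesis using \<open>fst p = 0\<close> S by (simp add: E_scaleC E_Int scaleC.zero_left scaleC.zero_right)
  qed
  moreover have "E S (\<Sum>p\<in>V. f p) = (\<Sum>p\<in>V. E S (f p))" for f :: "complex \<times> complex \<Rightarrow> 'a" and V
    by (induction V rule: infinite_finite_induct) (auto simp: E_add E_zero S)
  ultimately show ?thesis
    using psi_comp[OF \<phi>, of "\<lambda>p. fst p * snd p" x] psi_comp[OF \<phi>, of snd x] by simp
qed

text \<open>By \<open>psi_cinner\<close> and orthogonality of the level sets, the squared norm is
  the form of the integral of the squared modulus of \<open>s\<close>. This isometry controls every
  limit taken below.\<close>

lemma psi_norm:
  assumes s: "simple_function borel s"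
  shows "ennreal ((norm (psi s x))\<^sup>2) = sq x s"
proof -
  note fin = simple_functionD(1)[OF s, simplified]
  have mult: "psi (\<lambda>a. cnj (s a)) (psi s x) = psi (\<lambda>a. cnj (s a) * s a) x"
  proof -
    have "psi (\<lambda>a. cnj (s a)) (psi s x) = (\<Sum>v\<in>range s. cnj v *\<^sub>C E (s -` {v}) (psi s x))"
      using psi_comp[OF s, of cnj] by simp
    also have "\<dots> = (\<Sum>v\<in>range s. cnj v *\<^sub>C (v *\<^sub>C E (s -` {v}) x))"
    proof (rule sum.cong[OF refl])
      fix v assume v: "v \<in> range s"
      have "E (s -` {v}) (psi s x) = psi (\<lambda>a. indicator (s -` {v}) a * s a) x"
        using psi_E[OF s, of "s -` {v}"] s by (simp add: simple_vimage)
      also have "(\<lambda>a. indicator (s -` {v}) a * s a) = (\<lambda>a. (if s a = v then v else 0))"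
        by (auto simp: indicator_def)
      also have "psi \<dots> x = (\<Sum>p\<in>range s. (if p = v then v else 0) *\<^sub>C E (s -` {p}) x)"
        by (rule psi_comp[OF s])
      also have "\<dots> = (\<Sum>p\<in>range s. if p = v then v *\<^sub>C E (s -` {p}) x else 0)"
        by (intro sum.cong refl) (simp add: scaleC.zero_left)
      also have "\<dots> = v *\<^sub>C E (s -` {v}) x"
        using fin v by (simp add: sum.delta')
      finally show "cnj v *\<^sub>C E (s -` {v}) (psi s x) = cnj v *\<^sub>C (v *\<^sub>C E (s -` {v}) x)"
        by simp
    qed
    also have "\<dots> = psi (\<lambda>a. cnj (s a) * s a) x"
      using psi_comp[OF s, of "\<lambda>v. cnj v * v" x] by (simp add: scaleC_scaleC)
    finally show ?thesis .
  qed
  have "(norm (psi s x))\<^sup>2 = inner x (psi (\<lambda>a. cnj (s a) * s a) x)"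
    by (simp only: power2_norm_eq_inner inner_eq_Re_cinner psi_cinner[OF s] mult)
  also have "\<dots> = (\<Sum>v\<in>range s. (cmod v)\<^sup>2 * (norm (E (s -` {v}) x))\<^sup>2)"
    unfolding psi_comp[OF s, of "\<lambda>v. cnj v * v"] inner_sum_right
  proof (rule sum.cong[OF refl])
    fix v
    have "(cnj v * v) *\<^sub>C E (s -` {v}) x = (cmod v)\<^sup>2 *\<^sub>R E (s -` {v}) x"
      using complex_norm_square[of v] by (simp add: scaleR_scaleC mult.commute)
    then show "inner x ((cnj v * v) *\<^sub>C E (s -` {v}) x) = (cmod v)\<^sup>2 * (norm (E (s -` {v}) x))\<^sup>2"
      using s by (simp add: E_inner simple_vimage)
  qed
  finally have "ennreal ((norm (psi s x))\<^sup>2) = (\<Sum>v\<in>range s. ennreal ((cmod v)\<^sup>2) * emeasure (\<mu> x) (s -` {v}))"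
    using s by (simp add: emeasure_mu simple_vimage ennreal_mult flip: sum_ennreal)
  also have "\<dots> = (\<Sum>v\<in>range s. \<integral>\<^sup>+ a. ennreal ((cmod v)\<^sup>2) * indicator (s -` {v}) a \<partial>\<mu> x)"
    using s by (simp add: nn_integral_cmult_indicator simple_vimage)
  also have "\<dots> = (\<integral>\<^sup>+ a. (\<Sum>v\<in>range s. ennreal ((cmod v)\<^sup>2) * indicator (s -` {v}) a) \<partial>\<mu> x)"
    using s by (intro nn_integral_sum[symmetric]) (auto simp: simple_vimage)
  also have "\<dots> = sq x s"
    unfolding sq_def
  proof (rule nn_integral_cong)
    fix a
    have "(\<Sum>v\<in>range s. ennreal ((cmod v)\<^sup>2) * indicator (s -` {v}) a)
        = (\<Sum>v\<in>range s. if v = s a then ennreal ((cmod v)\<^sup>2) else 0)"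
      by (intro sum.cong refl) (auto simp: indicator_def)
    then show "(\<Sum>v\<in>range s. ennreal ((cmod v)\<^sup>2) * indicator (s -` {v}) a) = ennreal ((cmod (s a))\<^sup>2)"
      using fin by (simp add: sum.delta')
  qed
  finally show ?thesis .
qed

end

section \<open>Square integrable functions: existence, algebra and composition of the
  integral\<close>

context projection_valued_measure
begin

lemma simple_measurable [measurable_dest]: "simple_function borel (s :: real \<Rightarrow> complex) \<Longrightarrow> s \<in> borel_measurable borel"
  by (rule borel_measurable_simple_function)

lemma sq_dominated:
  assumes [measurable]: "\<And>n. g n \<in> borel_measurable borel" "h \<in> borel_measurable borel"
    and lim: "\<And>a. (\<lambda>n. g n a) \<longlonglongrightarrow> 0"
    and bound: "\<And>n a. cmod (g n a) \<le> cmod (h a)" and h: "sq x h < \<infinity>"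
  shows "(\<lambda>n. sq x (g n)) \<longlonglongrightarrow> 0"
proof -
  have "(\<lambda>n. \<integral>\<^sup>+ a. ennreal ((cmod (g n a))\<^sup>2) \<partial>\<mu> x) \<longlonglongrightarrow> (\<integral>\<^sup>+ a. 0 \<partial>\<mu> x)"
  proof (rule nn_integral_dominated_convergence[where w = "\<lambda>a. ennreal ((cmod (h a))\<^sup>2)"])
    show "AE a in \<mu> x. (\<lambda>n. ennreal ((cmod (g n a))\<^sup>2)) \<longlonglongrightarrow> 0"
    proof (rule AE_I2)
      fix a
      have "(\<lambda>n. ennreal ((cmod (g n a))\<^sup>2)) \<longlonglongrightarrow> ennreal ((cmod 0)\<^sup>2)"
        by (intro tendsto_intros lim)
      then show "(\<lambda>n. ennreal ((cmod (g n a))\<^sup>2)) \<longlonglongrightarrow> 0" by simp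
    qed
  qed (use h bound in \<open>auto simp: sq_def intro!: AE_I2 ennreal_leI power_mono\<close>)
  then show ?thesis by (simp add: sq_def)
qed

text \<open>The approximation depends on \<open>f\<close> only, not on the vector; this makes linearity in the vector
  immediate.\<close>

definition approx :: "(real \<Rightarrow> complex) \<Rightarrow> nat \<Rightarrow> real \<Rightarrow> complex" where
  "approx f = (SOME F. (\<forall>n. simple_function borel (F n)) \<and> (\<forall>a. (\<lambda>n. F n a) \<longlonglongrightarrow> f a) \<and>
     (\<forall>n a. cmod (F n a) \<le> 2 * cmod (f a)))"

lemma approx:
  assumes f: "f \<in> borel_measurable borel"
  shows "simple_function borel (approx f n)" "(\<lambda>n. approx f n a) \<longlonglongrightarrow> f a"
    "cmod (approx f n a) \<le> 2 * cmod (f a)"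
proof -
  have "\<exists>F. (\<forall>n. simple_function borel (F n)) \<and> (\<forall>a. (\<lambda>n. F n a) \<longlonglongrightarrow> f a) \<and>
     (\<forall>n a. cmod (F n a) \<le> 2 * cmod (f a))"
    using borel_measurable_implies_sequence_metric[OF f, of 0] by simp
  from someI_ex[OF this] show "simple_function borel (approx f n)" "(\<lambda>n. approx f n a) \<longlonglongrightarrow> f a"
    "cmod (approx f n a) \<le> 2 * cmod (f a)"
    unfolding approx_def[symmetric] by blast+
qed

lemma approx_measurable [measurable]:
  "f \<in> borel_measurable borel \<Longrightarrow> approx f n \<in> borel_measurable borel"
  using approx(1) simple_measurable by blast

lemma sq_finite_cmult: "f \<in> borel_measurable borel \<Longrightarrow> sq x f < \<infinity> \<Longrightarrow> sq x (\<lambda>a. c * f a) < \<infinity>"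
  by (simp add: sq_cmult ennreal_mult_less_top)

lemma approx_sq:
  assumes f [measurable]: "f \<in> borel_measurable borel" and fin: "sq x f < \<infinity>"
  shows "(\<lambda>n. sq x (\<lambda>a. f a - approx f n a)) \<longlonglongrightarrow> 0"
proof (rule sq_dominated[where h = "\<lambda>a. 3 * f a"])
  show "(\<lambda>n. f a - approx f n a) \<longlonglongrightarrow> 0" for a
    using tendsto_diff[OF tendsto_const approx(2)[OF f, of a]] by (metis diff_self)
  show "cmod (f a - approx f n a) \<le> cmod (3 * f a)" for n a
    using approx(3)[OF f, of n a] norm_triangle_ineq4[of "f a" "approx f n a"]
    by (simp add: norm_mult)
  show "sq x (\<lambda>a. 3 * f a) < \<infinity>"
    using fin by (rule sq_finite_cmult[OF f])
qed measurable

lemma sq_limit_triangle: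
  assumes [measurable]: "f \<in> borel_measurable borel" "\<And>n. s n \<in> borel_measurable borel" "\<And>n. t n \<in> borel_measurable borel"
    and "(\<lambda>n. sq x (\<lambda>a. f a - s n a)) \<longlonglongrightarrow> 0" "(\<lambda>n. sq x (\<lambda>a. f a - t n a)) \<longlonglongrightarrow> 0"
  shows "(\<lambda>n. sq x (\<lambda>a. s n a - t n a)) \<longlonglongrightarrow> 0"
proof (rule tendsto_sandwich[OF _ _ tendsto_const])
  show "(\<lambda>n. 2 * sq x (\<lambda>a. f a - s n a) + 2 * sq x (\<lambda>a. f a - t n a)) \<longlonglongrightarrow> 0"
    using tendsto_add[OF ennreal_tendsto_cmult[OF _ assms(4), of 2] ennreal_tendsto_cmult[OF _ assms(5), of 2]]
    by simp
  have "sq x (\<lambda>a. s n a - t n a) \<le> 2 * sq x (\<lambda>a. s n a - f a) + 2 * sq x (\<lambda>a. f a - t n a)" for n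
    using sq_add_le[of "\<lambda>a. s n a - f a" "\<lambda>a. f a - t n a" x] by simp
  then show "\<forall>\<^sub>F n in sequentially. sq x (\<lambda>a. s n a - t n a) \<le> 2 * sq x (\<lambda>a. f a - s n a) + 2 * sq x (\<lambda>a. f a - t n a)"
    by (simp add: sq_minus_commute[of x f])
qed simp

lemma norm_tendsto_sq:
  assumes "(\<lambda>n. sq x (g n)) \<longlonglongrightarrow> 0" "\<And>n. ennreal ((norm (z n))\<^sup>2) = sq x (g n)"
  shows "z \<longlonglongrightarrow> (0::'a)"
proof -
  have "(\<lambda>n. ennreal ((norm (z n))\<^sup>2)) \<longlonglongrightarrow> 0"
    using assms by simp
  then have "(\<lambda>n. (norm (z n))\<^sup>2) \<longlonglongrightarrow> 0"
    by (simp add: ennreal_tendsto_0_iff)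
  then have "(\<lambda>n. sqrt ((norm (z n))\<^sup>2)) \<longlonglongrightarrow> sqrt 0"
    by (rule tendsto_real_sqrt)
  then show ?thesis
    by (simp add: tendsto_norm_zero_iff)
qed

text \<open>Independence of the approximating sequence: by the isometry, the difference of the two
  simple integrals is measured by \<open>sq x\<close> of \<open>s n - t n\<close>.\<close>

lemma psi_seq_transfer:
  assumes [measurable]: "f \<in> borel_measurable borel"
    and s: "\<And>n. simple_function borel (s n)" and t: "\<And>n. simple_function borel (t n)"
    and "(\<lambda>n. sq x (\<lambda>a. f a - s n a)) \<longlonglongrightarrow> 0" "(\<lambda>n. sq x (\<lambda>a. f a - t n a)) \<longlonglongrightarrow> 0"
    and lim: "(\<lambda>n. psi (s n) x) \<longlonglongrightarrow> y"
  shows "(\<lambda>n. psi (t n) x) \<longlonglongrightarrow> y"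
proof -
  have "(\<lambda>n. psi (s n) x - psi (t n) x) \<longlonglongrightarrow> 0"
  proof (rule norm_tendsto_sq)
    show "(\<lambda>n. sq x (\<lambda>a. s n a - t n a)) \<longlonglongrightarrow> 0"
      by (rule sq_limit_triangle[OF assms(1) _ _ assms(4,5)]) (use s t simple_measurable in auto)
    show "ennreal ((norm (psi (s n) x - psi (t n) x))\<^sup>2) = sq x (\<lambda>a. s n a - t n a)" for n
      using psi_norm[OF simple_function_diff[OF s[of n] t[of n]], of x] by (simp add: psi_diff s t)
  qed
  from tendsto_diff[OF lim this] show ?thesis by simp
qed

abbreviation "has_int \<equiv> has_pvm_integral E"

lemma has_int_def:
  "has_int f x y \<longleftrightarrow> f \<in> borel_measurable borel \<and> (\<exists>s. (\<forall>n. simple_function borel (s n)) \<and>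
     (\<lambda>n. sq x (\<lambda>a. f a - s n a)) \<longlonglongrightarrow> 0 \<and> (\<lambda>n. psi (s n) x) \<longlonglongrightarrow> y)"
  unfolding has_pvm_integral_def sq_def ..

lemma has_int_borel [measurable_dest]: "has_int f x y \<Longrightarrow> f \<in> borel_measurable borel"
  by (simp add: has_pvm_integral_def)

text \<open>One approximant at finite distance is enough, because \<open>psi_norm\<close> makes
  \<open>sq x\<close> of a simple function finite.\<close>

lemma has_int_finite:
  assumes "has_int f x y" shows "sq x f < \<infinity>"
proof -
  have f [measurable]: "f \<in> borel_measurable borel" using assms by (rule has_int_borel)
  obtain s where s: "\<And>n. simple_function borel (s n)" "(\<lambda>n. sq x (\<lambda>a. f a - s n a)) \<longlonglongrightarrow> 0"
    using assms by (auto simp: has_int_def)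
  have "\<forall>\<^sub>F n in sequentially. sq x (\<lambda>a. f a - s n a) < 1"
    using order_tendstoD(2)[OF s(2), of 1] by simp
  then obtain n where n: "sq x (\<lambda>a. f a - s n a) < 1"
    using eventually_happens'[of sequentially] by auto
  have [measurable]: "s n \<in> borel_measurable borel" using s(1) by (rule simple_measurable)
  have "sq x f \<le> 2 * sq x (\<lambda>a. f a - s n a) + 2 * sq x (s n)"
    using sq_add_le[of "\<lambda>a. f a - s n a" "s n" x] by simp
  also have "\<dots> < \<infinity>"
    using n psi_norm[OF s(1), of n x] by (auto simp: ennreal_mult_less_top intro: order.strict_trans simp flip: psi_norm[OF s(1)])
  finally show ?thesis .
qed

text \<open>Replaces the existential quantifier over sequences by the fixed sequence
  \<open>approx f\<close>. In the converse direction, convergence of the vectors bounds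
  \<open>sq x\<close> of the approximants, and Fatou's lemma makes \<open>f\<close> square
  integrable.\<close>

lemma has_int_iff_approx:
  assumes f [measurable]: "f \<in> borel_measurable borel"
  shows "has_int f x y \<longleftrightarrow> (\<lambda>n. psi (approx f n) x) \<longlonglongrightarrow> y"
proof
  assume h: "has_int f x y"
  then obtain s where s: "\<And>n. simple_function borel (s n)" "(\<lambda>n. sq x (\<lambda>a. f a - s n a)) \<longlonglongrightarrow> 0"
    "(\<lambda>n. psi (s n) x) \<longlonglongrightarrow> y"
    by (auto simp: has_int_def)
  show "(\<lambda>n. psi (approx f n) x) \<longlonglongrightarrow> y"
    by (rule psi_seq_transfer[OF f s(1) approx(1)[OF f] s(2) approx_sq[OF f has_int_finite[OF h]] s(3)])
next
  assume lim: "(\<lambda>n. psi (approx f n) x) \<longlonglongrightarrow> y"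
  have "sq x f = (\<integral>\<^sup>+ a. liminf (\<lambda>n. ennreal ((cmod (approx f n a))\<^sup>2)) \<partial>\<mu> x)"
    unfolding sq_def
  proof (rule nn_integral_cong)
    fix a
    have "(\<lambda>n. ennreal ((cmod (approx f n a))\<^sup>2)) \<longlonglongrightarrow> ennreal ((cmod (f a))\<^sup>2)"
      by (intro tendsto_intros approx(2)[OF f])
    then show "ennreal ((cmod (f a))\<^sup>2) = liminf (\<lambda>n. ennreal ((cmod (approx f n a))\<^sup>2))"
      by (rule lim_imp_Liminf[OF sequentially_bot, symmetric])
  qed
  also have "\<dots> \<le> liminf (\<lambda>n. sq x (approx f n))"
    unfolding sq_def by (rule nn_integral_liminf) measurable
  also have "\<dots> = liminf (\<lambda>n. ennreal ((norm (psi (approx f n) x))\<^sup>2))"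
    by (simp add: psi_norm approx(1)[OF f])
  also have "\<dots> = ennreal ((norm y)\<^sup>2)"
    by (rule lim_imp_Liminf[OF sequentially_bot]) (intro tendsto_intros lim)
  finally have "sq x f < \<infinity>"
    using le_less_trans by fastforce
  then show "has_int f x y"
    unfolding has_int_def using f approx(1)[OF f] approx_sq[OF f] lim by blast
qed

lemma has_int_unique: "has_int f x y \<Longrightarrow> has_int f x z \<Longrightarrow> y = z"
  using has_int_iff_approx[OF has_int_borel] LIMSEQ_unique by metis

lemma ex_has_int:
  assumes f [measurable]: "f \<in> borel_measurable borel" and fin: "sq x f < \<infinity>"
  shows "\<exists>y. has_int f x y"
proof -
  have "Cauchy (\<lambda>n. psi (approx f n) x)"
  proof (rule metric_CauchyI)
    fix e :: real assume e: "0 < e"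
    have "\<forall>\<^sub>F n in sequentially. sq x (\<lambda>a. f a - approx f n a) < ennreal (e\<^sup>2 / 4)"
      using order_tendstoD(2)[OF approx_sq[OF f fin], of "ennreal (e\<^sup>2/4)"] e by simp
    then obtain N where N: "\<And>n. n \<ge> N \<Longrightarrow> sq x (\<lambda>a. f a - approx f n a) < ennreal (e\<^sup>2 / 4)"
      by (auto simp: eventually_sequentially)
    have "dist (psi (approx f m) x) (psi (approx f n) x) < e" if "m \<ge> N" "n \<ge> N" for m n
    proof -
      have "ennreal ((norm (psi (approx f m) x - psi (approx f n) x))\<^sup>2) = sq x (\<lambda>a. approx f m a - approx f n a)"
        using psi_norm[OF simple_function_diff[OF approx(1)[OF f, of m] approx(1)[OF f, of n]], of x]
        by (simp add: psi_diff approx(1)[OF f])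
      also have "\<dots> \<le> 2 * sq x (\<lambda>a. f a - approx f m a) + 2 * sq x (\<lambda>a. f a - approx f n a)"
        using sq_add_le[of "\<lambda>a. approx f m a - f a" "\<lambda>a. f a - approx f n a" x]
        by (simp add: sq_minus_commute[of x f])
      also have "\<dots> < 2 * ennreal (e\<^sup>2 / 4) + 2 * ennreal (e\<^sup>2 / 4)"
        using N[OF that(1)] N[OF that(2)]
        by (intro add_strict_mono ennreal_mult_strict_left_mono) auto
      also have "\<dots> = ennreal (e\<^sup>2)"
        by (simp flip: ennreal_plus ennreal_mult' ennreal_numeral)
      finally have "(norm (psi (approx f m) x - psi (approx f n) x))\<^sup>2 < e\<^sup>2"
        by (simp add: ennreal_less_iff)
      then show ?thesis
        using e by (simp add: dist_norm power_less_imp_less_base)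
    qed
    then show "\<exists>M. \<forall>m\<ge>M. \<forall>n\<ge>M. dist (psi (approx f m) x) (psi (approx f n) x) < e" by blast
  qed
  then show ?thesis
    using Cauchy_convergent convergent_def has_int_iff_approx[OF f] by blast
qed

lemma has_int_simple: "simple_function borel s \<Longrightarrow> has_int s x (psi s x)"
  unfolding has_int_def by (auto intro!: exI[of _ "\<lambda>_. s"] simp: sq_def simple_measurable)

lemma has_int_add:
  assumes "has_int f x y" "has_int g x z"
  shows "has_int (\<lambda>a. f a + g a) x (y + z)"
proof -
  have fg [measurable]: "f \<in> borel_measurable borel" "g \<in> borel_measurable borel"
    using assms has_int_borel by auto
  obtain s where s: "\<And>n. simple_function borel (s n)" "(\<lambda>n. sq x (\<lambda>a. f a - s n a)) \<longlonglongrightarrow> 0"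
    "(\<lambda>n. psi (s n) x) \<longlonglongrightarrow> y"
    using assms(1) by (auto simp: has_int_def)
  obtain t where t: "\<And>n. simple_function borel (t n)" "(\<lambda>n. sq x (\<lambda>a. g a - t n a)) \<longlonglongrightarrow> 0"
    "(\<lambda>n. psi (t n) x) \<longlonglongrightarrow> z"
    using assms(2) by (auto simp: has_int_def)
  have [measurable]: "\<And>n. s n \<in> borel_measurable borel" "\<And>n. t n \<in> borel_measurable borel"
    using s(1) t(1) simple_measurable by auto
  have "(\<lambda>n. psi (\<lambda>a. s n a + t n a) x) \<longlonglongrightarrow> y + z"
    using tendsto_add[OF s(3) t(3)] by (simp add: psi_add s t)
  moreover have "(\<lambda>n. sq x (\<lambda>a. f a + g a - (s n a + t n a))) \<longlonglongrightarrow> 0"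
  proof (rule tendsto_sandwich[OF _ _ tendsto_const])
    show "(\<lambda>n. 2 * sq x (\<lambda>a. f a - s n a) + 2 * sq x (\<lambda>a. g a - t n a)) \<longlonglongrightarrow> 0"
      using tendsto_add[OF ennreal_tendsto_cmult[OF _ s(2), of 2] ennreal_tendsto_cmult[OF _ t(2), of 2]]
      by simp
    have "sq x (\<lambda>a. f a + g a - (s n a + t n a)) \<le> 2 * sq x (\<lambda>a. f a - s n a) + 2 * sq x (\<lambda>a. g a - t n a)" for n
      using sq_add_le[of "\<lambda>a. f a - s n a" "\<lambda>a. g a - t n a" x] by (simp add: add_diff_add)
    then show "\<forall>\<^sub>F n in sequentially. sq x (\<lambda>a. f a + g a - (s n a + t n a)) \<le> 2 * sq x (\<lambda>a. f a - s n a) + 2 * sq x (\<lambda>a. g a - t n a)"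
      by simp
  qed simp
  ultimately show ?thesis
    unfolding has_int_def using s(1) t(1)
    by (intro conjI exI[of _ "\<lambda>n a. s n a + t n a"] allI simple_function_add) auto
qed

lemma has_int_cmult:
  assumes "has_int f x y"
  shows "has_int (\<lambda>a. c * f a) x (c *\<^sub>C y)"
proof -
  have f [measurable]: "f \<in> borel_measurable borel"
    using assms has_int_borel by auto
  obtain s where s: "\<And>n. simple_function borel (s n)" "(\<lambda>n. sq x (\<lambda>a. f a - s n a)) \<longlonglongrightarrow> 0"
    "(\<lambda>n. psi (s n) x) \<longlonglongrightarrow> y"
    using assms(1) by (auto simp: has_int_def)
  have [measurable]: "\<And>n. s n \<in> borel_measurable borel"
    using s(1) simple_measurable by auto
  have "(\<lambda>n. psi (\<lambda>a. c * s n a) x) \<longlonglongrightarrow> c *\<^sub>C y"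
    unfolding psi_cmult[OF s(1)] by (intro tendsto_intros s)
  moreover have "(\<lambda>n. sq x (\<lambda>a. c * f a - c * s n a)) \<longlonglongrightarrow> 0"
    unfolding right_diff_distrib[symmetric]
    using ennreal_tendsto_cmult[OF _ s(2), of "ennreal ((cmod c)\<^sup>2)"] by (simp add: sq_cmult)
  ultimately show ?thesis
    unfolding has_int_def using s(1)
    by (intro conjI exI[of _ "\<lambda>n a. c * s n a"] allI simple_function_mult simple_function_const) auto
qed

lemma has_int_diff:
  assumes "has_int f x y" "has_int g x z"
  shows "has_int (\<lambda>a. f a - g a) x (y - z)"
  using has_int_add[OF assms(1) has_int_cmult[OF assms(2), of "-1"]] scaleR_scaleC[of "-1" z, symmetric] by simp

lemma has_int_norm:
  assumes h: "has_int f x y" shows "ennreal ((norm y)\<^sup>2) = sq x f"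
proof (rule LIMSEQ_unique)
  have f [measurable]: "f \<in> borel_measurable borel" using h by (rule has_int_borel)
  have "(\<lambda>n. psi (approx f n) x) \<longlonglongrightarrow> y"
    using h has_int_iff_approx[OF f] by simp
  then have "(\<lambda>n. ennreal ((norm (psi (approx f n) x))\<^sup>2)) \<longlonglongrightarrow> ennreal ((norm y)\<^sup>2)"
    by (intro tendsto_intros)
  then show "(\<lambda>n. sq x (approx f n)) \<longlonglongrightarrow> ennreal ((norm y)\<^sup>2)"
    by (simp add: psi_norm approx(1)[OF f])
  show "(\<lambda>n. sq x (approx f n)) \<longlonglongrightarrow> sq x f"
    unfolding sq_def
  proof (rule nn_integral_dominated_convergence[where w = "\<lambda>a. ennreal ((cmod (2 * f a))\<^sup>2)"])
    show "(\<integral>\<^sup>+ a. ennreal ((cmod (2 * f a))\<^sup>2) \<partial>\<mu> x) < \<infinity>"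
      using sq_finite_cmult[OF f has_int_finite[OF h], of 2] by (simp add: sq_def)
    show "AE a in \<mu> x. (\<lambda>n. ennreal ((cmod (approx f n a))\<^sup>2)) \<longlonglongrightarrow> ennreal ((cmod (f a))\<^sup>2)"
      by (intro AE_I2 tendsto_intros approx(2)[OF f])
    show "AE a in \<mu> x. ennreal ((cmod (approx f n a))\<^sup>2) \<le> ennreal ((cmod (2 * f a))\<^sup>2)" for n
      using approx(3)[OF f] by (intro AE_I2 ennreal_leI power_mono) (auto simp: norm_mult)
  qed measurable
qed

lemma has_int_limit:
  assumes "\<And>n. has_int (f n) x (y n)" "has_int g x z" "(\<lambda>n. sq x (\<lambda>a. f n a - g a)) \<longlonglongrightarrow> 0"
  shows "y \<longlonglongrightarrow> z"
proof -
  have "(\<lambda>n. y n - z) \<longlonglongrightarrow> 0"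
    by (rule norm_tendsto_sq[OF assms(3) has_int_norm]) (rule has_int_diff[OF assms(1,2)])
  then show ?thesis by (rule LIM_zero_cancel)
qed

lemma has_int_vector_add:
  assumes "has_int f x y" "has_int f x' y'" shows "has_int f (x + x') (y + y')"
proof -
  have f: "f \<in> borel_measurable borel" using assms has_int_borel by auto
  show ?thesis
    using tendsto_add assms unfolding has_int_iff_approx[OF f]
    by (simp add: psi_vector_add approx(1)[OF f])
qed

lemma has_int_vector_scaleC:
  assumes "has_int f x y" shows "has_int f (c *\<^sub>C x) (c *\<^sub>C y)"
proof -
  have f: "f \<in> borel_measurable borel" using assms has_int_borel by auto
  show ?thesis
    using assms unfolding has_int_iff_approx[OF f]
    by (auto simp: psi_vector_scaleC approx(1)[OF f] intro!: tendsto_intros)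
qed

lemma has_int_adjoint:
  assumes h: "has_int f x y" and k: "has_int (\<lambda>a. cnj (f a)) u w"
  shows "cinner y u = cinner x w"
proof (rule LIMSEQ_unique)
  have f [measurable]: "f \<in> borel_measurable borel" using h by (rule has_int_borel)
  have cf [measurable]: "(\<lambda>a. cnj (f a)) \<in> borel_measurable borel" using k by (rule has_int_borel)
  have lim: "(\<lambda>n. psi (approx f n) x) \<longlonglongrightarrow> y"
    using h has_int_iff_approx[OF f] by simp
  \<comment> \<open>The conjugates of \<open>approx f\<close> form an admissible sequence for the
    conjugate function, though not necessarily the chosen one; \<open>psi_seq_transfer\<close> moves
    the limit over.\<close>
  have "(\<lambda>n. psi (\<lambda>a. cnj (approx f n a)) u) \<longlonglongrightarrow> w"
  proof (rule psi_seq_transfer[OF cf approx(1)[OF cf]])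
    show "simple_function borel (\<lambda>a. cnj (approx f n a))" for n
      using simple_function_compose1[OF approx(1)[OF f], of cnj] .
    have "sq u f < \<infinity>"
      using has_int_finite[OF k] by (simp add: sq_def)
    then show "(\<lambda>n. sq u (\<lambda>a. cnj (f a) - cnj (approx f n a))) \<longlonglongrightarrow> 0"
      using approx_sq[OF f, of u] by (simp add: sq_def flip: complex_cnj_diff)
    show "(\<lambda>n. sq u (\<lambda>a. cnj (f a) - approx (\<lambda>a. cnj (f a)) n a)) \<longlonglongrightarrow> 0"
      by (rule approx_sq[OF cf has_int_finite[OF k]])
    show "(\<lambda>n. psi (approx (\<lambda>a. cnj (f a)) n) u) \<longlonglongrightarrow> w"
      using k has_int_iff_approx[OF cf] by simp
  qed
  then show "(\<lambda>n. cinner x (psi (\<lambda>a. cnj (approx f n a)) u)) \<longlonglongrightarrow> cinner x w"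
    by (intro tendsto_intros)
  show "(\<lambda>n. cinner x (psi (\<lambda>a. cnj (approx f n a)) u)) \<longlonglongrightarrow> cinner y u"
    using tendsto_cinner[OF lim tendsto_const[of u]] by (simp add: psi_cinner approx(1)[OF f])
qed

lemma has_int_E:
  assumes h: "has_int f x y" and S [measurable]: "S \<in> sets borel"
  shows "has_int (\<lambda>a. indicator S a * f a) x (E S y)"
proof -
  have f [measurable]: "f \<in> borel_measurable borel" using h by (rule has_int_borel)
  have [measurable]: "(indicator S :: real \<Rightarrow> complex) \<in> borel_measurable borel" by measurable
  have "(\<lambda>n. psi (approx f n) x) \<longlonglongrightarrow> y"
    using h has_int_iff_approx[OF f] by simp
  then have "(\<lambda>n. psi (\<lambda>a. indicator S a * approx f n a) x) \<longlonglongrightarrow> E S y"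
    unfolding psi_E[OF approx(1)[OF f] S] by (intro bounded_linear.tendsto[OF E_bounded_linear] S)
  moreover have "(\<lambda>n. sq x (\<lambda>a. indicator S a * f a - indicator S a * approx f n a)) \<longlonglongrightarrow> 0"
  proof (rule tendsto_sandwich[OF _ _ tendsto_const approx_sq[OF f has_int_finite[OF h]]])
    show "\<forall>\<^sub>F n in sequentially. sq x (\<lambda>a. indicator S a * f a - indicator S a * approx f n a)
        \<le> sq x (\<lambda>a. f a - approx f n a)"
      unfolding sq_def by (intro always_eventually allI nn_integral_mono) (auto simp: indicator_def)
  qed simp
  moreover have "simple_function borel (\<lambda>a. indicator S a * approx f n a)" for n
    by (intro simple_function_mult simple_function_indicator approx(1)[OF f]) simp
  ultimately show ?thesis
    unfolding has_int_def by (intro conjI exI[of _ "\<lambda>n a. indicator S a * approx f n a"]) auto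
qed

lemma has_int_0: "has_int (\<lambda>_. 0) x 0"
  using has_int_norm[OF has_int_simple[of "\<lambda>_. 0" x]] has_int_simple[of "\<lambda>_. 0" x]
  by (simp add: sq_def)

lemma has_int_sum:
  assumes "\<And>i. i \<in> I \<Longrightarrow> has_int (f i) x (y i)"
  shows "has_int (\<lambda>a. \<Sum>i\<in>I. f i a) x (\<Sum>i\<in>I. y i)"
  using assms by (induction I rule: infinite_finite_induct) (auto intro: has_int_0 has_int_add)

text \<open>The scalar measure of \<open>z\<close> has density equal to the squared modulus of
  \<open>g\<close> with respect to that of \<open>x\<close>. Hence approximating \<open>f\<close>
  for \<open>z\<close> is the same as approximating \<open>f * g\<close> for \<open>x\<close>.
  Multiplicativity of the calculus follows, also for unbounded \<open>f\<close>.\<close>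

lemma has_int_comp:
  assumes g: "has_int g x z" and f [measurable]: "f \<in> borel_measurable borel"
    and fg: "has_int (\<lambda>a. f a * g a) x y"
  shows "has_int f z y"
proof -
  have [measurable]: "g \<in> borel_measurable borel" using g by (rule has_int_borel)
  have mu: "\<mu> z = density (\<mu> x) (\<lambda>a. ennreal ((cmod (g a))\<^sup>2))"
  proof (rule measure_eqI)
    fix S assume "S \<in> sets (\<mu> z)"
    then have S [measurable]: "S \<in> sets borel" by simp
    have "emeasure (\<mu> z) S = sq x (\<lambda>a. indicator S a * g a)"
      using has_int_norm[OF has_int_E[OF g S]] by (simp add: emeasure_mu)
    also have "\<dots> = (\<integral>\<^sup>+ a. ennreal ((cmod (g a))\<^sup>2) * indicator S a \<partial>\<mu> x)"
      unfolding sq_def by (intro nn_integral_cong) (auto simp: indicator_def)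
    also have "\<dots> = emeasure (density (\<mu> x) (\<lambda>a. ennreal ((cmod (g a))\<^sup>2))) S"
      by (simp add: emeasure_density)
    finally show "emeasure (\<mu> z) S = emeasure (density (\<mu> x) (\<lambda>a. ennreal ((cmod (g a))\<^sup>2))) S" .
  qed simp
  have sq_z: "sq z h = sq x (\<lambda>a. h a * g a)" if [measurable]: "h \<in> borel_measurable borel" for h
    unfolding sq_def mu
    by (subst nn_integral_density) (auto simp: norm_mult power_mult_distrib ennreal_mult mult.commute)
  have simple: "has_int (\<lambda>a. s a * g a) x (psi s z)" if s: "simple_function borel s" for s
  proof -
    have "has_int (\<lambda>a. \<Sum>v\<in>range s. v * (indicator (s -` {v}) a * g a)) x (psi s z)"
      unfolding pvm_simple_integral_def
      by (intro has_int_sum has_int_cmult has_int_E g simple_vimage s)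
    also have "(\<lambda>a. \<Sum>v\<in>range s. v * (indicator (s -` {v}) a * g a)) = (\<lambda>a. s a * g a)"
    proof
      fix a
      have "(\<Sum>v\<in>range s. v * (indicator (s -` {v}) a * g a)) = (\<Sum>v\<in>range s. if v = s a then v * g a else 0)"
        by (intro sum.cong refl) (auto simp: indicator_def)
      then show "(\<Sum>v\<in>range s. v * (indicator (s -` {v}) a * g a)) = s a * g a"
        using simple_functionD(1)[OF s] by (simp add: sum.delta')
    qed
    finally show ?thesis .
  qed
  have "sq z f < \<infinity>"
    using has_int_finite[OF fg] by (simp add: sq_z)
  from approx_sq[OF f this] have "(\<lambda>n. sq x (\<lambda>a. (f a - approx f n a) * g a)) \<longlonglongrightarrow> 0"
    by (simp add: sq_z)
  then have "(\<lambda>n. sq x (\<lambda>a. f a * g a - approx f n a * g a)) \<longlonglongrightarrow> 0"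
    by (simp add: left_diff_distrib)
  then have "(\<lambda>n. sq x (\<lambda>a. approx f n a * g a - f a * g a)) \<longlonglongrightarrow> 0"
    by (subst sq_minus_commute)
  with simple[OF approx(1)[OF f]] fg have "(\<lambda>n. psi (approx f n) z) \<longlonglongrightarrow> y"
    by (rule has_int_limit)
  then show ?thesis by (simp add: has_int_iff_approx[OF f])
qed

end

subsection \<open>The spectral theorem\<close>

lemma bounded_linear_scaleC: "bounded_linear (\<lambda>x::'a::chilbert_space. c *\<^sub>C x)"
  by (rule scaleC.bounded_linear_right)

locale complex_self_adjoint =
  fixes D :: "'a::chilbert_space set" and A :: "'a \<Rightarrow> 'a"
  assumes sa: "self_adjoint D A"
begin

lemma csub: "csubspace D" and A_cadd: "x \<in> D \<Longrightarrow> y \<in> D \<Longrightarrow> A (x + y) = A x + A y"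
  and A_scaleC: "x \<in> D \<Longrightarrow> A (c *\<^sub>C x) = c *\<^sub>C A x"
  using sa by (auto simp: self_adjoint_def clinear_on_def)

lemma D_scaleC: "x \<in> D \<Longrightarrow> c *\<^sub>C x \<in> D"
  using csub by (auto simp: csubspace_def)

lemma adjoint_iff: "(\<forall>x\<in>D. cinner y (A x) = cinner z x) \<longleftrightarrow> y \<in> D \<and> z = A y"
proof -
  have "(y, z) \<in> adjoint_graph D A \<longleftrightarrow> (y, z) \<in> op_graph D A"
    using sa by (simp add: self_adjoint_def)
  then show ?thesis by (auto simp: adjoint_graph_def op_graph_def)
qed

lemma A_cinner: "x \<in> D \<Longrightarrow> y \<in> D \<Longrightarrow> cinner (A x) y = cinner x (A y)"
  using adjoint_iff[of x "A x"] by auto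

sublocale real_self_adjoint D A
proof
  show "subspace D"
    using csub by (auto simp: csubspace_def subspace_def scaleR_scaleC)
  show "closure D = UNIV" using sa by (simp add: self_adjoint_def)
  fix y z assume a: "\<And>x. x \<in> D \<Longrightarrow> inner y (A x) = inner z x"
  have "cinner y (A x) = cinner z x" if x: "x \<in> D" for x
  proof -
    have "inner (\<i> *\<^sub>C y) (A x) = inner (\<i> *\<^sub>C z) x"
      using a[OF D_scaleC[OF x, of \<i>]] x by (simp add: A_scaleC inner_i_scaleC)
    then show ?thesis by (simp add: cinner_eq_inner a x)
  qed
  then show "y \<in> D \<and> A y = z" using adjoint_iff[of y z] by auto
qed (auto simp: A_cadd A_scaleC scaleR_scaleC inner_eq_Re_cinner A_cinner)

text \<open>Multiplication by \<open>\<i>\<close> is a bounded real linear operator commuting with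
  \<open>A\<close>, hence with \<open>F t\<close>.\<close>

lemma F_orth: "orth_projection (F t)"
  unfolding orth_projection_iff
proof (intro conjI allI)
  have "commutes (\<lambda>x. \<i> *\<^sub>C x)"
    by (auto simp: commutes_def bounded_linear_scaleC D_scaleC A_scaleC)
  from commutes_F[OF this] show "F t (\<i> *\<^sub>C x) = \<i> *\<^sub>C F t x" for x by simp
qed (auto simp: F_sym_op F_idem)

section \<open>Extension of the spectral family to Borel sets\<close>

definition spectral_mass :: "'a \<Rightarrow> real measure" where
  "spectral_mass x = interval_measure (\<lambda>t. (norm (F t x))\<^sup>2)"

lemma sets_spectral_mass [simp]: "sets (spectral_mass x) = sets borel"
  by (simp add: spectral_mass_def)

lemma mass_Ioc:
  assumes "a \<le> b"
  shows "emeasure (spectral_mass x) {a<..b} = ennreal ((norm (F b x))\<^sup>2 - (norm (F a x))\<^sup>2)"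
  unfolding spectral_mass_def
proof (rule emeasure_interval_measure_Ioc[OF assms])
  show mono: "(norm (F s x))\<^sup>2 \<le> (norm (F t x))\<^sup>2" if "s \<le> t" for s t
    using that by (intro power_mono F_norm_mono) auto
  show "continuous (at_right t) (\<lambda>t. (norm (F t x))\<^sup>2)" for t
  proof (subst continuous_at_right_real_increasing)
    show "\<forall>e>0. \<exists>d>0. (norm (F (t + d) x))\<^sup>2 - (norm (F t x))\<^sup>2 < e"
    proof (intro allI impI)
      fix e :: real assume e: "0 < e"
      have "(\<lambda>n. F (t + inverse (real (Suc n))) x) \<longlonglongrightarrow> F t x"
      proof (rule F_right_continuous)
        show "decseq (\<lambda>n. t + inverse (real (Suc n)))"
          by (auto simp: decseq_def field_simps)
        show "(\<lambda>n. t + inverse (real (Suc n))) \<longlonglongrightarrow> t"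
          using tendsto_add[OF tendsto_const LIMSEQ_inverse_real_of_nat, of t] by simp
      qed simp
      then have "(\<lambda>n. (norm (F (t + inverse (real (Suc n))) x))\<^sup>2) \<longlonglongrightarrow> (norm (F t x))\<^sup>2"
        by (intro tendsto_intros)
      from order_tendstoD(2)[OF this, of "(norm (F t x))\<^sup>2 + e"] e
      obtain n where "(norm (F (t + inverse (real (Suc n))) x))\<^sup>2 < (norm (F t x))\<^sup>2 + e"
        by (auto simp: eventually_sequentially)
      then show "\<exists>d>0. (norm (F (t + d) x))\<^sup>2 - (norm (F t x))\<^sup>2 < e"
        by (intro exI[of _ "inverse (real (Suc n))"]) auto
    qed
  qed (use mono in blast)
qed

lemma norm_F_at_bot: "(\<lambda>n. (norm (F (- real n) x))\<^sup>2) \<longlonglongrightarrow> 0"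
  using tendsto_power[OF tendsto_norm[OF F_at_bot[of x]], of 2] by simp

lemma mass_atMost: "emeasure (spectral_mass x) {..t} = ennreal ((norm (F t x))\<^sup>2)"
proof (rule LIMSEQ_unique)
  have "(\<lambda>n. emeasure (spectral_mass x) {- real n<..t}) \<longlonglongrightarrow> emeasure (spectral_mass x) (\<Union>n. {- real n<..t})"
    by (rule Lim_emeasure_incseq) (auto simp: incseq_def)
  also have "(\<Union>n. {- real n<..t}) = {..t}"
  proof -
    have "\<exists>n. - real n < s" for s
      using reals_Archimedean2[of "- s"] by (auto simp: minus_less_iff)
    then show ?thesis by auto
  qed
  finally show "(\<lambda>n. emeasure (spectral_mass x) {- real n<..t}) \<longlonglongrightarrow> emeasure (spectral_mass x) {..t}" .
  have "(\<lambda>n. ennreal ((norm (F t x))\<^sup>2 - (norm (F (- real n) x))\<^sup>2)) \<longlonglongrightarrow> ennreal ((norm (F t x))\<^sup>2 - 0)"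
    by (intro tendsto_intros norm_F_at_bot)
  moreover have "\<forall>\<^sub>F n in sequentially. ennreal ((norm (F t x))\<^sup>2 - (norm (F (- real n) x))\<^sup>2)
      = emeasure (spectral_mass x) {- real n<..t}"
  proof -
    obtain N where "- t < real N" using reals_Archimedean2 by blast
    then have "- real n \<le> t" if "n \<ge> N" for n using that by linarith
    then show ?thesis by (intro eventually_sequentiallyI[of N]) (simp add: mass_Ioc)
  qed
  ultimately show "(\<lambda>n. emeasure (spectral_mass x) {- real n<..t}) \<longlonglongrightarrow> ennreal ((norm (F t x))\<^sup>2)"
    by (auto intro: Lim_transform_eventually)
qed

lemma mass_UNIV: "emeasure (spectral_mass x) UNIV = ennreal ((norm x)\<^sup>2)"
proof (rule LIMSEQ_unique)
  have "(\<lambda>n. emeasure (spectral_mass x) {..real n}) \<longlonglongrightarrow> emeasure (spectral_mass x) (\<Union>n. {..real n})"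
    by (rule Lim_emeasure_incseq) (auto simp: incseq_def)
  also have "(\<Union>n. {..real n}) = UNIV"
    using real_arch_simple by auto
  finally show "(\<lambda>n. emeasure (spectral_mass x) {..real n}) \<longlonglongrightarrow> emeasure (spectral_mass x) UNIV" .
  show "(\<lambda>n. emeasure (spectral_mass x) {..real n}) \<longlonglongrightarrow> ennreal ((norm x)\<^sup>2)"
    unfolding mass_atMost by (intro tendsto_intros F_at_top)
qed

text \<open>A projection is tied to a set only through its quadratic form. By
  \<open>orth_projection_eqI\<close> this determines it, so the Dynkin argument has to produce
  nothing but existence.\<close>

definition represents :: "real set \<Rightarrow> ('a \<Rightarrow> 'a) \<Rightarrow> bool" where
  "represents S P \<longleftrightarrow> orth_projection P \<and> (\<forall>x. emeasure (spectral_mass x) S = ennreal ((norm (P x))\<^sup>2))"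

lemma represents_unique: "represents S P \<Longrightarrow> represents S P' \<Longrightarrow> P = P'"
  by (rule ext, rule orth_projection_eqI) (auto simp: represents_def)

text \<open>Disjoint sets have orthogonal projections because
  \<open>\<parallel>P x\<parallel>\<^sup>2 + \<parallel>P' x\<parallel>\<^sup>2 \<le> \<parallel>x\<parallel>\<^sup>2\<close>, applied to \<open>x\<close> in the range of \<open>P\<close>.\<close>

lemma represents_disjoint:
  assumes P: "represents S P" and P': "represents T P'"
    and ST: "S \<in> sets borel" "T \<in> sets borel" "S \<inter> T = {}"
  shows "P' (P x) = 0"
proof -
  let ?y = "P x"
  have "emeasure (spectral_mass ?y) (S \<union> T) \<le> emeasure (spectral_mass ?y) UNIV"
    by (rule emeasure_mono) auto
  moreover have "emeasure (spectral_mass ?y) (S \<union> T) = emeasure (spectral_mass ?y) S + emeasure (spectral_mass ?y) T"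
    using ST by (intro plus_emeasure[symmetric]) auto
  ultimately have "ennreal ((norm (P ?y))\<^sup>2 + (norm (P' ?y))\<^sup>2) \<le> ennreal ((norm ?y)\<^sup>2)"
    using P P' by (simp add: represents_def mass_UNIV ennreal_plus)
  moreover have "P ?y = ?y" using P orth_projectionD(4) by (auto simp: represents_def)
  ultimately show ?thesis by (simp add: ennreal_le_iff)
qed

text \<open>Projections of disjoint sets are mutually orthogonal. By Pythagoras and Bessel's
  inequality their sum converges strongly, and countable additivity of the scalar masses identifies
  the limit with the union.\<close>

lemma represents_UN:
  fixes S :: "nat \<Rightarrow> real set"
  assumes S: "range S \<subseteq> sets borel" "disjoint_family S" and P: "\<And>i. represents (S i) (P i)"
  shows "\<exists>Q. represents (\<Union>i. S i) Q \<and> (\<forall>x. (\<lambda>i. P i x) sums Q x)"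
proof -
  have oP: "orth_projection (P i)" for i using P by (simp add: represents_def)
  note PD = orth_projectionD[OF oP]
  have mass: "(\<lambda>i. ennreal ((norm (P i x))\<^sup>2)) sums emeasure (spectral_mass x) (\<Union>i. S i)" for x
    using sums_emeasure[of S "spectral_mass x"] S P
    by (auto simp: represents_def disjoint_family_on_def)
  have orth: "P j (P i x) = (if i = j then P i x else 0)" for i j x
    using represents_disjoint[OF P[of i] P[of j]] S by (auto simp: PD(4) disjoint_family_on_def)
  have lin: "linear (P i)" for i using PD(7) bounded_linear.linear by blast
  have Psum: "P j (\<Sum>i\<in>I. P i x) = (if j \<in> I then P j x else 0)" if "finite I" for I j x
    using that unfolding linear_sum[OF lin] by (simp add: orth sum.delta)
  have norm_sum: "(norm (\<Sum>i\<in>I. P i x))\<^sup>2 = (\<Sum>i\<in>I. (norm (P i x))\<^sup>2)" if "finite I" for I x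
  proof -
    have "(norm (\<Sum>i\<in>I. P i x))\<^sup>2 = (\<Sum>j\<in>I. inner x (P j (\<Sum>i\<in>I. P i x)))"
      by (simp add: power2_norm_eq_inner inner_sum_left PD(6))
    also have "\<dots> = (\<Sum>i\<in>I. (norm (P i x))\<^sup>2)"
      using that by (intro sum.cong refl) (simp add: Psum PD(9))
    finally show ?thesis .
  qed
  have bound: "(\<Sum>i\<in>I. (norm (P i x))\<^sup>2) \<le> (norm x)\<^sup>2" if "finite I" for I x
  proof -
    let ?y = "\<Sum>i\<in>I. P i x"
    have "(norm ?y)\<^sup>2 = inner x ?y"
      unfolding norm_sum[OF that] by (simp add: inner_sum_right PD(9))
    also have "\<dots> \<le> norm x * norm ?y" by (rule norm_cauchy_schwarz)
    finally have "norm ?y \<le> norm x"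
      by (cases "norm ?y = 0") (auto simp: power2_eq_square)
    then show ?thesis
      unfolding norm_sum[OF that, symmetric] by (intro power_mono) auto
  qed
  have summ2: "summable (\<lambda>i. (norm (P i x))\<^sup>2)" for x
    using bound by (intro summableI_nonneg_bounded[of _ "(norm x)\<^sup>2"]) auto
  have summ: "summable (\<lambda>i. P i x)" for x
    unfolding summable_Cauchy
  proof (intro allI impI)
    fix e :: real assume e: "0 < e"
    then obtain N where N: "\<And>m n. m \<ge> N \<Longrightarrow> norm (\<Sum>i=m..<n. (norm (P i x))\<^sup>2) < e\<^sup>2"
      using summ2[of x] unfolding summable_Cauchy by (meson zero_less_power)
    have "norm (\<Sum>i=m..<n. P i x) < e" if "m \<ge> N" for m n
    proof -
      have "(norm (\<Sum>i=m..<n. P i x))\<^sup>2 < e\<^sup>2"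
        using N[OF that, of n] by (simp add: norm_sum)
      then show ?thesis using e by (simp add: power_less_imp_less_base)
    qed
    then show "\<exists>N. \<forall>m\<ge>N. \<forall>n. norm (\<Sum>i=m..<n. P i x) < e" by blast
  qed
  define Q where "Q x = (\<Sum>i. P i x)" for x
  have sums: "(\<lambda>i. P i x) sums Q x" for x
    unfolding Q_def by (rule summable_sums[OF summ])
  have PQ: "P j (Q x) = P j x" for j x
  proof (rule LIMSEQ_unique)
    show "(\<lambda>n. P j (\<Sum>i<n. P i x)) \<longlonglongrightarrow> P j (Q x)"
      using sums[of x] unfolding sums_def by (rule bounded_linear.tendsto[OF PD(7)])
    show "(\<lambda>n. P j (\<Sum>i<n. P i x)) \<longlonglongrightarrow> P j x"
      by (rule tendsto_eventually, rule eventually_sequentiallyI[of "Suc j"]) (simp add: Psum)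
  qed
  have QQ: "Q (Q x) = Q x" for x
    unfolding Q_def[of "Q x"] PQ by (simp add: Q_def)
  have normQ: "(\<lambda>i. (norm (P i x))\<^sup>2) sums (norm (Q x))\<^sup>2" for x
  proof -
    have "(\<lambda>n. (norm (\<Sum>i<n. P i x))\<^sup>2) \<longlonglongrightarrow> (norm (Q x))\<^sup>2"
      using sums[of x] unfolding sums_def by (intro tendsto_intros)
    then show ?thesis by (simp add: sums_def norm_sum)
  qed
  have "orth_projection Q"
    unfolding orth_projection_def clinear_on_def is_adjoint_def csubspace_def
  proof (intro conjI allI ballI)
    show "Q (x + y) = Q x + Q y" for x y
      using sums_add[OF sums[of x] sums[of y]] sums[of "x + y"] by (simp add: PD sums_unique2)
    show "Q (c *\<^sub>C x) = c *\<^sub>C Q x" for c x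
      using bounded_linear.sums[OF bounded_linear_scaleC sums[of x], of c] sums[of "c *\<^sub>C x"]
      by (simp add: PD sums_unique2)
    show "cinner (Q x) y = cinner x (Q y)" for x y
    proof (rule LIMSEQ_unique)
      have l: "cinner (\<Sum>i<n. f i) z = (\<Sum>i<n. cinner (f i) z)" for f :: "nat \<Rightarrow> 'a" and z n
        by (induction n) (auto simp: cinner_add_left)
      have r: "cinner z (\<Sum>i<n. f i) = (\<Sum>i<n. cinner z (f i))" for f :: "nat \<Rightarrow> 'a" and z n
        by (induction n) (auto simp: cinner_add_right)
      show "(\<lambda>n. cinner (\<Sum>i<n. P i x) y) \<longlonglongrightarrow> cinner (Q x) y"
        using sums[of x] unfolding sums_def by (intro tendsto_intros)
      have "(\<lambda>n. cinner x (\<Sum>i<n. P i y)) \<longlonglongrightarrow> cinner x (Q y)"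
        using sums[of y] unfolding sums_def by (intro tendsto_intros)
      then show "(\<lambda>n. cinner (\<Sum>i<n. P i x) y) \<longlonglongrightarrow> cinner x (Q y)"
        by (simp add: l r PD(5))
    qed
  qed (auto simp: QQ)
  moreover have "emeasure (spectral_mass x) (\<Union>i. S i) = ennreal ((norm (Q x))\<^sup>2)" for x
    using normQ[of x] mass[of x] by (intro sums_unique2[OF mass]) simp
  ultimately show ?thesis
    using sums by (auto simp: represents_def)
qed

lemma represents_UNIV: "represents UNIV (\<lambda>x. x)"
  by (auto simp: represents_def mass_UNIV orth_projection_iff sym_op_def)

lemma ex_represents:
  assumes "S \<in> sets borel" shows "\<exists>P. represents S P"
proof -
  have "Int_stable (range (atMost :: real \<Rightarrow> _))"
    by (auto simp: Int_stable_def)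
  moreover have "range atMost \<subseteq> Pow (UNIV :: real set)" by simp
  moreover have "S \<in> sigma_sets UNIV (range atMost)"
    using assms by (simp add: borel_eq_atMost image_def)
  ultimately show ?thesis
  proof (induction rule: sigma_sets_induct_disjoint)
    case (basic S)
    then obtain t where "S = {..t}" by auto
    then have "represents S (F t)" by (simp add: represents_def mass_atMost F_orth)
    then show ?case by blast
  next
    case empty
    show ?case
      by (rule exI[of _ "\<lambda>_. 0"]) (auto simp: represents_def orth_projection_iff sym_op_def scaleC.zero_right)
  next
    case (compl S)
    then obtain P where P: "orth_projection P" "\<And>x. emeasure (spectral_mass x) S = ennreal ((norm (P x))\<^sup>2)"
      by (auto simp: represents_def)
    note PD = orth_projectionD[OF P(1)]
    have [simp]: "S \<in> sets borel" using compl by (simp add: borel_eq_atMost image_def)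
    have "orth_projection (\<lambda>x. x - P x)"
      unfolding orth_projection_iff sym_op_def
      by (auto simp: PD inner_diff_left inner_diff_right scaleC.diff_right
          intro!: bounded_linear_sub bounded_linear_ident)
    moreover have "emeasure (spectral_mass x) (UNIV - S) = ennreal ((norm (x - P x))\<^sup>2)" for x
      using emeasure_compl[of S "spectral_mass x"]
      by (simp add: P(2) mass_UNIV PD(11) spectral_mass_def flip: ennreal_minus)
        (metis P(2) ennreal_neq_top mass_UNIV spectral_mass_def)
    ultimately show ?case by (auto simp: represents_def)
  next
    case (union S)
    have "range S \<subseteq> sets borel" using union(2) by (simp add: borel_eq_atMost image_def)
    moreover obtain P where "\<And>i. represents (S i) (P i)" using union(3) by metis
    ultimately show ?case using represents_UN union(1) by blast
  qed
qed

definition E :: "real set \<Rightarrow> 'a \<Rightarrow> 'a" where "E S = (SOME P. represents S P)"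

lemma represents_E: "S \<in> sets borel \<Longrightarrow> represents S (E S)"
  unfolding E_def by (rule someI_ex[OF ex_represents])

lemma E_eqI: "S \<in> sets borel \<Longrightarrow> represents S P \<Longrightarrow> E S = P"
  using represents_E represents_unique by blast

lemma pvm_E: "pvm E"
  unfolding pvm_def
proof (intro conjI ballI allI impI)
  show "orth_projection (E S)" if "S \<in> sets borel" for S
    using represents_E[OF that] by (simp add: represents_def)
  show "E UNIV x = x" for x
    using E_eqI[OF _ represents_UNIV] by simp
  show "(\<lambda>n. E (S n) x) sums E (\<Union>n. S n) x"
    if S: "range S \<subseteq> sets borel" "disjoint_family S" for S :: "nat \<Rightarrow> _" and x
  proof -
    have "represents (S i) (E (S i))" for i using S by (intro represents_E) auto
    from represents_UN[OF S this] obtain Q where Q: "represents (\<Union>i. S i) Q" "(\<lambda>i. E (S i) x) sums Q x"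
      by blast
    have "(\<Union>i. S i) \<in> sets borel" using S by auto
    from E_eqI[OF this Q(1)] Q(2) show ?thesis by simp
  qed
qed

sublocale projection_valued_measure E
  by standard (rule pvm_E)

lemma E_atMost: "E {..t} = F t"
  by (rule E_eqI) (auto simp: represents_def mass_atMost F_orth)

lemma E_Ioc: "a \<le> b \<Longrightarrow> E {a<..b} x = F b x - F a x"
proof -
  assume "a \<le> b"
  then have "E ({..a} \<union> {a<..b}) x = E {..a} x + E {a<..b} x"
    by (intro E_Un) auto
  moreover have "{..a} \<union> {a<..b} = {..b}" using \<open>a \<le> b\<close> by auto
  ultimately show ?thesis by (simp add: E_atMost)
qed

end

context projection_valued_measure
begin

lemma has_int_one: "has_int (\<lambda>_. 1) x x"
  using has_int_simple[of "\<lambda>_. 1" x] by (simp add: pvm_simple_integral_def)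

lemma has_int_indicator: "S \<in> sets borel \<Longrightarrow> has_int (indicator S) x (E S x)"
  using has_int_E[OF has_int_one, of S x] by simp

lemma sq_le_bound:
  assumes [measurable]: "S \<in> sets borel" and "\<And>a. cmod (f a) \<le> M * indicator S a" and M: "0 \<le> M"
  shows "sq x f \<le> ennreal ((M * norm (E S x))\<^sup>2)"
proof -
  have "sq x f \<le> (\<integral>\<^sup>+ a. ennreal (M\<^sup>2) * indicator S a \<partial>\<mu> x)"
    unfolding sq_def
  proof (rule nn_integral_mono)
    fix a
    have "(cmod (f a))\<^sup>2 \<le> (M * indicator S a)\<^sup>2"
      by (intro power_mono assms) auto
    then have "ennreal ((cmod (f a))\<^sup>2) \<le> ennreal ((M * indicator S a)\<^sup>2)"
      by (rule ennreal_leI)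
    then show "ennreal ((cmod (f a))\<^sup>2) \<le> ennreal (M\<^sup>2) * indicator S a"
      by (auto simp: indicator_def split: if_splits)
  qed
  also have "\<dots> = ennreal ((M * norm (E S x))\<^sup>2)"
    by (simp add: nn_integral_cmult_indicator emeasure_mu power_mult_distrib ennreal_mult)
  finally show ?thesis .
qed

end

section \<open>The operator as the integral of its spectral measure\<close>

context complex_self_adjoint
begin

lemma E_Ioc_D: "a \<le> b \<Longrightarrow> x \<in> D \<Longrightarrow> E {a<..b} x \<in> D"
  using D by (simp add: E_Ioc F_D subspace_diff)

lemma E_Ioc_A: "a \<le> b \<Longrightarrow> x \<in> D \<Longrightarrow> A (E {a<..b} x) = E {a<..b} (A x)"
  by (simp add: E_Ioc F_D F_A A_diff)

lemma E_Ioc_norm: "a \<le> b \<Longrightarrow> (norm (E {a<..b} x))\<^sup>2 = (norm (F b x))\<^sup>2 - (norm (F a x))\<^sup>2"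
  by (simp add: E_Ioc F_norm_diff)

text \<open>On a short interval \<open>(c, d]\<close> both the operator and the integral differ from
  multiplication by \<open>c\<close> by at most \<open>d - c\<close>. Their difference
  \<open>v\<close> is thus at most \<open>2 * (d - c)\<close> times the local part of
  \<open>x\<close>; summing squares over a fine partition makes it vanish.\<close>

lemma has_int_truncated:
  assumes x: "x \<in> D"
  shows "has_int (\<lambda>a. indicator {- real N<..real N} a * complex_of_real a) x (A (E {- real N<..real N} x))"
proof -
  define J where "J = {- real N<..real N}"
  have J [measurable]: "J \<in> sets borel" by (simp add: J_def)
  let ?f = "\<lambda>a. indicator J a * complex_of_real a"
  have "sq x ?f \<le> ennreal ((real N * norm (E J x))\<^sup>2)"
    by (rule sq_le_bound) (auto simp: J_def indicator_def)
  then have "sq x ?f < \<infinity>"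
    using le_less_trans by fastforce
  then obtain y where y: "has_int ?f x y"
    using ex_has_int[of ?f x] by auto
  define v where "v = A (E J x) - y"
  have Ey: "E J y = y"
  proof (rule has_int_unique)
    show "has_int (\<lambda>a. indicator J a * ?f a) x (E J y)" by (rule has_int_E[OF y J])
    have "(\<lambda>a. indicator J a * ?f a) = ?f" by (auto simp: indicator_def)
    then show "has_int (\<lambda>a. indicator J a * ?f a) x y" using y by simp
  qed
  have Ev: "E J v = v"
    using x Ey E_idem[OF J] by (simp add: v_def E_diff J_def E_Ioc_A)
  have local: "norm (E {c<..d} v) \<le> 2 * (d - c) * norm (E {c<..d} x)"
    if cd: "c < d" "- real N \<le> c" "d \<le> real N" for c d
  proof -
    let ?I = "{c<..d}"
    have IJ: "?I \<inter> J = ?I" using cd by (auto simp: J_def)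
    have 1: "E ?I (A (E J x)) = A (E ?I x)"
      using x cd E_Int[of ?I J x] by (simp add: IJ J_def E_Ioc_D flip: E_Ioc_A)
    have "has_int (\<lambda>a. indicator ?I a * ?f a - complex_of_real c * indicator ?I a) x
        (E ?I y - complex_of_real c *\<^sub>C E ?I x)"
      by (intro has_int_diff has_int_E y has_int_cmult has_int_indicator) auto
    from has_int_norm[OF this]
    have "ennreal ((norm (E ?I y - complex_of_real c *\<^sub>C E ?I x))\<^sup>2)
        = sq x (\<lambda>a. indicator ?I a * ?f a - complex_of_real c * indicator ?I a)" .
    also have "\<dots> \<le> ennreal (((d - c) * norm (E ?I x))\<^sup>2)"
    proof (rule sq_le_bound)
      fix a
      show "cmod (indicator ?I a * ?f a - complex_of_real c * indicator ?I a) \<le> (d - c) * indicator ?I a"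
      proof (cases "a \<in> ?I")
        case True
        then have "a \<in> J" using IJ by blast
        then have "indicator ?I a * ?f a - complex_of_real c * indicator ?I a = of_real (a - c)"
          using True by simp
        then show ?thesis using True by (simp only: norm_of_real) simp
      qed simp
    qed (use cd in auto)
    finally have "(norm (E ?I y - complex_of_real c *\<^sub>C E ?I x))\<^sup>2 \<le> ((d - c) * norm (E ?I x))\<^sup>2"
      by (rule ennreal_le_iff[OF zero_le_power2, THEN iffD1])
    then have 2: "norm (E ?I y - c *\<^sub>R E ?I x) \<le> (d - c) * norm (E ?I x)"
      unfolding scaleR_scaleC by (rule power2_le_imp_le) (use cd in auto)
    have 3: "norm (A (E ?I x) - c *\<^sub>R E ?I x) \<le> (d - c) * norm (E ?I x)"
    proof (rule F_Ioc_bound[OF cd(1)])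
      show "E ?I x \<in> D" using cd x by (simp add: E_Ioc_D)
      show "F c (E ?I x) = 0" "F d (E ?I x) = E ?I x"
        using cd F_mono'[of c d x] by (simp_all add: E_Ioc F_diff F_idem F_comm[of c d])
    qed
    have "E ?I v = (A (E ?I x) - c *\<^sub>R E ?I x) - (E ?I y - c *\<^sub>R E ?I x)"
      by (simp add: v_def E_diff 1)
    then have "norm (E ?I v) \<le> norm (A (E ?I x) - c *\<^sub>R E ?I x) + norm (E ?I y - c *\<^sub>R E ?I x)"
      using norm_triangle_ineq4 by metis
    then show ?thesis using 2 3 unfolding mult.assoc by linarith
  qed
  have "(norm v)\<^sup>2 \<le> 4 * (2 * real N / real (Suc m))\<^sup>2 * (norm x)\<^sup>2" for m
  proof (cases "N = 0")
    case True
    then have "J = {}" by (simp add: J_def)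
    then show ?thesis using Ev by simp
  next
    case False
    \<comment> \<open>The mesh of the partition of \<open>(- N, N]\<close> into \<open>Suc m\<close>
      equal pieces with endpoints \<open>c i\<close>.\<close>
    define h where "h = 2 * real N / real (Suc m)"
    define c where "c i = - real N + real i * h" for i
    have h: "h > 0" using False by (simp add: h_def)
    have c0: "c 0 = - real N" and cm: "c (Suc m) = real N"
      by (simp_all add: c_def h_def)
    have cS: "c (Suc i) = c i + h" for i by (simp add: c_def algebra_simps)
    have le: "(norm (F (c (Suc i)) v))\<^sup>2 - (norm (F (c i) v))\<^sup>2
        \<le> 4 * h\<^sup>2 * ((norm (F (c (Suc i)) x))\<^sup>2 - (norm (F (c i) x))\<^sup>2)" if i: "i < Suc m" for i
    proof -
      have "c (Suc i) \<le> c (Suc m)" "c 0 \<le> c i"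
        using h i unfolding c_def by (auto intro!: mult_right_mono)
      then have "norm (E {c i<..c (Suc i)} v) \<le> 2 * h * norm (E {c i<..c (Suc i)} x)"
        using local[of "c i" "c (Suc i)"] h c0 cm by (simp add: cS)
      then have "(norm (E {c i<..c (Suc i)} v))\<^sup>2 \<le> (2 * h * norm (E {c i<..c (Suc i)} x))\<^sup>2"
        by (intro power_mono) auto
      then show ?thesis
        using h E_Ioc_norm[of "c i" "c (Suc i)"] by (simp add: cS power_mult_distrib)
    qed
    \<comment> \<open>Pythagoras in telescoping form: the squared norm on a piece is a difference of
      values of the squared norm of \<open>F\<close> at the two endpoints.\<close>
    have "(norm v)\<^sup>2 = (norm (F (c (Suc m)) v))\<^sup>2 - (norm (F (c 0) v))\<^sup>2"
      using E_Ioc_norm[of "- real N" "real N" v] Ev by (simp add: c0 cm J_def)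
    also have "\<dots> = (\<Sum>i<Suc m. (norm (F (c (Suc i)) v))\<^sup>2 - (norm (F (c i) v))\<^sup>2)"
      by (rule sum_lessThan_telescope[symmetric])
    also have "\<dots> \<le> (\<Sum>i<Suc m. 4 * h\<^sup>2 * ((norm (F (c (Suc i)) x))\<^sup>2 - (norm (F (c i) x))\<^sup>2))"
      by (intro sum_mono le) auto
    also have "\<dots> = 4 * h\<^sup>2 * ((norm (F (c (Suc m)) x))\<^sup>2 - (norm (F (c 0) x))\<^sup>2)"
      by (simp only: sum_distrib_left[symmetric] sum_lessThan_telescope[of "\<lambda>i. (norm (F (c i) x))\<^sup>2"])
    also have "\<dots> \<le> 4 * h\<^sup>2 * (norm x)\<^sup>2"
    proof (rule mult_left_mono)
      have "(norm (F (c (Suc m)) x))\<^sup>2 \<le> (norm x)\<^sup>2"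
        by (intro power_mono F_contr) auto
      then show "(norm (F (c (Suc m)) x))\<^sup>2 - (norm (F (c 0) x))\<^sup>2 \<le> (norm x)\<^sup>2"
        using zero_le_power2[of "norm (F (c 0) x)"] by linarith
    qed simp
    finally show ?thesis by (simp add: h_def)
  qed
  moreover have "(\<lambda>m. 4 * (2 * real N / real (Suc m))\<^sup>2 * (norm x)\<^sup>2) \<longlonglongrightarrow> 4 * (2 * real N * 0)\<^sup>2 * (norm x)\<^sup>2"
    unfolding divide_inverse by (intro tendsto_intros LIMSEQ_inverse_real_of_nat)
  ultimately have "(norm v)\<^sup>2 \<le> 4 * (2 * real N * 0)\<^sup>2 * (norm x)\<^sup>2"
    by (intro LIMSEQ_le_const) auto
  then have "v = 0" by simp
  then show ?thesis using y by (simp add: v_def J_def)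
qed

text \<open>The truncations integrate to spectral pieces of \<open>A x\<close>, whose norms are at
  most that of \<open>A x\<close>. Fatou's lemma then gives square integrability, and dominated
  convergence identifies the value.\<close>

lemma has_int_A:
  assumes x: "x \<in> D" shows "has_int complex_of_real x (A x)"
proof -
  define f where "f N a = indicator {- real N<..real N} a * complex_of_real a" for N a
  have [measurable]: "f N \<in> borel_measurable borel" for N
    unfolding f_def by measurable
  have f: "has_int (f N) x (E {- real N<..real N} (A x))" for N
    using has_int_truncated[OF x, of N] x unfolding f_def by (simp add: E_Ioc_A)
  have lim: "(\<lambda>N. f N a) \<longlonglongrightarrow> complex_of_real a" for a
  proof (rule tendsto_eventually)
    obtain M where "\<bar>a\<bar> < real M" using reals_Archimedean2 by blast
    then show "\<forall>\<^sub>F N in sequentially. f N a = complex_of_real a"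
      by (intro eventually_sequentiallyI[of M]) (auto simp: f_def indicator_def)
  qed
  have "sq x complex_of_real = (\<integral>\<^sup>+ a. liminf (\<lambda>n. ennreal ((cmod (f n a))\<^sup>2)) \<partial>\<mu> x)"
    unfolding sq_def
  proof (rule nn_integral_cong)
    fix a
    have "(\<lambda>n. ennreal ((cmod (f n a))\<^sup>2)) \<longlonglongrightarrow> ennreal ((cmod (complex_of_real a))\<^sup>2)"
      by (intro tendsto_intros lim)
    then show "ennreal ((cmod (complex_of_real a))\<^sup>2) = liminf (\<lambda>n. ennreal ((cmod (f n a))\<^sup>2))"
      by (rule lim_imp_Liminf[OF sequentially_bot, symmetric])
  qed
  also have "\<dots> \<le> liminf (\<lambda>n. sq x (f n))"
    unfolding sq_def by (rule nn_integral_liminf) measurable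
  also have "\<dots> \<le> liminf (\<lambda>n. ennreal ((norm (A x))\<^sup>2))"
  proof (rule Liminf_mono, rule always_eventually, rule allI)
    fix n
    show "sq x (f n) \<le> ennreal ((norm (A x))\<^sup>2)"
      unfolding has_int_norm[OF f, symmetric] by (intro ennreal_leI power_mono E_contr) auto
  qed
  also have "\<dots> = ennreal ((norm (A x))\<^sup>2)"
    by (rule lim_imp_Liminf[OF sequentially_bot tendsto_const])
  finally have fin: "sq x complex_of_real < \<infinity>"
    using le_less_trans by fastforce
  then obtain y where y: "has_int complex_of_real x y"
    using ex_has_int[of complex_of_real x] by auto
  have "(\<lambda>N. E {- real N<..real N} (A x)) \<longlonglongrightarrow> y"
  proof (rule has_int_limit[OF f y])
    show "(\<lambda>n. sq x (\<lambda>a. f n a - complex_of_real a)) \<longlonglongrightarrow> 0"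
    proof (rule sq_dominated[OF _ _ _ _ fin])
      show "(\<lambda>n. f n a - complex_of_real a) \<longlonglongrightarrow> 0" for a
        using tendsto_diff[OF lim[of a] tendsto_const[of "complex_of_real a"]] by simp
    qed (auto simp: f_def indicator_def)
  qed
  moreover have "(\<lambda>N. E {- real N<..real N} (A x)) \<longlonglongrightarrow> A x"
    using tendsto_diff[OF F_at_top F_at_bot, of "A x"] by (simp add: E_Ioc)
  ultimately have "y = A x" using LIMSEQ_unique by blast
  then show ?thesis using y by simp
qed

text \<open>The integral is a symmetric extension of \<open>A\<close>, and a self-adjoint operator
  has no proper symmetric extension.\<close>

lemma has_int_iff_graph: "has_int complex_of_real x y \<longleftrightarrow> (x, y) \<in> op_graph D A"
proof
  assume h: "has_int complex_of_real x y"
  have "cinner x (A u) = cinner y u" if u: "u \<in> D" for u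
    using has_int_adjoint[OF h, of u "A u"] has_int_A[OF u] by simp
  then show "(x, y) \<in> op_graph D A"
    using adjoint_iff[of x y] by (auto simp: op_graph_def)
qed (auto simp: op_graph_def has_int_A)

end

theorem spectral_theorem:
  assumes "self_adjoint D A"
  shows "pvm (spectral_measure D A)"
    "has_pvm_integral (spectral_measure D A) complex_of_real x y \<longleftrightarrow> (x, y) \<in> op_graph D A"
proof -
  interpret complex_self_adjoint D A by standard (rule assms)
  have "\<exists>E. pvm E \<and> (\<forall>x y. has_pvm_integral E complex_of_real x y \<longleftrightarrow> (x, y) \<in> op_graph D A)"
    using pvm_E has_int_iff_graph by blast
  from someI_ex[OF this] show "pvm (spectral_measure D A)"
    "has_pvm_integral (spectral_measure D A) complex_of_real x y \<longleftrightarrow> (x, y) \<in> op_graph D A"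
    unfolding spectral_measure_def by blast+
qed

subsection \<open>Bounded functional calculus\<close>

text \<open>The set \<open>K\<close> carries the spectral measure; functions only need to be bounded there.\<close>

locale spectral_calculus = projection_valued_measure E for E :: "real set \<Rightarrow> 'a::chilbert_space \<Rightarrow> 'a" +
  fixes K :: "real set"
  assumes K [measurable]: "K \<in> sets borel" and E_K: "E (- K) x = 0"
begin

definition bdd :: "(real \<Rightarrow> complex) \<Rightarrow> bool" where
  "bdd f \<longleftrightarrow> f \<in> borel_measurable borel \<and> (\<exists>M. \<forall>a\<in>K. cmod (f a) \<le> M)"

lemma bddI: "f \<in> borel_measurable borel \<Longrightarrow> (\<And>a. a \<in> K \<Longrightarrow> cmod (f a) \<le> M) \<Longrightarrow> bdd f"
  by (auto simp: bdd_def)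

lemma bdd_borel [measurable_dest]: "bdd f \<Longrightarrow> f \<in> borel_measurable borel"
  by (simp add: bdd_def)

lemma bdd_bound:
  assumes "bdd f" shows "\<exists>M\<ge>0. \<forall>a\<in>K. cmod (f a) \<le> M"
proof -
  obtain M where "\<forall>a\<in>K. cmod (f a) \<le> M" using assms by (auto simp: bdd_def)
  then show ?thesis by (intro exI[of _ "max M 0"]) (auto simp: le_max_iff_disj)
qed

lemma bdd_add: assumes "bdd f" "bdd g" shows "bdd (\<lambda>a. f a + g a)"
proof -
  obtain M where M: "\<And>a. a \<in> K \<Longrightarrow> cmod (f a) \<le> M" using bdd_bound[OF assms(1)] by blast
  obtain N where N: "\<And>a. a \<in> K \<Longrightarrow> cmod (g a) \<le> N" using bdd_bound[OF assms(2)] by blast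
  show ?thesis
  proof (rule bddI)
    show "(\<lambda>a. f a + g a) \<in> borel_measurable borel" using assms by measurable
    show "cmod (f a + g a) \<le> M + N" if "a \<in> K" for a
      using M[OF that] N[OF that] norm_triangle_ineq[of "f a" "g a"] by linarith
  qed
qed

lemma bdd_mult: assumes "bdd f" "bdd g" shows "bdd (\<lambda>a. f a * g a)"
proof -
  obtain M where M: "0 \<le> M" "\<And>a. a \<in> K \<Longrightarrow> cmod (f a) \<le> M" using bdd_bound[OF assms(1)] by blast
  obtain N where N: "\<And>a. a \<in> K \<Longrightarrow> cmod (g a) \<le> N" using bdd_bound[OF assms(2)] by blast
  show ?thesis
  proof (rule bddI)
    show "(\<lambda>a. f a * g a) \<in> borel_measurable borel" using assms by measurable
    show "cmod (f a * g a) \<le> M * N" if "a \<in> K" for a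
      using M(2)[OF that] N[OF that] M(1) by (auto simp: norm_mult intro!: mult_mono)
  qed
qed

lemma bdd_const: "bdd (\<lambda>_. c)"
  by (rule bddI[of _ "cmod c"]) auto

lemma bdd_diff: "bdd f \<Longrightarrow> bdd g \<Longrightarrow> bdd (\<lambda>a. f a - g a)"
  using bdd_add[of f "\<lambda>a. -1 * g a"] bdd_mult[OF bdd_const[of "-1"]] by simp

lemma bdd_power: "bdd f \<Longrightarrow> bdd (\<lambda>a. f a ^ n)"
  by (induction n) (auto intro: bdd_const bdd_mult)

lemma bdd_sum: "(\<And>i. i \<in> I \<Longrightarrow> bdd (f i)) \<Longrightarrow> bdd (\<lambda>a. \<Sum>i\<in>I. f i a)"
  by (induction I rule: infinite_finite_induct) (auto intro: bdd_const bdd_add)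

lemma bdd_cnj: "bdd f \<Longrightarrow> bdd (\<lambda>a. cnj (f a))"
  using measurable_compose[OF bdd_borel borel_measurable_continuous_onI[OF continuous_on_cnj[OF continuous_on_id]]]
  by (auto simp: bdd_def)

lemma AE_K: "AE a in \<mu> x. a \<in> K"
proof (rule AE_I[of _ _ "- K"])
  show "emeasure (\<mu> x) (- K) = 0"
    by (subst emeasure_mu) (auto simp: E_K)
qed auto

lemma sq_mono_K:
  assumes "\<And>a. a \<in> K \<Longrightarrow> cmod (f a) \<le> cmod (g a)"
  shows "sq x f \<le> sq x g"
  unfolding sq_def
  by (intro nn_integral_mono_AE) (use AE_K[of x] in \<open>eventually_elim, auto intro!: ennreal_leI power_mono assms\<close>)

lemma sq_K_cong: "(\<And>a. a \<in> K \<Longrightarrow> f a = g a) \<Longrightarrow> sq x f = sq x g"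
  by (intro order_antisym sq_mono_K) auto

lemma sq_const: "sq x (\<lambda>_. c) = ennreal ((cmod c * norm x)\<^sup>2)"
  by (simp add: sq_def emeasure_mu power_mult_distrib ennreal_mult)

lemma sq_le_K:
  assumes "\<And>a. a \<in> K \<Longrightarrow> cmod (f a) \<le> M" "0 \<le> M"
  shows "sq x f \<le> ennreal ((M * norm x)\<^sup>2)"
  using sq_mono_K[of f "\<lambda>_. complex_of_real M" x] sq_const[of x "complex_of_real M"] assms by simp

definition Phi :: "(real \<Rightarrow> complex) \<Rightarrow> 'a \<Rightarrow> 'a" where
  "Phi f x = (THE y. has_int f x y)"

lemma Phi_eqI: "has_int f x y \<Longrightarrow> Phi f x = y"
  unfolding Phi_def using has_int_unique by blast

lemma has_Phi: assumes "bdd f" shows "has_int f x (Phi f x)"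
proof -
  obtain M where "0 \<le> M" "\<And>a. a \<in> K \<Longrightarrow> cmod (f a) \<le> M" using bdd_bound[OF assms] by blast
  then have "sq x f \<le> ennreal ((M * norm x)\<^sup>2)" by (intro sq_le_K) auto
  then have "sq x f < \<infinity>" using le_less_trans by fastforce
  then obtain y where "has_int f x y" using ex_has_int bdd_borel[OF assms] by blast
  then show ?thesis using Phi_eqI by simp
qed

lemma has_int_cong_K:
  assumes h: "has_int f x y" and g: "g \<in> borel_measurable borel" and eq: "\<And>a. a \<in> K \<Longrightarrow> f a = g a"
  shows "has_int g x y"
proof -
  have [measurable]: "f \<in> borel_measurable borel" using h by (rule has_int_borel)
  note [measurable] = g
  have 0: "sq x (\<lambda>a. g a - f a) = 0"
    using sq_K_cong[of "\<lambda>a. g a - f a" "\<lambda>_. 0" x] eq by (simp add: sq_const)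
  then obtain z where z: "has_int (\<lambda>a. g a - f a) x z"
    using ex_has_int[of "\<lambda>a. g a - f a" x] by auto
  with 0 has_int_norm[OF z] have "z = 0" by (simp add: ennreal_eq_0_iff)
  with has_int_add[OF z h] show ?thesis by simp
qed

lemma Phi_norm:
  assumes "f \<in> borel_measurable borel" "\<And>a. a \<in> K \<Longrightarrow> cmod (f a) \<le> M" "0 \<le> M"
  shows "norm (Phi f x) \<le> M * norm x"
proof -
  have "ennreal ((norm (Phi f x))\<^sup>2) \<le> ennreal ((M * norm x)\<^sup>2)"
    using has_int_norm[OF has_Phi[OF bddI[OF assms(1,2)]]] sq_le_K[OF assms(2,3)] by simp
  then have "(norm (Phi f x))\<^sup>2 \<le> (M * norm x)\<^sup>2"
    by (rule ennreal_le_iff[OF zero_le_power2, THEN iffD1])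
  then show ?thesis
    by (rule power2_le_imp_le) (use assms(3) in simp)
qed

lemma bounded_linear_Phi: assumes "bdd f" shows "bounded_linear (Phi f)"
proof -
  obtain M where M: "0 \<le> M" "\<And>a. a \<in> K \<Longrightarrow> cmod (f a) \<le> M" using bdd_bound[OF assms] by blast
  show ?thesis
  proof (rule bounded_linear_intro[where K = M])
    show "Phi f (x + y) = Phi f x + Phi f y" for x y
      by (intro Phi_eqI has_int_vector_add has_Phi assms)
    show "Phi f (r *\<^sub>R x) = r *\<^sub>R Phi f x" for r x
      unfolding scaleR_scaleC by (intro Phi_eqI has_int_vector_scaleC has_Phi assms)
    show "norm (Phi f x) \<le> norm x * M" for x
      using Phi_norm[OF bdd_borel[OF assms] M(2,1)] by (simp add: mult.commute)
  qed
qed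

definition Psi :: "(real \<Rightarrow> complex) \<Rightarrow> 'a \<Rightarrow>\<^sub>L 'a" where "Psi f = Blinfun (Phi f)"

lemma Psi_apply: "bdd f \<Longrightarrow> blinfun_apply (Psi f) x = Phi f x"
  unfolding Psi_def by (simp add: bounded_linear_Blinfun_apply bounded_linear_Phi)

lemma has_Psi: "bdd f \<Longrightarrow> has_int f x (Psi f x)"
  by (simp add: Psi_apply has_Phi)

lemma Psi_eqI:
  fixes T :: "'a \<Rightarrow>\<^sub>L 'a"
  assumes "bdd f" "\<And>x. has_int f x (T x)" shows "Psi f = T"
  by (rule blinfun_eqI) (use assms in \<open>simp add: Psi_apply Phi_eqI\<close>)

lemma Psi_norm:
  assumes "f \<in> borel_measurable borel" "\<And>a. a \<in> K \<Longrightarrow> cmod (f a) \<le> M" "0 \<le> M"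
  shows "norm (Psi f) \<le> M"
  using Phi_norm[OF assms] Psi_apply[OF bddI[OF assms(1,2)]] assms(3) by (intro norm_blinfun_bound) auto

lemma Psi_add: "bdd f \<Longrightarrow> bdd g \<Longrightarrow> Psi (\<lambda>a. f a + g a) = Psi f + Psi g"
  by (rule Psi_eqI) (auto simp: blinfun.add_left intro!: bdd_add has_int_add has_Psi)

lemma Psi_diff: "bdd f \<Longrightarrow> bdd g \<Longrightarrow> Psi (\<lambda>a. f a - g a) = Psi f - Psi g"
  by (rule Psi_eqI) (auto simp: blinfun.diff_left intro!: bdd_diff has_int_diff has_Psi)

lemma Psi_scaleR: "bdd f \<Longrightarrow> Psi (\<lambda>a. complex_of_real r * f a) = r *\<^sub>R Psi f"
  by (rule Psi_eqI)
    (auto simp: blinfun.scaleR_left scaleR_scaleC intro!: bdd_mult bdd_const has_int_cmult has_Psi)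

lemma Psi_0: "Psi (\<lambda>_. 0) = 0"
  by (rule Psi_eqI) (auto intro: has_int_0 bdd_const)

lemma Psi_1: "Psi (\<lambda>_. 1) = id_blinfun"
proof (rule Psi_eqI)
  show "has_int (\<lambda>_. 1) x (id_blinfun x)" for x
    using has_int_one by simp
qed (rule bdd_const)

lemma Psi_sum: "(\<And>i. i \<in> I \<Longrightarrow> bdd (f i)) \<Longrightarrow> Psi (\<lambda>a. \<Sum>i\<in>I. f i a) = (\<Sum>i\<in>I. Psi (f i))"
  by (induction I rule: infinite_finite_induct) (auto simp: Psi_0 Psi_add bdd_sum)

lemma Psi_mult: "bdd f \<Longrightarrow> bdd g \<Longrightarrow> Psi (\<lambda>a. f a * g a) = Psi f o\<^sub>L Psi g"
proof (rule Psi_eqI)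
  fix x assume f: "bdd f" and g: "bdd g"
  have "has_int f (Psi g x) (Psi (\<lambda>a. f a * g a) x)"
    by (intro has_int_comp[OF has_Psi[OF g] bdd_borel[OF f]] has_Psi bdd_mult f g)
  then have "Psi f (Psi g x) = Psi (\<lambda>a. f a * g a) x"
    using has_int_unique[OF has_Psi[OF f]] by blast
  then show "has_int (\<lambda>a. f a * g a) x ((Psi f o\<^sub>L Psi g) x)"
    using has_Psi[OF bdd_mult[OF f g], of x] by simp
qed (rule bdd_mult)

lemma Psi_cong:
  assumes "bdd f" "g \<in> borel_measurable borel" "\<And>a. a \<in> K \<Longrightarrow> f a = g a"
  shows "Psi f = Psi g"
proof -
  have "bdd g" using assms by (auto simp: bdd_def)
  then show ?thesis
    by (intro Psi_eqI[symmetric]) (auto intro: has_int_cong_K[OF has_Psi] assms)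
qed

lemma Psi_power: "bdd f \<Longrightarrow> Psi (\<lambda>a. f a ^ n) = blinfun_pow (Psi f) n"
  by (induction n) (auto simp: blinfun_pow_def Psi_1 Psi_mult bdd_power)

lemma Psi_adjoint: "bdd f \<Longrightarrow> is_adjoint (Psi f) (Psi (\<lambda>a. cnj (f a)))"
  unfolding is_adjoint_def using has_int_adjoint has_Psi bdd_cnj by blast

lemma Psi_inverse:
  assumes f: "bdd f" and g: "bdd g" and fg: "\<And>a. a \<in> K \<Longrightarrow> f a * g a = 1"
  shows "bij (blinfun_apply (Psi f))" "blinfun_inv (Psi f) = Psi g"
proof -
  have "Psi f o\<^sub>L Psi g = Psi (\<lambda>_. 1)" "Psi g o\<^sub>L Psi f = Psi (\<lambda>_. 1)"
    unfolding Psi_mult[OF f g, symmetric] Psi_mult[OF g f, symmetric]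
    by (auto intro!: Psi_cong bdd_mult f g simp: fg mult.commute)
  then have 1: "Psi f (Psi g x) = x" "Psi g (Psi f x) = x" for x
    by (metis Psi_1 blinfun_apply_blinfun_compose id_blinfun.rep_eq id_apply)+
  then show "bij (blinfun_apply (Psi f))" by (intro o_bij[of "blinfun_apply (Psi g)"]) (auto simp: fun_eq_iff)
  have "inv (blinfun_apply (Psi f)) = blinfun_apply (Psi g)"
    using 1 by (intro inv_unique_comp) (auto simp: fun_eq_iff)
  then show "blinfun_inv (Psi f) = Psi g" by (simp add: blinfun_inv_def blinfun_apply_inverse)
qed

text \<open>The norm of \<open>Psi\<close> is bounded by the supremum over \<open>K\<close>, so
  uniform convergence on the support becomes convergence in operator norm.\<close>

lemma Psi_limit:
  assumes f: "\<And>n. bdd (f n)" and g: "g \<in> borel_measurable borel"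
    and lim: "uniform_limit K f g sequentially"
  shows "bdd g" "(\<lambda>n. Psi (f n)) \<longlonglongrightarrow> Psi g"
proof -
  obtain n where n: "\<forall>a\<in>K. dist (f n a) (g a) < 1"
    using uniform_limitD[OF lim, of 1] eventually_happens'[of sequentially] by auto
  obtain M where M: "\<And>a. a \<in> K \<Longrightarrow> cmod (f n a) \<le> M" using bdd_bound[OF f] by blast
  show bg: "bdd g"
  proof (rule bddI[OF g])
    show "cmod (g a) \<le> M + 1" if "a \<in> K" for a
      using bspec[OF n that] M[OF that] norm_triangle_ineq3[of "f n a" "g a"] by (simp add: dist_norm)
  qed
  show "(\<lambda>n. Psi (f n)) \<longlonglongrightarrow> Psi g"
  proof (rule tendstoI)
    fix e :: real assume e: "0 < e"
    have "\<forall>\<^sub>F n in sequentially. \<forall>a\<in>K. dist (f n a) (g a) < e / 2"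
      by (rule uniform_limitD[OF lim]) (use e in simp)
    then show "\<forall>\<^sub>F n in sequentially. dist (Psi (f n)) (Psi g) < e"
    proof eventually_elim
      case (elim n)
      have "norm (Psi (f n) - Psi g) \<le> e / 2"
        unfolding Psi_diff[OF f bg, symmetric]
        by (rule Psi_norm) (use elim e bdd_borel[OF bdd_diff[OF f bg]] in \<open>auto simp: dist_norm less_imp_le\<close>)
      then show ?case using e by (simp add: dist_norm)
    qed
  qed
qed

text \<open>For a fixed vector, bounded pointwise convergence is convergence in L2 of its finite
  scalar measure. This is the mode available for the unitary group, where convergence is not
  uniform.\<close>

lemma Psi_strong_limit:
  assumes f: "\<And>n. bdd (f n)" and g: "bdd g"
    and bound: "\<And>n a. a \<in> K \<Longrightarrow> cmod (f n a - g a) \<le> M" and M: "0 \<le> M"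
    and lim: "\<And>a. a \<in> K \<Longrightarrow> (\<lambda>n. f n a) \<longlonglongrightarrow> g a"
  shows "(\<lambda>n. Psi (f n) x) \<longlonglongrightarrow> Psi g x"
proof (rule has_int_limit[OF has_Psi[OF f] has_Psi[OF g]])
  have [measurable]: "f n \<in> borel_measurable borel" "g \<in> borel_measurable borel" for n
    using f g by (auto intro: bdd_borel)
  have "(\<lambda>n. sq x (\<lambda>a. indicator K a * (f n a - g a))) \<longlonglongrightarrow> 0"
  proof (rule sq_dominated[where h = "\<lambda>_. complex_of_real M"])
    show "(\<lambda>n. indicator K a * (f n a - g a)) \<longlonglongrightarrow> 0" for a
    proof (cases "a \<in> K")
      case True
      then show ?thesis using LIM_zero[OF lim[OF True]] by simp
    qed simp
    show "cmod (indicator K a * (f n a - g a)) \<le> cmod (complex_of_real M)" for n a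
      using bound[of a n] M by (auto simp: indicator_def)
    show "sq x (\<lambda>_. complex_of_real M) < \<infinity>" by (simp add: sq_const)
  qed measurable
  moreover have "sq x (\<lambda>a. indicator K a * (f n a - g a)) = sq x (\<lambda>a. f n a - g a)" for n
    by (rule sq_K_cong) simp
  ultimately show "(\<lambda>n. sq x (\<lambda>a. f n a - g a)) \<longlonglongrightarrow> 0" by simp
qed

lemma Psi_series:
  assumes f: "\<And>j. bdd (f j)" and g: "g \<in> borel_measurable borel"
    and bound: "\<And>j a. a \<in> K \<Longrightarrow> cmod (f j a) \<le> b j" and b: "summable b"
    and sums: "\<And>a. a \<in> K \<Longrightarrow> (\<lambda>j. f j a) sums g a"
  shows "bdd g" "(\<lambda>j. Psi (f j)) sums Psi g"
proof -
  have "uniform_limit K (\<lambda>n a. \<Sum>j<n. f j a) (\<lambda>a. \<Sum>j. f j a) sequentially"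
    by (rule Weierstrass_m_test[OF bound b])
  also have "?this \<longleftrightarrow> uniform_limit K (\<lambda>n a. \<Sum>j<n. f j a) g sequentially"
    by (rule uniform_limit_cong') (use sums in \<open>auto simp: sums_iff\<close>)
  finally have lim: "uniform_limit K (\<lambda>n a. \<Sum>j<n. f j a) g sequentially" .
  have sum: "bdd (\<lambda>a. \<Sum>j<n. f j a)" for n by (intro bdd_sum f)
  show "bdd g" by (rule Psi_limit(1)[OF sum g lim])
  show "(\<lambda>j. Psi (f j)) sums Psi g"
    using Psi_limit(2)[OF sum g lim] by (simp add: sums_def Psi_sum f)
qed

text \<open>Applied to \<open>q\<close> and to \<open>- q\<close>, which yields the inverses of
  \<open>1 - T\<close> and \<open>1 + T\<close> together with their Neumann series; the series
  starting at \<open>Suc j\<close> serves the semigroup formula.\<close>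

lemma Psi_geometric:
  assumes q: "q \<in> borel_measurable borel" and r': "\<forall>a\<in>K. cmod (q a) \<le> r" "0 \<le> r" "r < 1"
  shows "bdd (\<lambda>a. 1 / (1 - q a))" "(\<lambda>j. Psi (\<lambda>a. q a ^ j)) sums Psi (\<lambda>a. 1 / (1 - q a))"
    "(\<lambda>j. Psi (\<lambda>a. q a ^ Suc j)) sums Psi (\<lambda>a. q a / (1 - q a))"
    "bij (blinfun_apply (id_blinfun - Psi q))" "blinfun_inv (id_blinfun - Psi q) = Psi (\<lambda>a. 1 / (1 - q a))"
proof -
  note r = bspec[OF r'(1)] r'(2,3)
  note [measurable] = q
  have bq: "bdd q" using q r(1) by (rule bddI)
  have q1: "cmod (q a) < 1" if "a \<in> K" for a using r(1)[OF that] r(3) by linarith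
  have 1: "bdd (\<lambda>a. 1 / (1 - q a)) \<and> (\<lambda>j. Psi (\<lambda>a. q a ^ j)) sums Psi (\<lambda>a. 1 / (1 - q a))"
    by (intro conjI; rule Psi_series[where b = "\<lambda>j. r ^ j" and f = "\<lambda>j a. q a ^ j"])
      (use q1 r in \<open>auto simp: norm_power intro!: bdd_power bq power_mono geometric_sums\<close>)
  then show *: "bdd (\<lambda>a. 1 / (1 - q a))" "(\<lambda>j. Psi (\<lambda>a. q a ^ j)) sums Psi (\<lambda>a. 1 / (1 - q a))" by auto
  show "(\<lambda>j. Psi (\<lambda>a. q a ^ Suc j)) sums Psi (\<lambda>a. q a / (1 - q a))"
  proof (rule Psi_series(2)[where b = "\<lambda>j. r ^ Suc j"])
    show "summable (\<lambda>j. r ^ Suc j)" using r by (simp add: summable_mult)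
    show "(\<lambda>j. q a ^ Suc j) sums (q a / (1 - q a))" if "a \<in> K" for a
      using sums_mult[OF geometric_sums[OF q1[OF that]], of "q a"] by simp
    show "cmod (q a ^ Suc j) \<le> r ^ Suc j" if "a \<in> K" for j a
      unfolding norm_power using r(1)[OF that] by (intro power_mono) auto
  qed (auto intro!: bdd_power bq bdd_mult)
  have i: "id_blinfun - Psi q = Psi (\<lambda>a. 1 - q a)"
    by (simp add: Psi_diff bdd_const bq Psi_1)
  have "(1 - q a) * (1 / (1 - q a)) = 1" if "a \<in> K" for a
    using q1[OF that] by auto
  from Psi_inverse[OF bdd_diff[OF bdd_const bq] *(1) this]
  show "bij (blinfun_apply (id_blinfun - Psi q))" "blinfun_inv (id_blinfun - Psi q) = Psi (\<lambda>a. 1 / (1 - q a))"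
    unfolding i by auto
qed

text \<open>Boundedness of \<open>a / (a - z)\<close> places the range of the candidate inverse
  inside the domain. Composition in either order then integrates a function equal to 1 on
  \<open>K\<close>.\<close>

lemma resolvent_eq:
  assumes graph: "\<And>x y. has_int complex_of_real x y \<longleftrightarrow> (x, y) \<in> op_graph D A"
    and g: "bdd (\<lambda>a. 1 / (complex_of_real a - z))" and ag: "bdd (\<lambda>a. complex_of_real a * (1 / (complex_of_real a - z)))"
    and nz: "\<And>a. a \<in> K \<Longrightarrow> complex_of_real a \<noteq> z"
  shows "bij_betw (\<lambda>x. A x - z *\<^sub>C x) D UNIV"
    "resolvent D A z = blinfun_apply (Psi (\<lambda>a. 1 / (complex_of_real a - z)))"
    "z \<in> resolvent_set D A"
proof -
  let ?R = "Psi (\<lambda>a. 1 / (complex_of_real a - z))"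
  have zx: "has_int (\<lambda>_. z) x (z *\<^sub>C x)" for x
    using has_int_cmult[OF has_int_one, of z x] by simp
  note one = has_int_one
  have R: "?R x \<in> D" "A (?R x) - z *\<^sub>C ?R x = x" for x
  proof -
    have "has_int complex_of_real (?R x) (Psi (\<lambda>a. complex_of_real a * (1 / (complex_of_real a - z))) x)"
      by (rule has_int_comp[OF has_Psi[OF g] _ has_Psi[OF ag]]) measurable
    then have gr: "?R x \<in> D" "A (?R x) = Psi (\<lambda>a. complex_of_real a * (1 / (complex_of_real a - z))) x"
      by (auto simp: graph op_graph_def)
    have "has_int (\<lambda>a. complex_of_real a * (1 / (complex_of_real a - z)) - z * (1 / (complex_of_real a - z))) x
        (A (?R x) - z *\<^sub>C ?R x)"
      unfolding gr(2) by (intro has_int_diff has_int_cmult has_Psi g ag)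
    then have "has_int (\<lambda>_. 1) x (A (?R x) - z *\<^sub>C ?R x)"
      by (rule has_int_cong_K) (use nz in \<open>auto simp flip: diff_divide_distrib\<close>)
    with one show "?R x \<in> D" "A (?R x) - z *\<^sub>C ?R x = x"
      using gr has_int_unique by blast+
  qed
  have L: "?R (A u - z *\<^sub>C u) = u" if u: "u \<in> D" for u
  proof -
    have "has_int complex_of_real u (A u)" using u by (auto simp: graph op_graph_def)
    then have h: "has_int (\<lambda>a. complex_of_real a - z) u (A u - z *\<^sub>C u)"
      by (intro has_int_diff zx)
    have "has_int (\<lambda>a. 1 / (complex_of_real a - z) * (complex_of_real a - z)) u u"
      by (rule has_int_cong_K[OF one]) (use nz in auto)
    from has_int_comp[OF h bdd_borel[OF g] this] show ?thesis
      using has_int_unique[OF has_Psi[OF g]] by blast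
  qed
  show bij: "bij_betw (\<lambda>x. A x - z *\<^sub>C x) D UNIV"
    by (rule bij_betwI[where g = "blinfun_apply ?R"]) (use R L in auto)
  show eq: "resolvent D A z = blinfun_apply ?R"
  proof
    fix x
    show "resolvent D A z x = ?R x"
      unfolding resolvent_def
      by (rule inv_into_f_eq[OF bij_betw_imp_inj_on[OF bij]]) (use R in auto)
  qed
  show "z \<in> resolvent_set D A"
    using bij by (simp add: resolvent_set_def eq blinfun.bounded_linear_right)
qed

end

subsection \<open>Scalar identities and limits\<close>

text \<open>With step \<open>h = 1 / 2^n\<close> this is the sum over \<open>j\<close> of
  \<open>h * exp (- j * h * w)\<close>, a Riemann sum for the Laplace integral of
  \<open>exp (- t * w)\<close> over \<open>t \<ge> 0\<close>; hence the limit
  \<open>1 / w\<close>.\<close>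

definition dyadic_mean :: "nat \<Rightarrow> complex \<Rightarrow> complex" where
  "dyadic_mean n w = (1 / 2 ^ n) / (1 - exp (- w / 2 ^ n))"

lemma dyadic_mean_telescope:
  assumes w: "Re w > 0"
  shows "1 / (1 - exp (- w)) - (\<Sum>k<n. (1 / 2 ^ Suc k) * (1 / (1 + exp (- w / 2 ^ Suc k)))) = dyadic_mean n w"
proof (induction n)
  case 0 then show ?case by (simp add: dyadic_mean_def)
next
  case (Suc n)
  define q where "q = exp (- w / 2 ^ Suc n)"
  have "cmod q < 1"
    unfolding q_def using w by (simp add: Re_divide_of_nat)
  then have "q \<noteq> 1" "q \<noteq> - 1" by auto
  then have q: "1 - q \<noteq> 0" "1 + q \<noteq> 0"
    by (auto simp: eq_neg_iff_add_eq_0 add.commute)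
  have "exp (- w / 2 ^ n) = q\<^sup>2"
    unfolding q_def exp_double[symmetric] by simp
  moreover have "1 / (1 - q\<^sup>2) = (1/2) * (1 / (1 - q) + 1 / (1 + q))"
  proof -
    have "1 - q\<^sup>2 = (1 - q) * (1 + q)" by (simp add: power2_eq_square algebra_simps)
    then show ?thesis using q by (simp add: field_simps)
  qed
  moreover have "(1 / 2 ^ n :: complex) = 2 * (1 / 2 ^ Suc n)" by simp
  ultimately have "dyadic_mean n w = 2 * (1 / 2 ^ Suc n) * ((1/2) * (1 / (1 - q) + 1 / (1 + q)))"
    unfolding dyadic_mean_def by (metis times_divide_eq_right mult.right_neutral)
  moreover have "2 * h * ((1/2) * (u + v)) - h * v = h * u" for h u v :: complex
    by (simp add: algebra_simps)
  moreover have "dyadic_mean (Suc n) w = (1 / 2 ^ Suc n) * (1 / (1 - q))"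
    by (simp add: dyadic_mean_def q_def)
  ultimately have "dyadic_mean n w - (1 / 2 ^ Suc n) * (1 / (1 + q)) = dyadic_mean (Suc n) w"
    by metis
  then show ?case
    unfolding sum.lessThan_Suc diff_diff_eq[symmetric] Suc q_def .
qed

text \<open>Both follow from \<open>1 + u \<le> exp u\<close>, at \<open>u = - y\<close> and at
  \<open>u = y\<close>.\<close>

lemma one_minus_exp_bounds:
  fixes y :: real
  assumes "y > 0"
  shows "1 / y \<le> 1 / (1 - exp (- y))" "1 / (1 - exp (- y)) \<le> 1 / y + 1"
proof -
  have 1: "1 - exp (- y) \<le> y" using exp_ge_add_one_self[of "- y"] by linarith
  have 2: "0 < 1 - exp (- y)" using assms by simp
  show "1 / y \<le> 1 / (1 - exp (- y))"
    using 1 2 by (intro divide_left_mono) (auto intro: mult_pos_pos assms)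
  have "exp (- y) * (1 + y) \<le> exp (- y) * exp y"
    by (intro mult_left_mono exp_ge_add_one_self) auto
  then have "y \<le> (1 + y) * (1 - exp (- y))"
    by (simp add: algebra_simps flip: exp_add)
  then show "1 / (1 - exp (- y)) \<le> 1 / y + 1"
    using assms 2 by (simp add: field_simps)
qed

text \<open>The reverse triangle inequality replaces \<open>w\<close> by its real part in the
  denominator, so the bound is constant on vertical lines and serves as the dominating
  constant.\<close>

lemma dyadic_mean_bound:
  assumes w: "Re w > 0"
  shows "cmod (dyadic_mean n w) \<le> 1 / Re w + 1 / 2 ^ n"
proof -
  let ?y = "Re w / 2 ^ n"
  have y: "?y > 0" using w by simp
  have "1 - exp (- ?y) \<le> cmod (1 - exp (- w / 2 ^ n))"
    using norm_triangle_ineq2[of 1 "exp (- w / 2 ^ n)"] by (simp add: Re_divide_of_nat)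
  moreover have "0 < 1 - exp (- ?y)" using y by simp
  ultimately have "1 / cmod (1 - exp (- w / 2 ^ n)) \<le> 1 / (1 - exp (- ?y))"
    by (intro divide_left_mono mult_pos_pos) linarith+
  also have "\<dots> \<le> 1 / ?y + 1" by (rule one_minus_exp_bounds(2)[OF y])
  finally have "(1 / 2 ^ n) * (1 / cmod (1 - exp (- w / 2 ^ n))) \<le> (1 / 2 ^ n) * (1 / ?y + 1)"
    by (intro mult_left_mono) auto
  also have "\<dots> = 1 / Re w + 1 / 2 ^ n" using w by (simp add: field_simps)
  finally show ?thesis
    by (simp add: dyadic_mean_def norm_divide norm_mult norm_power)
qed

lemma dyadic_mean_real:
  "dyadic_mean n (complex_of_real a) = complex_of_real ((1 / 2 ^ n) / (1 - exp (- a / 2 ^ n)))"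
  by (simp add: dyadic_mean_def flip: exp_of_real)

text \<open>The bounds of \<open>one_minus_exp_bounds\<close> at \<open>a / 2^n\<close>, scaled by
  \<open>1 / 2^n\<close>. The error is independent of \<open>a\<close>, whence convergence in
  operator norm.\<close>

lemma dyadic_mean_real_bound:
  fixes a :: real
  assumes a: "a > 0"
  shows "\<bar>(1 / 2 ^ n) / (1 - exp (- a / 2 ^ n)) - 1 / a\<bar> \<le> 1 / 2 ^ n"
proof -
  let ?y = "a / 2 ^ n"
  have y: "?y > 0" using a by simp
  have "(1 / 2 ^ n) * (1 / ?y) \<le> (1 / 2 ^ n) * (1 / (1 - exp (- ?y)))"
    "(1 / 2 ^ n) * (1 / (1 - exp (- ?y))) \<le> (1 / 2 ^ n) * (1 / ?y + 1)"
    by (rule mult_left_mono[OF one_minus_exp_bounds(1)[OF y]], simp,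
        rule mult_left_mono[OF one_minus_exp_bounds(2)[OF y]], simp)
  moreover have "(1 / 2 ^ n) * (1 / ?y) = 1 / a" by simp
  moreover have "(1 / 2 ^ n) * (1 / ?y + 1) = 1 / a + 1 / 2 ^ n"
    unfolding distrib_left by simp
  moreover have "(1 / 2 ^ n) * (1 / (1 - exp (- ?y))) = (1 / 2 ^ n) / (1 - exp (- a / 2 ^ n))"
    by simp
  ultimately show ?thesis by linarith
qed

lemma inverse_two_power_tendsto: "(\<lambda>n. 1 / 2 ^ n :: real) \<longlonglongrightarrow> 0"
  using LIMSEQ_power_zero[of "1/2 :: real"] by (simp add: power_one_over)

text \<open>Up to sign and inversion this is the difference quotient of \<open>exp (- w * z)\<close>
  at 0 along \<open>z = 1 / 2^n\<close>.\<close>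

lemma dyadic_mean_tendsto:
  assumes w: "Re w > 0"
  shows "(\<lambda>n. dyadic_mean n w) \<longlonglongrightarrow> 1 / w"
proof -
  have "((\<lambda>z. exp (- w * z)) has_field_derivative - w) (at 0)"
    by (auto intro!: derivative_eq_intros)
  then have D: "(\<lambda>h. (exp (- w * h) - 1) / h) \<midarrow>0\<rightarrow> - w"
    by (simp add: DERIV_def)
  have h: "filterlim (\<lambda>n. 1 / 2 ^ n :: complex) (at 0) sequentially"
    using LIMSEQ_power_zero[of "1/2 :: complex"]
    by (auto simp: filterlim_at power_one_over norm_divide)
  have "(\<lambda>n. (exp (- w * (1 / 2 ^ n)) - 1) / (1 / 2 ^ n)) \<longlonglongrightarrow> - w"
    by (rule filterlim_compose[OF D h])
  then have "(\<lambda>n. inverse (- ((exp (- w * (1 / 2 ^ n)) - 1) / (1 / 2 ^ n)))) \<longlonglongrightarrow> inverse (- (- w))"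
    using w by (intro tendsto_inverse tendsto_minus) auto
  moreover have "inverse (- ((exp (- w * (1 / 2 ^ n)) - 1) / (1 / 2 ^ n))) = dyadic_mean n w" for n
  proof -
    have e: "- w * (1 / 2 ^ n) = - w / 2 ^ n" by simp
    show ?thesis
      unfolding e minus_divide_left minus_diff_eq inverse_divide dyadic_mean_def ..
  qed
  ultimately show ?thesis by (simp add: divide_inverse)
qed

section \<open>The Gamma function and polylogarithms near 1\<close>

lemma Gamma_reflection_real:
  fixes s :: real
  assumes "s \<notin> \<int>"
  shows "Gamma s * sin (pi * s) * Gamma (1 - s) = pi"
proof -
  have "sin (pi * s) \<noteq> 0"
    using assms sin_zero_iff_int2[of "pi * s"] by (auto simp: mult.commute)
  moreover have "complex_of_real (Gamma s * Gamma (1 - s)) = complex_of_real (pi / sin (pi * s))"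
  proof -
    have "1 - complex_of_real s = complex_of_real (1 - s)"
      "complex_of_real pi * complex_of_real s = complex_of_real (pi * s)" by simp_all
    then have "Gamma (complex_of_real s) * Gamma (complex_of_real (1 - s)) = complex_of_real pi / sin (complex_of_real (pi * s))"
      using Gamma_reflection_complex[of "complex_of_real s"] by (simp only:)
    then show ?thesis
      by (simp only: Gamma_complex_of_real sin_of_real of_real_mult[symmetric] of_real_divide[symmetric])
  qed
  then have "Gamma s * Gamma (1 - s) = pi / sin (pi * s)"
    using of_real_eq_iff by blast
  ultimately show ?thesis by (simp add: field_simps)
qed

text \<open>An Abelian theorem: the ratio of the coefficients determines the ratio of the sums as
  \<open>x\<close> tends to 1. Initial terms stay bounded while \<open>C x\<close> diverges, and the
  tail is compared coefficient by coefficient.\<close>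

lemma power_series_comparison:
  fixes a c :: "nat \<Rightarrow> real"
  assumes c: "\<And>k. 0 < c k" and lim: "(\<lambda>k. a k / c k) \<longlonglongrightarrow> L"
    and C: "\<And>x. 0 \<le> x \<Longrightarrow> x < 1 \<Longrightarrow> (\<lambda>k. c k * x ^ k) sums C x"
    and C_top: "((\<lambda>x. 1 / C x) \<longlongrightarrow> 0) (at_left 1)" and C_pos: "\<And>x. 0 \<le> x \<Longrightarrow> x < 1 \<Longrightarrow> 0 < C x"
  shows "0 \<le> x \<Longrightarrow> x < 1 \<Longrightarrow> summable (\<lambda>k. \<bar>a k * x ^ k\<bar>)"
    "\<exists>B. \<forall>x\<in>{0..<1}. \<bar>(\<Sum>k. a k * x ^ k) / C x\<bar> \<le> B"
    "((\<lambda>x. (\<Sum>k. a k * x ^ k) / C x) \<longlongrightarrow> L) (at_left 1)"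
proof -
  have "Bseq (\<lambda>k. a k / c k)" using lim by (intro convergent_imp_Bseq convergentI)
  then obtain B where "\<And>k. \<bar>a k / c k\<bar> \<le> B" by (auto simp: Bseq_def)
  then have "\<bar>a k\<bar> / c k \<le> B" for k
    using c[of k] by (metis abs_divide abs_of_pos)
  then have B: "\<bar>a k\<bar> \<le> B * c k" for k
    using pos_divide_le_eq[OF c[of k]] by blast
  have bound: "\<bar>a k * x ^ k\<bar> \<le> B * (c k * x ^ k)" if "0 \<le> x" for k x
    using mult_right_mono[OF B[of k], of "x ^ k"] that by (simp add: abs_mult mult.assoc)
  have sB: "(\<lambda>k. B * (c k * x ^ k)) sums (B * C x)" if "0 \<le> x" "x < 1" for x
    by (rule sums_mult[OF C[OF that]])
  show summ: "summable (\<lambda>k. \<bar>a k * x ^ k\<bar>)" if "0 \<le> x" "x < 1" for x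
    by (rule summable_comparison_test'[OF sums_summable[OF sB[OF that]]]) (simp add: bound that)
  show "\<exists>B. \<forall>x\<in>{0..<1}. \<bar>(\<Sum>k. a k * x ^ k) / C x\<bar> \<le> B"
  proof (intro exI ballI)
    fix x :: real assume x: "x \<in> {0..<1}"
    have "\<bar>\<Sum>k. a k * x ^ k\<bar> \<le> B * C x"
      using norm_suminf_le[of "\<lambda>k. a k * x ^ k" "\<lambda>k. B * (c k * x ^ k)"] sB[of x] bound[of x] x
      by (auto simp: sums_iff)
    then show "\<bar>(\<Sum>k. a k * x ^ k) / C x\<bar> \<le> B"
      using C_pos[of x] x by (simp add: field_simps)
  qed
  show "((\<lambda>x. (\<Sum>k. a k * x ^ k) / C x) \<longlongrightarrow> L) (at_left 1)"
  proof (rule tendstoI)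
    fix e :: real assume e: "0 < e"
    obtain N where N: "\<And>k. k \<ge> N \<Longrightarrow> \<bar>a k / c k - L\<bar> < e/2"
      using LIMSEQ_D[OF lim, of "e/2"] e by auto
    define d where "d k = a k - L * c k" for k
    have d: "\<bar>d k\<bar> \<le> e/2 * c k" if "k \<ge> N" for k
    proof -
      have "d k = (a k / c k - L) * c k" using c[of k] by (simp add: d_def field_simps)
      then show ?thesis
        using N[OF that] c[of k] by (simp add: abs_mult)
    qed
    \<comment> \<open>The initial terms contribute at most this much for every \<open>x\<close> in
      the unit interval, since the powers of \<open>x\<close> are at most 1.\<close>
    define M where "M = (\<Sum>k<N. \<bar>d k\<bar>)"
    have main: "\<bar>(\<Sum>k. a k * x ^ k) - L * C x\<bar> \<le> M + e/2 * C x" if x: "0 \<le> x" "x < 1" for x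
    proof -
      have sa: "(\<lambda>k. a k * x ^ k) sums (\<Sum>k. a k * x ^ k)"
        by (rule summable_sums[OF summable_rabs_cancel[OF summ[OF x]]])
      have "(\<lambda>k. a k * x ^ k - L * (c k * x ^ k)) sums ((\<Sum>k. a k * x ^ k) - L * C x)"
        by (intro sums_diff sa sums_mult C x)
      then have sd: "(\<lambda>k. d k * x ^ k) sums ((\<Sum>k. a k * x ^ k) - L * C x)"
        by (simp add: d_def algebra_simps)
      have "(\<lambda>k. if k \<in> {..<N} then \<bar>d k\<bar> else 0) sums M"
        unfolding M_def by (rule sums_If_finite_set) simp
      then have sb: "(\<lambda>k. (if k \<in> {..<N} then \<bar>d k\<bar> else 0) + e/2 * (c k * x ^ k)) sums (M + e/2 * C x)"
        by (intro sums_add sums_mult C x)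
      have "norm (d k * x ^ k) \<le> (if k \<in> {..<N} then \<bar>d k\<bar> else 0) + e/2 * (c k * x ^ k)" for k
      proof (cases "k < N")
        case True
        have "\<bar>d k\<bar> * x ^ k \<le> \<bar>d k\<bar> * 1"
          using x by (intro mult_left_mono power_le_one) auto
        moreover have "0 \<le> e/2 * (c k * x ^ k)"
          using e c[of k] x by (intro mult_nonneg_nonneg) auto
        ultimately show ?thesis using True x by (simp add: abs_mult)
      next
        case False
        then show ?thesis
          using mult_right_mono[OF d[of k], of "x ^ k"] x by (simp add: abs_mult mult.assoc)
      qed
      from norm_suminf_le[OF this sums_summable[OF sb]] show ?thesis
        using sums_unique[OF sd] sums_unique[OF sb] by simp
    qed
    have "((\<lambda>x. M * (1 / C x)) \<longlongrightarrow> M * 0) (at_left 1)"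
      by (intro tendsto_intros C_top)
    then have "\<forall>\<^sub>F x in at_left 1. M * (1 / C x) < e/2"
      by (rule order_tendstoD(2)) (use e in simp)
    moreover have "\<forall>\<^sub>F x in at_left (1::real). x \<in> {0<..<1}"
      by (rule eventually_at_left_real) simp
    ultimately show "\<forall>\<^sub>F x in at_left 1. dist ((\<Sum>k. a k * x ^ k) / C x) L < e"
    proof eventually_elim
      case (elim x)
      then have x: "0 \<le> x" "x < 1" by auto
      have "dist ((\<Sum>k. a k * x ^ k) / C x) L = \<bar>(\<Sum>k. a k * x ^ k) - L * C x\<bar> / C x"
        using C_pos[OF x] by (simp add: dist_real_def field_simps abs_divide)
      also have "\<dots> \<le> (M + e/2 * C x) / C x"
        using main[OF x] C_pos[OF x] by (intro divide_right_mono) auto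
      also have "\<dots> = M * (1 / C x) + e/2"
        using C_pos[OF x] by (simp add: field_simps)
      finally show ?case using elim(1) by linarith
    qed
  qed
qed

text \<open>The term for \<open>k = 0\<close> vanishes because \<open>0\<close> \<open>powr\<close> \<open>_ = 0\<close>.\<close>

definition real_polylog :: "real \<Rightarrow> real \<Rightarrow> real" where
  "real_polylog s x = (\<Sum>k. real k powr (- s) * x ^ k)"

text \<open>The coefficients of \<open>(1 - x)\<close> \<open>powr\<close> \<open>(s - 1)\<close> are asymptotic to
  \<open>k\<close> \<open>powr\<close> \<open>(- s)\<close> \<open>/ \<Gamma>(1 - s)\<close>, by the limit formula for the Gamma function.\<close>

lemma polylog_facts:
  assumes s: "s < 1"
  shows "\<bar>x\<bar> < 1 \<Longrightarrow> summable (\<lambda>k. \<bar>real k powr (- s) * x ^ k\<bar>)"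
    "\<exists>B. \<forall>x\<in>{0..<1}. \<bar>real_polylog s x * (1 - x) powr (1 - s)\<bar> \<le> B"
    "((\<lambda>x. real_polylog s x * (1 - x) powr (1 - s)) \<longlongrightarrow> Gamma (1 - s)) (at_left 1)"
proof -
  \<comment> \<open>These are the binomial coefficients of \<open>s - 1\<close> with alternating
    sign, that is, the Taylor coefficients of \<open>(1 - x) powr (s - 1)\<close>, and they are
    positive as \<open>s < 1\<close>.\<close>
  define c where "c k = pochhammer (1 - s) k / fact k" for k :: nat
  have c: "0 < c k" for k using s by (simp add: c_def pochhammer_pos)
  have "Gamma_series' (1 - s) \<longlonglongrightarrow> Gamma (1 - s)" by (rule Gamma_series'_LIMSEQ)
  moreover have "\<forall>\<^sub>F k in sequentially. Gamma_series' (1 - s) k = real k powr (- s) / c k"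
  proof (rule eventually_sequentiallyI[of 1])
    fix k :: nat assume k: "1 \<le> k"
    then have "fact k = real k * fact (k - 1)" using fact_reduce[of k] by simp
    moreover have "exp ((1 - s) * ln (real k)) = real k * real k powr (- s)"
      using k by (simp add: powr_def left_diff_distrib exp_diff exp_minus divide_inverse)
    ultimately show "Gamma_series' (1 - s) k = real k powr (- s) / c k"
      by (simp add: Gamma_series'_def c_def)
  qed
  ultimately have lim: "(\<lambda>k. real k powr (- s) / c k) \<longlonglongrightarrow> Gamma (1 - s)"
    by (rule Lim_transform_eventually)
  have C: "(\<lambda>k. c k * x ^ k) sums (1 - x) powr (s - 1)" if "0 \<le> x" "x < 1" for x
  proof -
    have "(\<lambda>k. ((s - 1) gchoose k) * (- x) ^ k) sums (1 + (- x)) powr (s - 1)"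
      using that by (intro gen_binomial_real) auto
    moreover have "((s - 1) gchoose k) * (- x) ^ k = c k * x ^ k" for k
      unfolding gbinomial_pochhammer c_def power_minus[of x k]
      by (simp add: power_mult_distrib[symmetric] flip: power_add mult.assoc)
    ultimately show ?thesis by simp
  qed
  have inv: "1 / (1 - x) powr (s - 1) = (1 - x) powr (1 - s)" for x
    by (metis inverse_eq_divide minus_diff_eq powr_minus)
  have C_top: "((\<lambda>x. 1 / (1 - x) powr (s - 1)) \<longlongrightarrow> 0) (at_left 1)"
  proof -
    have "((\<lambda>x. (1 - x) powr (1 - s)) \<longlongrightarrow> 0 powr (1 - s)) (at_left 1)"
    proof (rule tendsto_powr2)
      have "((\<lambda>x::real. 1 - x) \<longlongrightarrow> 1 - 1) (at_left 1)" by (intro tendsto_intros)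
      then show "((\<lambda>x::real. 1 - x) \<longlongrightarrow> 0) (at_left 1)" by simp
      show "\<forall>\<^sub>F x in at_left (1::real). 0 \<le> 1 - x"
        using eventually_at_left_real[of 0 "1::real"] by (auto elim: eventually_mono)
    qed (use s in auto)
    then show ?thesis by (simp add: inv)
  qed
  have pos: "0 < (1 - x) powr (s - 1)" if "0 \<le> x" "x < 1" for x using that by simp
  have "summable (\<lambda>k. \<bar>real k powr (- s) * x ^ k\<bar>)" if "0 \<le> x" "x < 1" for x
    by (rule power_series_comparison(1)[OF c lim C C_top pos that])
  from this[of "\<bar>x\<bar>"] show "summable (\<lambda>k. \<bar>real k powr (- s) * x ^ k\<bar>)" if "\<bar>x\<bar> < 1"
    using that by (simp add: abs_mult power_abs)
  have div: "y / (1 - x) powr (s - 1) = y * (1 - x) powr (1 - s)" for x y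
    by (metis inv mult.right_neutral times_divide_eq_right)
  have "\<exists>B. \<forall>x\<in>{0..<1}. \<bar>(\<Sum>k. real k powr (- s) * x ^ k) / (1 - x) powr (s - 1)\<bar> \<le> B"
    by (rule power_series_comparison(2)[OF c lim C C_top pos])
  then show "\<exists>B. \<forall>x\<in>{0..<1}. \<bar>real_polylog s x * (1 - x) powr (1 - s)\<bar> \<le> B"
    unfolding div real_polylog_def .
  have "((\<lambda>x. (\<Sum>k. real k powr (- s) * x ^ k) / (1 - x) powr (s - 1)) \<longlongrightarrow> Gamma (1 - s)) (at_left 1)"
    by (rule power_series_comparison(3)[OF c lim C C_top pos])
  then show "((\<lambda>x. real_polylog s x * (1 - x) powr (1 - s)) \<longlongrightarrow> Gamma (1 - s)) (at_left 1)"
    unfolding div real_polylog_def .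
qed

lemma polylog_sums:
  assumes "s < 1" "\<bar>x\<bar> < 1"
  shows "(\<lambda>k. real k powr (- s) * x ^ k) sums real_polylog s x"
  unfolding real_polylog_def
  by (rule summable_sums[OF summable_rabs_cancel[OF polylog_facts(1)[OF assms]]])

text \<open>The odd powers cancel. On the even ones \<open>(2 * k) powr (- s)\<close> splits off
  \<open>2 powr (- s)\<close>, and the two equal summands supply the remaining factor 2.\<close>

lemma polylog_duplication:
  assumes s: "s < 1" and x: "\<bar>x\<bar> < 1"
  shows "real_polylog s x + real_polylog s (- x) = 2 powr (1 - s) * real_polylog s (x\<^sup>2)"
proof -
  let ?f = "\<lambda>k. real k powr (- s) * x ^ k + real k powr (- s) * (- x) ^ k"
  have 1: "?f sums (real_polylog s x + real_polylog s (- x))"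
    using x by (intro sums_add polylog_sums s) auto
  have "x\<^sup>2 < 1" using x by (simp add: abs_square_less_1)
  then have "(\<lambda>k. 2 powr (1 - s) * (real k powr (- s) * (x\<^sup>2) ^ k)) sums (2 powr (1 - s) * real_polylog s (x\<^sup>2))"
    by (intro sums_mult polylog_sums s) auto
  moreover have "2 powr (1 - s) * (real k powr (- s) * (x\<^sup>2) ^ k) = ?f (2 * k)" for k
  proof -
    have "2 powr (1 - s) = 2 * 2 powr (- s)" by (simp add: powr_diff powr_minus divide_inverse)
    moreover have "real (2 * k) powr (- s) = 2 powr (- s) * real k powr (- s)" by (simp add: powr_mult)
    moreover have "x ^ (2 * k) = (x\<^sup>2) ^ k" "(- x) ^ (2 * k) = (x\<^sup>2) ^ k" by (simp_all add: power_mult)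
    ultimately show ?thesis by simp
  qed
  ultimately have "(\<lambda>k. ?f (2 * k)) sums (2 powr (1 - s) * real_polylog s (x\<^sup>2))" by simp
  moreover have "(\<lambda>k. ?f (2 * k)) sums c \<longleftrightarrow> ?f sums c" for c
  proof (rule sums_mono_reindex)
    show "strict_mono (\<lambda>k::nat. 2 * k)" by (simp add: strict_mono_def)
    fix k :: nat assume "k \<notin> range (\<lambda>k. 2 * k)"
    then have "odd k" by (auto elim!: evenE)
    then show "?f k = 0" by simp
  qed
  ultimately show ?thesis using 1 sums_unique2 by blast
qed

text \<open>The remainder of the telescoping. For \<open>s = 0\<close> it is the real
  \<open>dyadic_mean\<close> diminished by \<open>1 / 2^n\<close>, the constant term of the
  geometric series being absent.\<close>

definition polylog_mean :: "real \<Rightarrow> nat \<Rightarrow> real \<Rightarrow> real" where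
  "polylog_mean s n a = 2 powr (- real n * (1 - s)) * real_polylog s (exp (- a / 2 ^ n))"

lemma polylog_mean_telescope:
  assumes s: "s < 1" and a: "a > 0"
  shows "real_polylog s (exp (- a))
    - (\<Sum>k<n. 2 powr (- real (Suc k) * (1 - s)) * real_polylog s (- exp (- a / 2 ^ Suc k))) = polylog_mean s n a"
proof (induction n)
  case 0 then show ?case by (simp add: polylog_mean_def)
next
  case (Suc n)
  define q where "q = exp (- a / 2 ^ Suc n)"
  have "\<bar>q\<bar> < 1" using a by (simp add: q_def)
  from polylog_duplication[OF s this]
  have d: "real_polylog s (- q) = 2 powr (1 - s) * real_polylog s (q\<^sup>2) - real_polylog s q" by simp
  have q2: "q\<^sup>2 = exp (- a / 2 ^ n)"
    unfolding q_def exp_double[symmetric] by simp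
  have "2 powr (- real (Suc n) * (1 - s)) * 2 powr (1 - s) = 2 powr (- real n * (1 - s))"
    by (simp add: algebra_simps flip: powr_add)
  then have "polylog_mean s n a - 2 powr (- real (Suc n) * (1 - s)) * real_polylog s (- q) = polylog_mean s (Suc n) a"
    unfolding polylog_mean_def d q2 q_def[symmetric] by (simp add: right_diff_distrib flip: mult.assoc)
  then show ?case
    unfolding sum.lessThan_Suc diff_diff_eq[symmetric] Suc q_def .
qed

text \<open>The mean factors as \<open>G powr p * \<rho>\<close>, where \<open>G\<close> tends to
  \<open>1 / a\<close> uniformly, but \<open>\<rho>\<close> is close to \<open>L\<close> only when
  \<open>a / 2^n\<close> is small. For bounded \<open>a\<close> this is so once \<open>n\<close> is
  large; for large \<open>a\<close> the factor \<open>G powr p\<close> is small and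
  \<open>\<rho>\<close> is merely bounded. The threshold is \<open>M\<close>.\<close>

lemma polylog_mean_uniform_limit:
  assumes s: "s < 1" and \<epsilon>: "\<epsilon> > 0"
  shows "uniform_limit {\<epsilon>..} (polylog_mean s) (\<lambda>a. Gamma (1 - s) * a powr (s - 1)) sequentially"
proof (rule uniform_limitI)
  fix e :: real assume e: "0 < e"
  define p where "p = 1 - s"
  have p: "p > 0" using s by (simp add: p_def)
  define \<rho> where "\<rho> x = real_polylog s x * (1 - x) powr p" for x
  define G where "G n a = (1 / 2 ^ n) / (1 - exp (- a / 2 ^ n))" for n and a :: real
  define L where "L = Gamma p"
  have L: "L > 0" using p by (simp add: L_def Gamma_real_pos)
  obtain B where "\<And>x. 0 \<le> x \<Longrightarrow> x < 1 \<Longrightarrow> \<bar>\<rho> x\<bar> \<le> B"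
    using polylog_facts(2)[OF s] unfolding \<rho>_def p_def by (meson atLeastLessThan_iff)
  then have B: "\<And>x. 0 \<le> x \<Longrightarrow> x < 1 \<Longrightarrow> \<bar>\<rho> x\<bar> \<le> B" "0 \<le> B"
    using abs_ge_zero order_trans zero_le_one by (blast, meson abs_ge_zero order_refl order_trans zero_less_one)
  have mean: "polylog_mean s n a = (G n a) powr p * \<rho> (exp (- a / 2 ^ n))" if "a > 0" for n a
  proof -
    have pos: "0 < 1 - exp (- a / 2 ^ n)" using that by simp
    have "(G n a) powr p = (1 / 2 ^ n) powr p / (1 - exp (- a / 2 ^ n)) powr p"
      unfolding G_def by (rule powr_divide)
    moreover have "(1 / 2 ^ n :: real) powr p = 2 powr (- real n * p)"
    proof -
      have "(1 / 2 ^ n :: real) = 2 powr (- real n)"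
        by (simp add: powr_minus_divide powr_realpow)
      then show ?thesis by (simp only: powr_powr)
    qed
    ultimately have "(G n a) powr p = 2 powr (- real n * p) / (1 - exp (- a / 2 ^ n)) powr p"
      by simp
    moreover have "(1 - exp (- a / 2 ^ n)) powr p \<noteq> 0"
      using pos by (metis less_irrefl powr_eq_0_iff)
    moreover have "u * l = u / z * (l * z)" if "z \<noteq> 0" for u l z :: real
      using that by simp
    ultimately show ?thesis
      unfolding polylog_mean_def \<rho>_def p_def[symmetric] by metis
  qed
  have Gb: "\<bar>G n a - 1 / a\<bar> \<le> 1 / 2 ^ n" "0 \<le> G n a" if "a > 0" for n a
    using dyadic_mean_real_bound[OF that, of n] that by (auto simp: G_def)
  \<comment> \<open>Solves \<open>d powr p * (B + L) = e / 4\<close>: if \<open>G\<close> is at most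
    \<open>d\<close>, boundedness of \<open>\<rho>\<close> suffices.\<close>
  define d where "d = (e / (4 * (B + L))) powr (1 / p)"
  have BL: "B + L > 0" using B L by simp
  have "d powr p = e / (4 * (B + L))"
    using e BL p by (simp add: d_def powr_powr)
  moreover have "e / (4 * z) * z = e / 4" if "z > 0" for z
    using that by simp
  ultimately have d: "d > 0" "d powr p * (B + L) = e / 4"
    using e BL by (auto simp: d_def simp del: distrib_left_numeral)
  \<comment> \<open>Beyond \<open>M\<close> one has \<open>1 / a \<le> d / 2\<close>, which leaves
    \<open>d / 2\<close> for the distance between \<open>G\<close> and \<open>1 / a\<close>.\<close>
  define M where "M = max \<epsilon> (2 / d)"
  \<comment> \<open>The interval contains \<open>1 / a\<close> and all values of \<open>G\<close>
    for \<open>a \<ge> \<epsilon>\<close>, so closeness of \<open>G\<close> to \<open>1 / a\<close>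
    passes to the powers uniformly in \<open>a\<close>.\<close>
  have "uniformly_continuous_on {0..1/\<epsilon> + 1} (\<lambda>y::real. y powr p)"
    by (intro compact_uniformly_continuous continuous_on_powr' continuous_on_id continuous_on_const)
      (use p in auto)
  then obtain \<delta> where \<delta>: "\<delta> > 0"
    "\<And>y z. y \<in> {0..1/\<epsilon>+1} \<Longrightarrow> z \<in> {0..1/\<epsilon>+1} \<Longrightarrow> dist z y < \<delta> \<Longrightarrow> dist (z powr p) (y powr p) < e / (2 * L)"
    unfolding uniformly_continuous_on_def using e L by (metis divide_pos_pos mult_pos_pos zero_less_numeral)
  \<comment> \<open>An upper bound of \<open>G powr p\<close> over all
    \<open>a \<ge> \<epsilon>\<close>, used on the bounded range of \<open>a\<close>.\<close>
  define R where "R = (1/\<epsilon> + 1) powr p"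
  have "1/\<epsilon> + 1 > 0" using \<epsilon> by (intro add_pos_pos) auto
  then have R: "R > 0" by (simp add: R_def)
  have "\<forall>\<^sub>F x in at_left 1. dist (\<rho> x) L < e / (4 * R)"
    using polylog_facts(3)[OF s] e R unfolding \<rho>_def p_def L_def by (intro tendstoD) auto
  then obtain b where b: "b < 1" "\<And>x. b < x \<Longrightarrow> x < 1 \<Longrightarrow> dist (\<rho> x) L < e / (4 * R)"
    unfolding eventually_at_left_field by auto
  have "(\<lambda>n. exp (- (M * (1 / 2 ^ n)))) \<longlonglongrightarrow> exp (- (M * 0))"
    by (intro tendsto_intros inverse_two_power_tendsto)
  then have "\<forall>\<^sub>F n in sequentially. b < exp (- (M * (1 / 2 ^ n)))"
    by (rule order_tendstoD) (use b in simp)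
  moreover have "\<forall>\<^sub>F n in sequentially. 1 / 2 ^ n < min \<delta> (d / 2)"
    by (rule order_tendstoD[OF inverse_two_power_tendsto]) (use \<delta> d in simp)
  ultimately show "\<forall>\<^sub>F n in sequentially. \<forall>a\<in>{\<epsilon>..}. dist (polylog_mean s n a) (Gamma (1 - s) * a powr (s - 1)) < e"
  proof eventually_elim
    case (elim n)
    show ?case
    proof
      fix a assume a': "a \<in> {\<epsilon>..}"
      then have a: "a > 0" "\<epsilon> \<le> a" using \<epsilon> by auto
      let ?x = "exp (- a / 2 ^ n)"
      have x: "0 \<le> ?x" "?x < 1" using a by auto
      have inva: "1 / a \<le> 1 / \<epsilon>" "0 \<le> 1 / a" using a \<epsilon> by (auto simp: frac_le)
      have n1: "1 / 2 ^ n \<le> (1::real)" by simp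
      have Gin: "G n a \<in> {0..1/\<epsilon>+1}" "1 / a \<in> {0..1/\<epsilon>+1}"
        unfolding atLeastAtMost_iff using Gb[OF a(1), of n] inva n1 by linarith+
      have "dist (G n a) (1 / a) < \<delta>"
        using Gb(1)[OF a(1), of n] elim(2) by (simp add: dist_real_def)
      then have "dist ((G n a) powr p) ((1 / a) powr p) < e / (2 * L)"
        by (intro \<delta>(2) Gin)
      then have "L * \<bar>(G n a) powr p - (1 / a) powr p\<bar> < L * (e / (2 * L))"
        unfolding dist_real_def by (rule mult_strict_left_mono[OF _ L])
      then have t1: "\<bar>L * ((G n a) powr p - (1 / a) powr p)\<bar> < e / 2"
        using L by (simp add: abs_mult)
      have t2: "(G n a) powr p * \<bar>\<rho> ?x - L\<bar> \<le> e / 4"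
      proof (cases "a \<le> M")
        case True
        then have "exp (- (M * (1 / 2 ^ n))) \<le> ?x" by (simp add: divide_right_mono)
        then have "b < ?x" using elim(1) by linarith
        then have "\<bar>\<rho> ?x - L\<bar> < e / (4 * R)"
          using b(2)[OF _ x(2)] unfolding dist_real_def by blast
        moreover have "(G n a) powr p \<le> R"
          unfolding R_def using Gin p by (intro powr_mono2) auto
        ultimately have "(G n a) powr p * \<bar>\<rho> ?x - L\<bar> \<le> R * (e / (4 * R))"
          using R by (intro mult_mono) auto
        then show ?thesis using R by simp
      next
        case False
        then have "2 / d \<le> a" by (simp add: M_def)
        then have "1 / a \<le> d / 2" using d a by (simp add: field_simps)
        then have "G n a \<le> d" using Gb(1)[OF a(1), of n] elim(2) by auto
        then have "(G n a) powr p \<le> d powr p"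
          using Gb(2)[OF a(1)] p by (intro powr_mono2) auto
        moreover have "\<bar>\<rho> ?x - L\<bar> \<le> B + L" using B(1)[OF x] L by linarith
        ultimately have "(G n a) powr p * \<bar>\<rho> ?x - L\<bar> \<le> d powr p * (B + L)"
          by (intro mult_mono) auto
        then show ?thesis using d by simp
      qed
      have ap: "a powr (s - 1) = (1 / a) powr p"
        using a by (simp add: p_def powr_divide powr_minus_divide[symmetric])
      have "polylog_mean s n a - L * a powr (s - 1)
          = (G n a) powr p * (\<rho> ?x - L) + L * ((G n a) powr p - (1 / a) powr p)"
        unfolding mean[OF a(1)] ap by (simp add: algebra_simps)
      then have "\<bar>polylog_mean s n a - L * a powr (s - 1)\<bar>
          \<le> \<bar>(G n a) powr p * (\<rho> ?x - L)\<bar> + \<bar>L * ((G n a) powr p - (1 / a) powr p)\<bar>"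
        by (simp only: abs_triangle_ineq)
      also have "\<bar>(G n a) powr p * (\<rho> ?x - L)\<bar> = (G n a) powr p * \<bar>\<rho> ?x - L\<bar>"
        by (simp add: abs_mult)
      finally show "dist (polylog_mean s n a) (Gamma (1 - s) * a powr (s - 1)) < e"
        using t1 t2 e by (simp add: dist_real_def L_def p_def)
    qed
  qed
qed

context spectral_calculus
begin

subsection \<open>The unitary group\<close>

definition evol :: "real \<Rightarrow> 'a \<Rightarrow>\<^sub>L 'a" where
  "evol t = Psi (\<lambda>a. exp (- \<i> * complex_of_real t * complex_of_real a))"

lemma bdd_evol: "bdd (\<lambda>a. exp (- \<i> * complex_of_real t * complex_of_real a))"
  by (rule bddI[of _ 1]) (auto intro!: borel_measurable_continuous_onI continuous_intros)

lemma evol_adjoint: "is_adjoint (evol t) (evol (- t))"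
  using Psi_adjoint[OF bdd_evol[of t]] by (simp add: evol_def exp_cnj)

text \<open>Both half planes are treated at once, with \<open>\<sigma> = 1\<close> for the upper and \<open>\<sigma> = - 1\<close> for the
  lower one; the resolvent at \<open>\<i> \<sigma> m\<close> is \<open>\<i> \<sigma> / w\<close> with \<open>w = m + \<i> \<sigma> a\<close>.\<close>

lemma evolution_formulas:
  fixes m \<sigma> :: real
  assumes m: "m > 0" and \<sigma>: "\<sigma> * \<sigma> = 1"
  defines "R \<equiv> Psi (\<lambda>a. 1 / (complex_of_real a - \<i> * complex_of_real (\<sigma> * m)))"
    and "B \<equiv> blinfun_inv (id_blinfun - exp (- m) *\<^sub>R evol \<sigma>)"
    and "N \<equiv> \<lambda>k. blinfun_inv (id_blinfun + exp (- m / 2 ^ k) *\<^sub>R evol (\<sigma> * (1 / 2 ^ k)))"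
    and "S \<equiv> \<lambda>k j. ((1 / 2 ^ k) * (- 1) ^ j * exp (- real j * m / 2 ^ k)) *\<^sub>R evol (\<sigma> * (real j / 2 ^ k))"
  shows "bij (blinfun_apply (id_blinfun - exp (- m) *\<^sub>R evol \<sigma>))"
    "bij (blinfun_apply (id_blinfun + exp (- m / 2 ^ k) *\<^sub>R evol (\<sigma> * (1 / 2 ^ k))))"
    "\<exists>y. (\<lambda>k. (1 / 2 ^ Suc k) *\<^sub>R N (Suc k) x) sums y \<and>
      R x = (\<i> * complex_of_real \<sigma>) *\<^sub>C B x - (\<i> * complex_of_real \<sigma>) *\<^sub>C y \<and>
      (\<lambda>n. \<Sum>k=1..n. \<Sum>j. S k j x) \<longlonglongrightarrow> y"
    "(\<lambda>j. exp (- real j * m) *\<^sub>R evol (\<sigma> * real j) x) sums B x"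
    "summable (\<lambda>j. S k j x)"
proof -
  define w where "w a = complex_of_real m + \<i> * complex_of_real (\<sigma> * a)" for a
  define q where "q k a = exp (- w a / 2 ^ k)" for k :: nat and a
  define r where "r k = exp (- m / 2 ^ k)" for k :: nat
  have w: "Re (w a) = m" for a by (simp add: w_def)
  have wb: "w \<in> borel_measurable borel"
    unfolding w_def by (intro borel_measurable_continuous_onI continuous_intros)
  have qb [measurable]: "q k \<in> borel_measurable borel" for k
    unfolding q_def w_def by (intro borel_measurable_continuous_onI continuous_intros) auto
  have qr: "cmod (q k a) \<le> r k" "cmod (- q k a) \<le> r k" for k a
    by (simp_all add: q_def r_def w Re_divide_of_nat)
  have qr': "\<forall>a\<in>K. cmod (q k a) \<le> r k" "\<forall>a\<in>K. cmod (- q k a) \<le> r k" for k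
    using qr by auto
  have r: "0 \<le> r k" "r k < 1" for k using m by (simp_all add: r_def)
  have bq: "bdd (q k)" for k using qb qr(1) by (rule bddI)
  have power: "Psi (\<lambda>a. q k a ^ j) = exp (- real j * m / 2 ^ k) *\<^sub>R evol (\<sigma> * (real j / 2 ^ k))" for k j
  proof -
    have "q k a ^ j = complex_of_real (exp (- real j * m / 2 ^ k))
        * exp (- \<i> * complex_of_real (\<sigma> * (real j / 2 ^ k)) * complex_of_real a)" for a
      unfolding q_def exp_of_nat_mult[symmetric] exp_of_real[symmetric] exp_add[symmetric]
      by (rule arg_cong[where f = exp]) (simp add: w_def field_simps)
    then show ?thesis by (simp only: Psi_scaleR[OF bdd_evol] evol_def)
  qed
  have q1: "Psi (q k) = exp (- m / 2 ^ k) *\<^sub>R evol (\<sigma> * (1 / 2 ^ k))" for k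
    using power[of k 1] by simp
  have minus: "Psi (\<lambda>a. - q k a) = - Psi (q k)" for k
    using Psi_scaleR[OF bq, of "-1" k] by simp
  { fix k note Psi_geometric[OF qb[of k] qr'(1) r] }
  note geo = this
  have mqb: "(\<lambda>a. - q k a) \<in> borel_measurable borel" for k by measurable
  { fix k note Psi_geometric[OF mqb[of k] qr'(2) r, unfolded minus diff_minus_eq_add, unfolded q1] }
  note alt = this
  have q0: "Psi (q 0) = exp (- m) *\<^sub>R evol \<sigma>" using q1[of 0] by simp
  show "bij (blinfun_apply (id_blinfun - exp (- m) *\<^sub>R evol \<sigma>))"
    using geo(4)[of 0] unfolding q0 .
  have B: "B = Psi (\<lambda>a. 1 / (1 - q 0 a))"
    using geo(5)[of 0] unfolding q0 B_def .
  show "bij (blinfun_apply (id_blinfun + exp (- m / 2 ^ k) *\<^sub>R evol (\<sigma> * (1 / 2 ^ k))))"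
    using alt(4) .
  have N: "N k = Psi (\<lambda>a. 1 / (1 + q k a))" for k
    using alt(5) unfolding N_def .
  have bN: "bdd (\<lambda>a. 1 / (1 + q k a))" for k using alt(1) .
  have "(\<lambda>j. blinfun_apply (Psi (\<lambda>a. q 0 a ^ j)) x) sums blinfun_apply B x"
    unfolding B by (rule bounded_linear.sums[OF blinfun.bounded_linear_left geo(2)])
  then show "(\<lambda>j. exp (- real j * m) *\<^sub>R evol (\<sigma> * real j) x) sums B x"
    unfolding power by (simp add: blinfun.scaleR_left)
  have S: "(\<lambda>j. S k j x) sums ((1 / 2 ^ k) *\<^sub>R N k x)" for k
  proof -
    have "(\<lambda>j. (1 / 2 ^ k) *\<^sub>R Psi (\<lambda>a. (- q k a) ^ j)) sums ((1 / 2 ^ k) *\<^sub>R N k)"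
      unfolding N by (rule bounded_linear.sums[OF bounded_linear_scaleR_right alt(2)])
    moreover have "(1 / 2 ^ k) *\<^sub>R Psi (\<lambda>a. (- q k a) ^ j) = S k j" for j
    proof -
      have "(- q k a) ^ j = complex_of_real ((- 1) ^ j) * q k a ^ j" for a
        by (subst power_minus) simp
      then show ?thesis
        by (simp only: Psi_scaleR[OF bdd_power[OF bq]] power S_def scaleR_scaleR mult.assoc)
    qed
    ultimately have "(\<lambda>j. S k j) sums ((1 / 2 ^ k) *\<^sub>R N k)" by simp
    from bounded_linear.sums[OF blinfun.bounded_linear_left this, of x] show ?thesis
      by (simp add: blinfun.scaleR_left)
  qed
  then show "summable (\<lambda>j. S k j x)" by (rule sums_summable)
  have binv: "bdd (\<lambda>a. 1 / w a)"
  proof (rule bddI)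
    show "(\<lambda>a. 1 / w a) \<in> borel_measurable borel" using wb by measurable
    show "cmod (1 / w a) \<le> 1 / m" for a
      using complex_Re_le_cmod[of "w a"] m w[of a] by (simp add: norm_divide frac_le)
  qed
  have mean: "(\<Sum>k<n. (1 / 2 ^ Suc k) *\<^sub>R N (Suc k)) = B - Psi (\<lambda>a. dyadic_mean n (w a))" for n
  proof -
    have b: "bdd (\<lambda>a. complex_of_real (1 / 2 ^ Suc k) * (1 / (1 + q (Suc k) a)))" for k
      by (intro bdd_mult bdd_const bN)
    have "(\<Sum>k<n. (1 / 2 ^ Suc k) *\<^sub>R N (Suc k)) = Psi (\<lambda>a. \<Sum>k<n. complex_of_real (1 / 2 ^ Suc k) * (1 / (1 + q (Suc k) a)))"
      unfolding Psi_sum[OF b] Psi_scaleR[OF bN] N ..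
    also have "(\<lambda>a. \<Sum>k<n. complex_of_real (1 / 2 ^ Suc k) * (1 / (1 + q (Suc k) a))) = (\<lambda>a. 1 / (1 - q 0 a) - dyadic_mean n (w a))"
    proof
      fix a
      show "(\<Sum>k<n. complex_of_real (1 / 2 ^ Suc k) * (1 / (1 + q (Suc k) a))) = 1 / (1 - q 0 a) - dyadic_mean n (w a)"
      proof -
        have "0 < Re (w a)" by (simp add: w m)
        from dyadic_mean_telescope[OF this, of n, symmetric] show ?thesis by (simp add: q_def)
      qed
    qed
    also have "Psi \<dots> = B - Psi (\<lambda>a. dyadic_mean n (w a))"
      unfolding B
    proof (rule Psi_diff[OF geo(1)])
      show "bdd (\<lambda>a. dyadic_mean n (w a))"
      proof (rule bddI)
        show "(\<lambda>a. dyadic_mean n (w a)) \<in> borel_measurable borel"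
          unfolding dyadic_mean_def q_def[symmetric] by measurable
        show "cmod (dyadic_mean n (w a)) \<le> 1 / m + 1 / 2 ^ n" for a
          using dyadic_mean_bound[of "w a" n] m by (simp add: w)
      qed
    qed
    finally show ?thesis .
  qed
  have "(\<lambda>n. Psi (\<lambda>a. dyadic_mean n (w a)) x) \<longlonglongrightarrow> Psi (\<lambda>a. 1 / w a) x"
  proof (rule Psi_strong_limit[OF _ binv])
    have b: "cmod (dyadic_mean n (w a)) \<le> 1 / m + 1" for n a
    proof -
      have "1 / 2 ^ n \<le> (1::real)" by simp
      then show ?thesis using dyadic_mean_bound[of "w a" n] m unfolding w by linarith
    qed
    have "(\<lambda>a. dyadic_mean n (w a)) \<in> borel_measurable borel" for n
      unfolding dyadic_mean_def q_def[symmetric] by measurable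
    then show "bdd (\<lambda>a. dyadic_mean n (w a))" for n
      using b by (rule bddI)
    have "cmod (1 / w a) \<le> 1 / m" for a
      using complex_Re_le_cmod[of "w a"] m w[of a] by (simp add: norm_divide frac_le)
    then show "cmod (dyadic_mean n (w a) - 1 / w a) \<le> 1 / m + 1 + 1 / m" for n a
      using b[of n a] norm_triangle_ineq4[of "dyadic_mean n (w a)" "1 / w a"] by (meson add_mono order_trans)
    show "(\<lambda>n. dyadic_mean n (w a)) \<longlonglongrightarrow> 1 / w a" for a
      by (rule dyadic_mean_tendsto) (simp add: w m)
    show "0 \<le> 1 / m + 1 + 1 / m" using m by simp
  qed
  then have "(\<lambda>n. blinfun_apply B x - Psi (\<lambda>a. dyadic_mean n (w a)) x) \<longlonglongrightarrow> B x - Psi (\<lambda>a. 1 / w a) x"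
    by (rule tendsto_diff[OF tendsto_const])
  also have "(\<lambda>n. blinfun_apply B x - Psi (\<lambda>a. dyadic_mean n (w a)) x) = (\<lambda>n. \<Sum>k<n. (1 / 2 ^ Suc k) *\<^sub>R N (Suc k) x)"
    by (simp only: blinfun.diff_left[symmetric] mean[symmetric] blinfun.sum_left blinfun.scaleR_left)
  \<comment> \<open>This sum is the \<open>y\<close> of the conclusion; multiplied by
    \<open>\<i> * \<sigma>\<close>, its second term is the resolvent.\<close>
  finally have sums: "(\<lambda>k. (1 / 2 ^ Suc k) *\<^sub>R N (Suc k) x) sums (B x - Psi (\<lambda>a. 1 / w a) x)"
    by (simp only: sums_def)
  moreover have "R x = (\<i> * complex_of_real \<sigma>) *\<^sub>C Psi (\<lambda>a. 1 / w a) x"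
  proof -
    have "1 / (complex_of_real a - \<i> * complex_of_real (\<sigma> * m)) = (\<i> * complex_of_real \<sigma>) * (1 / w a)" for a
    proof -
      have "complex_of_real \<sigma> * complex_of_real \<sigma> = 1"
        using \<sigma> by (metis of_real_1 of_real_mult)
      then have "(\<i> * complex_of_real \<sigma>) * (complex_of_real a - \<i> * complex_of_real (\<sigma> * m)) = w a"
        by (simp add: w_def algebra_simps)
      moreover have "w a \<noteq> 0" using w[of a] m by auto
      moreover have "1 / v = c * (1 / (c * v))" if "c * v \<noteq> 0" for c v :: complex
        using that by simp
      ultimately show ?thesis by metis
    qed
    then have "bdd (\<lambda>a. 1 / (complex_of_real a - \<i> * complex_of_real (\<sigma> * m)))"
      using bdd_mult[OF bdd_const binv] by simp
    moreover have "has_int (\<lambda>a. 1 / (complex_of_real a - \<i> * complex_of_real (\<sigma> * m))) x ((\<i> * complex_of_real \<sigma>) *\<^sub>C Psi (\<lambda>a. 1 / w a) x)"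
      using has_int_cmult[OF has_Psi[OF binv], of "\<i> * complex_of_real \<sigma>" x]
        \<open>\<And>a. 1 / (complex_of_real a - \<i> * complex_of_real (\<sigma> * m)) = (\<i> * complex_of_real \<sigma>) * (1 / w a)\<close> by simp
    ultimately show ?thesis
      unfolding R_def using has_int_unique[OF has_Psi] by blast
  qed
  moreover have "(\<lambda>n. \<Sum>k=1..n. \<Sum>j. S k j x) \<longlonglongrightarrow> B x - Psi (\<lambda>a. 1 / w a) x"
  proof -
    have "(\<Sum>k=1..n. \<Sum>j. S k j x) = (\<Sum>k<n. (1 / 2 ^ Suc k) *\<^sub>R N (Suc k) x)" for n
      unfolding sums_unique[OF S, symmetric]
      using sum.shift_bounds_cl_Suc_ivl[of "\<lambda>k. (1 / 2 ^ k) *\<^sub>R N k x" 0 n]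
      by (simp add: sum.atLeast1_atMost_eq lessThan_Suc_atMost)
    then show ?thesis using sums by (simp only: sums_def)
  qed
  ultimately show "\<exists>y. (\<lambda>k. (1 / 2 ^ Suc k) *\<^sub>R N (Suc k) x) sums y \<and>
      R x = (\<i> * complex_of_real \<sigma>) *\<^sub>C B x - (\<i> * complex_of_real \<sigma>) *\<^sub>C y \<and>
      (\<lambda>n. \<Sum>k=1..n. \<Sum>j. S k j x) \<longlonglongrightarrow> y"
    by (intro exI[of _ "B x - Psi (\<lambda>a. 1 / w a) x"]) (simp add: scaleC.diff_right)
qed

end

context spectral_calculus
begin

subsection \<open>The semigroup\<close>

definition heat :: "real \<Rightarrow> 'a \<Rightarrow>\<^sub>L 'a" where
  "heat t = Psi (\<lambda>a. complex_of_real (exp (- t * a)))"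

text \<open>The series begin at exponent 1, so every inverse enters with its constant term
  \<open>id_blinfun\<close> removed. The weights \<open>1 / 2^k\<close> add up to 1, and therefore
  the removed terms cancel between the single series and the double sum.\<close>

lemma semigroup_formulas:
  fixes \<epsilon> :: real
  assumes \<epsilon>: "\<epsilon> > 0" and K: "K = {\<epsilon>..}"
  defines "V \<equiv> Psi (\<lambda>a. 1 / complex_of_real a)"
    and "B \<equiv> blinfun_inv (id_blinfun - heat 1)"
    and "N \<equiv> \<lambda>k. blinfun_inv (id_blinfun + heat (1 / 2 ^ k))"
    and "S \<equiv> \<lambda>k j. ((1 / 2 ^ k) * (- 1) ^ Suc j) *\<^sub>R heat (real (Suc j) / 2 ^ k)"
  shows "bij (blinfun_apply (id_blinfun - heat 1))"
    "bij (blinfun_apply (id_blinfun + heat (1 / 2 ^ k)))"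
    "(\<lambda>k. (1 / 2 ^ Suc k) *\<^sub>R N (Suc k)) sums (B - V)"
    "(\<lambda>j. heat (real (Suc j))) sums (B - id_blinfun)"
    "summable (S k)"
    "(\<lambda>n. \<Sum>k=1..n. \<Sum>j. S k j) \<longlonglongrightarrow> B - V - id_blinfun"
    "t > 0 \<Longrightarrow> norm (heat t) < 1"
proof -
  define q where "q t a = complex_of_real (exp (- t * a))" for t a :: real
  have qb [measurable]: "q t \<in> borel_measurable borel" for t
    unfolding q_def by (intro borel_measurable_continuous_onI continuous_intros)
  define r where "r t = exp (- t * \<epsilon>)" for t :: real
  have qr: "cmod (q t a) \<le> r t" "cmod (- q t a) \<le> r t" if "t > 0" "a \<in> K" for t a
    using that by (simp_all add: q_def r_def K)
  have qr': "\<forall>a\<in>K. cmod (q t a) \<le> r t" "\<forall>a\<in>K. cmod (- q t a) \<le> r t" if "t > 0" for t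
    using qr that by auto
  have r: "0 \<le> r t" "r t < 1" if "t > 0" for t using \<epsilon> that by (simp_all add: r_def)
  have bq: "bdd (q t)" if "t > 0" for t using qb qr(1)[OF that] by (rule bddI)
  have heat: "heat t = Psi (q t)" for t by (simp add: heat_def q_def[abs_def])
  show "norm (heat t) < 1" if "t > 0" for t
    using Psi_norm[OF qb qr(1)[OF that] r(1)[OF that]] r(2)[OF that] by (simp add: heat)
  have power: "Psi (\<lambda>a. q t a ^ j) = heat (real j * t)" for t j
    by (simp add: heat q_def[abs_def] mult.assoc flip: of_real_power exp_of_nat_mult)
  have minus: "Psi (\<lambda>a. - q t a) = - heat t" if "t > 0" for t
    using Psi_scaleR[OF bq[OF that], of "-1"] by (simp add: heat)
  have mqb: "(\<lambda>a. - q t a) \<in> borel_measurable borel" for t by measurable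
  { fix t :: real assume t: "t > 0"
    note Psi_geometric[OF qb qr'(1)[OF t] r[OF t], folded heat] }
  note geo = this
  { fix t :: real assume t: "t > 0"
    note Psi_geometric[OF mqb qr'(2)[OF t] r[OF t], unfolded minus[OF t] diff_minus_eq_add] }
  note alt = this
  have t1: "(0::real) < 1" and tk: "(0::real) < 1 / 2 ^ k" for k :: nat by simp_all
  show "bij (blinfun_apply (id_blinfun - heat 1))" by (rule geo(4)[OF t1])
  show "bij (blinfun_apply (id_blinfun + heat (1 / 2 ^ k)))" by (rule alt(4)[OF tk])
  have B: "B = Psi (\<lambda>a. 1 / (1 - q 1 a))"
    unfolding B_def by (rule geo(5)[OF t1])
  have N: "N k = Psi (\<lambda>a. 1 / (1 + q (1 / 2 ^ k) a))" for k
    unfolding N_def by (rule alt(5)[OF tk])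
  note bN = alt(1)[OF tk]
  \<comment> \<open>Removing the constant term of the geometric series:
    \<open>p / (1 - p) = 1 / (1 - p) - 1\<close>.\<close>
  have shift: "Psi (\<lambda>a. p a / (1 - p a)) = Psi (\<lambda>a. 1 / (1 - p a)) - id_blinfun"
    if p: "bdd (\<lambda>a. 1 / (1 - p a))" "p \<in> borel_measurable borel" "\<forall>a\<in>K. cmod (p a) \<le> r t" "t > 0" for p t
  proof -
    note [measurable] = p(2)
    have "Psi (\<lambda>a. 1 / (1 - p a) - 1) = Psi (\<lambda>a. p a / (1 - p a))"
    proof (rule Psi_cong[OF bdd_diff[OF p(1) bdd_const]])
      fix a assume "a \<in> K"
      then have "p a \<noteq> 1" using bspec[OF p(3), of a] r(2)[OF p(4)] by auto
      then show "1 / (1 - p a) - 1 = p a / (1 - p a)" by (simp add: field_simps)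
    qed measurable
    then show ?thesis by (simp add: Psi_diff p(1) bdd_const Psi_1)
  qed
  have "(\<lambda>j. Psi (\<lambda>a. q 1 a ^ Suc j)) sums (B - id_blinfun)"
    using geo(3)[OF t1] unfolding shift[OF geo(1)[OF t1] qb qr'(1)[OF t1] t1] B .
  then show "(\<lambda>j. heat (real (Suc j))) sums (B - id_blinfun)"
    unfolding power by simp
  have S: "S k sums ((1 / 2 ^ k) *\<^sub>R (N k - id_blinfun))" for k
  proof -
    have "(\<lambda>j. Psi (\<lambda>a. (- q (1 / 2 ^ k) a) ^ Suc j)) sums (Psi (\<lambda>a. 1 / (1 - - q (1 / 2 ^ k) a)) - id_blinfun)"
      using alt(3)[OF tk, of k] shift[OF _ mqb qr'(2)[OF tk] tk, of k] bN[of k] by simp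
    then have "(\<lambda>j. (1 / 2 ^ k) *\<^sub>R Psi (\<lambda>a. (- q (1 / 2 ^ k) a) ^ Suc j)) sums ((1 / 2 ^ k) *\<^sub>R (N k - id_blinfun))"
      unfolding N diff_minus_eq_add by (rule bounded_linear.sums[OF bounded_linear_scaleR_right])
    moreover have "(1 / 2 ^ k) *\<^sub>R Psi (\<lambda>a. (- q (1 / 2 ^ k) a) ^ Suc j) = S k j" for j
    proof -
      have "(- q (1 / 2 ^ k) a) ^ Suc j = complex_of_real ((- 1) ^ Suc j) * q (1 / 2 ^ k) a ^ Suc j" for a
        by (subst power_minus) simp
      moreover have "heat (real (Suc j) * (1 / 2 ^ k)) = heat (real (Suc j) / 2 ^ k)" by simp
      ultimately show ?thesis
        by (simp only: Psi_scaleR[OF bdd_power[OF bq[OF tk]]] power S_def scaleR_scaleR)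
    qed
    ultimately show ?thesis by simp
  qed
  then show "summable (S k)" by (rule sums_summable)
  have Kpos: "a > 0" if "a \<in> K" for a using that \<epsilon> K by auto
  have bV: "bdd (\<lambda>a. 1 / complex_of_real a)"
  proof (rule bddI)
    show "cmod (1 / complex_of_real a) \<le> 1 / \<epsilon>" if "a \<in> K" for a
      using that \<epsilon> by (simp add: K norm_divide frac_le)
  qed measurable
  define M where "M n a = 1 / (1 - q 1 a) - (\<Sum>k<n. complex_of_real (1 / 2 ^ Suc k) * (1 / (1 + q (1 / 2 ^ Suc k) a)))" for n a
  have b: "bdd (\<lambda>a. complex_of_real (1 / 2 ^ Suc k) * (1 / (1 + q (1 / 2 ^ Suc k) a)))" for k
    using bN[of "Suc k"] by (intro bdd_mult bdd_const) simp
  have bM: "bdd (M n)" for n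
    unfolding M_def by (intro bdd_diff geo(1)[OF t1] bdd_sum b)
  have PM: "Psi (M n) = B - (\<Sum>k<n. (1 / 2 ^ Suc k) *\<^sub>R N (Suc k))" for n
    unfolding M_def B Psi_diff[OF geo(1)[OF t1] bdd_sum[OF b]] Psi_sum[OF b] Psi_scaleR[OF bN] N ..
  have "uniform_limit K M (\<lambda>a. 1 / complex_of_real a) sequentially"
  proof (rule uniform_limitI)
    fix e :: real assume "0 < e"
    then have "\<forall>\<^sub>F n in sequentially. 1 / 2 ^ n < e"
      by (rule order_tendstoD(2)[OF inverse_two_power_tendsto])
    then show "\<forall>\<^sub>F n in sequentially. \<forall>a\<in>K. dist (M n a) (1 / complex_of_real a) < e"
    proof eventually_elim
      case (elim n)
      show ?case
      proof
        fix a assume a: "a \<in> K"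
        have "M n a = dyadic_mean n (complex_of_real a)"
          using dyadic_mean_telescope[of "complex_of_real a" n, symmetric] Kpos[OF a]
          by (simp add: M_def q_def exp_of_real[symmetric])
        then have "dist (M n a) (1 / complex_of_real a)
            = cmod (complex_of_real ((1 / 2 ^ n) / (1 - exp (- a / 2 ^ n)) - 1 / a))"
          unfolding dyadic_mean_real dist_norm by (simp only: of_real_diff of_real_divide of_real_1)
        also have "\<dots> \<le> 1 / 2 ^ n"
          unfolding norm_of_real by (rule dyadic_mean_real_bound[OF Kpos[OF a]])
        finally show "dist (M n a) (1 / complex_of_real a) < e" using elim by simp
      qed
    qed
  qed
  from Psi_limit(2)[OF bM bdd_borel[OF bV] this]
  have "(\<lambda>n. B - Psi (M n)) \<longlonglongrightarrow> B - V"
    unfolding V_def by (intro tendsto_intros)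
  then show sums: "(\<lambda>k. (1 / 2 ^ Suc k) *\<^sub>R N (Suc k)) sums (B - V)"
    unfolding PM sums_def by simp
  have "(\<Sum>k=1..n. \<Sum>j. S k j) = (\<Sum>k<n. (1 / 2 ^ Suc k) *\<^sub>R N (Suc k)) - (\<Sum>k<n. 1 / 2 ^ Suc k) *\<^sub>R id_blinfun" for n
    unfolding sums_unique[OF S, symmetric]
    by (simp add: sum.atLeast1_atMost_eq scaleR_diff_right sum_subtractf scaleR_sum_left)
  moreover have "(\<lambda>n. (\<Sum>k<n. (1 / 2 ^ Suc k) *\<^sub>R N (Suc k)) - (\<Sum>k<n. 1 / 2 ^ Suc k) *\<^sub>R id_blinfun)
      \<longlonglongrightarrow> B - V - (1::real) *\<^sub>R id_blinfun"
  proof -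
    have "(\<lambda>k. 1 / 2 ^ Suc k :: real) sums 1"
      using power_half_series by (simp add: power_one_over)
    then show ?thesis using sums unfolding sums_def by (intro tendsto_intros)
  qed
  ultimately show "(\<lambda>n. \<Sum>k=1..n. \<Sum>j. S k j) \<longlonglongrightarrow> B - V - id_blinfun"
    by simp
qed

text \<open>The scalar series at radius \<open>r < 1\<close> majorises the functions on
  \<open>K\<close>, so the operator series converges in norm and may be computed inside the
  calculus.\<close>

lemma op_polylog_Psi:
  assumes s: "s < 1" and q [measurable]: "q \<in> borel_measurable borel"
    and r: "\<And>a. a \<in> K \<Longrightarrow> \<bar>q a\<bar> \<le> r" "0 \<le> r" "r < 1"
  shows "bdd (\<lambda>a. complex_of_real (real_polylog s (q a)))"
    "op_polylog s (Psi (\<lambda>a. complex_of_real (q a))) = Psi (\<lambda>a. complex_of_real (real_polylog s (q a)))"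
proof -
  let ?f = "\<lambda>k a. complex_of_real (real k powr (- s)) * complex_of_real (q a) ^ k"
  have bq: "bdd (\<lambda>a. complex_of_real (q a))"
    by (rule bddI[of _ r]) (use r in auto)
  have m: "(\<lambda>a. complex_of_real (real_polylog s (q a))) \<in> borel_measurable borel"
    unfolding real_polylog_def by measurable
  have bf: "bdd (?f k)" for k by (intro bdd_mult bdd_const bdd_power bq)
  have bound: "cmod (?f k a) \<le> \<bar>real k powr (- s) * r ^ k\<bar>" if "a \<in> K" for k a
    using r(1)[OF that] r(2) by (auto simp: norm_mult norm_power abs_mult intro!: mult_left_mono power_mono)
  have summ: "summable (\<lambda>k. \<bar>real k powr (- s) * r ^ k\<bar>)"
    using r by (intro polylog_facts(1) s) auto
  have fs: "(\<lambda>k. ?f k a) sums complex_of_real (real_polylog s (q a))" if "a \<in> K" for a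
    using sums_of_real[OF polylog_sums[OF s, of "q a"], where 'a = complex] r(1)[OF that] r(3) by simp
  note 1 = Psi_series(1)[OF bf m bound summ fs]
  note sums = Psi_series(2)[OF bf m bound summ fs]
  show "bdd (\<lambda>a. complex_of_real (real_polylog s (q a)))" by (rule 1)
  have f: "Psi (?f k) = real k powr (- s) *\<^sub>R blinfun_pow (Psi (\<lambda>a. complex_of_real (q a))) k" for k
    by (simp only: Psi_scaleR[OF bdd_power[OF bq]] Psi_power[OF bq])
  \<comment> \<open>The operator series starts at exponent 1, the scalar one at 0; the latter has a
    zero first term.\<close>
  have "(\<lambda>k. real (Suc k) powr (- s) *\<^sub>R blinfun_pow (Psi (\<lambda>a. complex_of_real (q a))) (Suc k))
      sums Psi (\<lambda>a. complex_of_real (real_polylog s (q a)))"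
    using sums unfolding f by (subst sums_Suc_iff) simp
  then show "op_polylog s (Psi (\<lambda>a. complex_of_real (q a))) = Psi (\<lambda>a. complex_of_real (real_polylog s (q a)))"
    unfolding op_polylog_def by (rule sums_unique[symmetric])
qed

text \<open>Kept in terms of \<open>Gamma (1 - s)\<close>, the form is valid for every
  \<open>s < 1\<close>, integers included. Reflection for nonintegral \<open>s\<close> is applied
  only in the final statement.\<close>

lemma polylog_formula:
  fixes \<epsilon> s :: real
  assumes \<epsilon>: "\<epsilon> > 0" and K: "K = {\<epsilon>..}" and s: "s < 1"
  shows "(\<lambda>k. 2 powr (- real (Suc k) * (1 - s)) *\<^sub>R op_polylog s (- heat (1 / 2 ^ Suc k)))
    sums (op_polylog s (heat 1) - Gamma (1 - s) *\<^sub>R Psi (\<lambda>a. complex_of_real (a powr (s - 1))))"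
proof -
  have Kpos: "a > 0" if "a \<in> K" for a using that \<epsilon> K by auto
  have [measurable]: "(\<lambda>a. exp (- t * a)) \<in> borel_measurable borel" for t :: real
    by (intro borel_measurable_continuous_onI continuous_intros)
  have bound: "\<bar>exp (- t * a)\<bar> \<le> exp (- t * \<epsilon>)" "exp (- t * \<epsilon>) < 1" if "t > 0" "a \<in> K" for t a
    using that \<epsilon> K by auto
  have lt1: "exp (- t * \<epsilon>) < 1" if "t > 0" for t using that \<epsilon> by simp
  have pos: "bdd (\<lambda>a. complex_of_real (real_polylog s (exp (- t * a)))) \<and>
      op_polylog s (heat t) = Psi (\<lambda>a. complex_of_real (real_polylog s (exp (- t * a))))" if "t > 0" for t
    unfolding heat_def using op_polylog_Psi[OF s _ bound(1)[OF that] _ lt1[OF that]] by simp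
  have neg: "bdd (\<lambda>a. complex_of_real (real_polylog s (- exp (- t * a)))) \<and>
      op_polylog s (- heat t) = Psi (\<lambda>a. complex_of_real (real_polylog s (- exp (- t * a))))" if "t > 0" for t
  proof -
    have "bdd (\<lambda>a. complex_of_real (exp (- t * a)))"
      by (rule bddI[of _ "exp (- t * \<epsilon>)"]) (use bound(1)[OF that] in auto)
    from Psi_scaleR[OF this, of "-1"]
    have "- heat t = Psi (\<lambda>a. complex_of_real (- exp (- t * a)))" by (simp add: heat_def)
    moreover have "\<bar>- exp (- t * a)\<bar> \<le> exp (- t * \<epsilon>)" if "a \<in> K" for a
      using bound(1)[OF \<open>t > 0\<close> that] by simp
    ultimately show ?thesis
      using op_polylog_Psi[OF s, of "\<lambda>a. - exp (- t * a)" "exp (- t * \<epsilon>)"] lt1[OF that] by simp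
  qed
  define M where "M n a = complex_of_real (real_polylog s (exp (- 1 * a)))
    - (\<Sum>k<n. complex_of_real (2 powr (- real (Suc k) * (1 - s))) * complex_of_real (real_polylog s (- exp (- (1 / 2 ^ Suc k) * a))))" for n a
  have b: "bdd (\<lambda>a. complex_of_real (real_polylog s (- exp (- (1 / 2 ^ Suc k) * a))))"
    and c: "op_polylog s (- heat (1 / 2 ^ Suc k)) = Psi (\<lambda>a. complex_of_real (real_polylog s (- exp (- (1 / 2 ^ Suc k) * a))))" for k :: nat
    using neg[of "1 / 2 ^ Suc k"] by auto
  have b1: "bdd (\<lambda>a. complex_of_real (real_polylog s (exp (- 1 * a))))"
    and c1: "op_polylog s (heat 1) = Psi (\<lambda>a. complex_of_real (real_polylog s (exp (- 1 * a))))"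
    using pos[of 1] by auto
  note bs = bdd_mult[OF bdd_const b]
  have bM: "bdd (M n)" for n
    unfolding M_def by (intro bdd_diff b1 bdd_sum bs)
  have PM: "Psi (M n) = op_polylog s (heat 1) - (\<Sum>k<n. 2 powr (- real (Suc k) * (1 - s)) *\<^sub>R op_polylog s (- heat (1 / 2 ^ Suc k)))" for n
    unfolding M_def c1 c Psi_diff[OF b1 bdd_sum[OF bs]] Psi_sum[OF bs] Psi_scaleR[OF b] ..
  have bG: "bdd (\<lambda>a. complex_of_real (a powr (s - 1)))"
  proof (rule bddI)
    show "cmod (complex_of_real (a powr (s - 1))) \<le> \<epsilon> powr (s - 1)" if "a \<in> K" for a
      using that \<epsilon> s K by (auto intro!: powr_mono2')
  qed measurable
  have M: "M n a = complex_of_real (polylog_mean s n a)" if "a \<in> K" for n a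
  proof -
    have "exp (- 1 * a) = exp (- a)" "exp (- (1 / 2 ^ Suc k) * a) = exp (- a / 2 ^ Suc k)" for k :: nat
      by simp_all
    then show ?thesis
      unfolding polylog_mean_telescope[OF s Kpos[OF that], symmetric] M_def
      by (simp only: of_real_diff of_real_sum of_real_mult)
  qed
  have "uniform_limit K M (\<lambda>a. complex_of_real (Gamma (1 - s)) * complex_of_real (a powr (s - 1))) sequentially"
  proof (rule uniform_limitI)
    fix e :: real assume "0 < e"
    from uniform_limitD[OF polylog_mean_uniform_limit[OF s \<epsilon>] this]
    show "\<forall>\<^sub>F n in sequentially. \<forall>a\<in>K. dist (M n a) (complex_of_real (Gamma (1 - s)) * complex_of_real (a powr (s - 1))) < e"
    proof eventually_elim
      case (elim n)
      then show ?case
        using M K by (auto simp: dist_of_real simp flip: of_real_mult)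
    qed
  qed
  from Psi_limit(2)[OF bM bdd_borel[OF bdd_mult[OF bdd_const bG]] this]
  have "(\<lambda>n. op_polylog s (heat 1) - Psi (M n)) \<longlonglongrightarrow>
      op_polylog s (heat 1) - Gamma (1 - s) *\<^sub>R Psi (\<lambda>a. complex_of_real (a powr (s - 1)))"
    unfolding Psi_scaleR[OF bG] by (intro tendsto_intros)
  then show ?thesis
    unfolding PM sums_def by simp
qed

end

subsection \<open>The spectral measure of a strictly positive operator\<close>

text \<open>Near 0 a spectral vector would violate the lower bound
  \<open>norm x \<le> M * norm (A x)\<close>; on a bounded negative interval it would have negative
  energy. Countably many such sets exhaust the complement of the half-line.\<close>

lemma (in projection_valued_measure) positive_spectral_gap:
  assumes graph: "\<And>x y. has_int complex_of_real x y \<longleftrightarrow> (x, y) \<in> op_graph D A"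
    and pos: "\<And>x. x \<in> D \<Longrightarrow> 0 \<le> Re (cinner x (A x))"
    and M: "M > 0" "\<And>x. x \<in> D \<Longrightarrow> norm x \<le> M * norm (A x)"
  shows "E (- {1 / (2 * M)..}) x = 0"
proof -
  \<comment> \<open>Half of \<open>1 / M\<close>, so that the two estimates on
    \<open>(- \<epsilon>, \<epsilon>)\<close> combine to
    \<open>norm y \<le> norm y / 2\<close>.\<close>
  define \<epsilon> where "\<epsilon> = 1 / (2 * M)"
  have \<epsilon>: "\<epsilon> > 0" using M by (simp add: \<epsilon>_def)
  have [measurable]: "(\<lambda>a. complex_of_real (sqrt (- a))) \<in> borel_measurable borel"
    by (intro borel_measurable_continuous_onI continuous_intros)
  \<comment> \<open>Over a bounded set the identity function is square integrable, and
    \<open>has_int_comp\<close> then places \<open>E S x\<close> in the domain of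
    \<open>A\<close>.\<close>
  have restricted: "E S x \<in> D \<and> has_int (\<lambda>a. complex_of_real a * indicator S a) x (A (E S x))"
    if S [measurable]: "S \<in> sets borel" and b: "\<And>a. a \<in> S \<Longrightarrow> \<bar>a\<bar> \<le> b" "0 \<le> b" for S b
  proof -
    have "sq x (\<lambda>a. complex_of_real a * indicator S a) \<le> ennreal ((b * norm (E S x))\<^sup>2)"
      by (rule sq_le_bound[OF S _ b(2)]) (auto simp: indicator_def b norm_mult)
    then have "sq x (\<lambda>a. complex_of_real a * indicator S a) < \<infinity>" using le_less_trans by fastforce
    then obtain z where z: "has_int (\<lambda>a. complex_of_real a * indicator S a) x z"
      using ex_has_int[of "\<lambda>a. complex_of_real a * indicator S a" x] by auto
    have "has_int complex_of_real (E S x) z"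
      by (rule has_int_comp[OF has_int_indicator[OF S] _ z]) measurable
    then show ?thesis using z by (auto simp: graph op_graph_def)
  qed
  have null1: "E {- \<epsilon><..<\<epsilon>} x = 0"
  proof -
    let ?S = "{- \<epsilon><..<\<epsilon>}"
    have "E ?S x \<in> D \<and> has_int (\<lambda>a. complex_of_real a * indicator ?S a) x (A (E ?S x))"
      by (rule restricted[where b = \<epsilon>]) (use \<epsilon> in auto)
    then have h: "E ?S x \<in> D" "has_int (\<lambda>a. complex_of_real a * indicator ?S a) x (A (E ?S x))"
      by auto
    have "ennreal ((norm (A (E ?S x)))\<^sup>2) \<le> ennreal ((\<epsilon> * norm (E ?S x))\<^sup>2)"
      unfolding has_int_norm[OF h(2)]
      by (rule sq_le_bound) (use \<epsilon> in \<open>auto simp: indicator_def norm_mult\<close>)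
    then have "(norm (A (E ?S x)))\<^sup>2 \<le> (\<epsilon> * norm (E ?S x))\<^sup>2"
      by (rule ennreal_le_iff[OF zero_le_power2, THEN iffD1])
    then have "norm (A (E ?S x)) \<le> \<epsilon> * norm (E ?S x)"
      by (rule power2_le_imp_le) (use \<epsilon> in simp)
    then have "norm (E ?S x) \<le> M * (\<epsilon> * norm (E ?S x))"
      using M(2)[OF h(1)] M(1) by (meson mult_left_mono order_trans less_imp_le)
    also have "\<dots> = norm (E ?S x) / 2" using M(1) by (simp add: \<epsilon>_def)
    finally show ?thesis by simp
  qed
  have null2: "E {- real n..- \<epsilon>} x = 0" for n
  proof -
    let ?S = "{- real n..- \<epsilon>}"
    let ?y = "E ?S x"
    have "?y \<in> D \<and> has_int (\<lambda>a. complex_of_real a * indicator ?S a) x (A ?y)"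
      by (rule restricted[where b = "real n"]) (use \<epsilon> in auto)
    then have h: "?y \<in> D" "has_int (\<lambda>a. complex_of_real a * indicator ?S a) x (A ?y)"
      by auto
    \<comment> \<open>A square root of \<open>- A\<close> on the negative piece: for the integral
      \<open>u\<close> of this function, the squared norm of \<open>u\<close> is minus the energy of
      \<open>?y\<close>, hence at most 0.\<close>
    let ?h = "\<lambda>a. complex_of_real (sqrt (- a)) * indicator ?S a"
    have "sq x ?h \<le> ennreal ((sqrt (real n) * norm ?y)\<^sup>2)"
      by (rule sq_le_bound) (use \<epsilon> in \<open>auto simp: indicator_def norm_mult\<close>)
    then have "sq x ?h < \<infinity>" using le_less_trans by fastforce
    then obtain u where u: "has_int ?h x u"
      using ex_has_int[of ?h x] by auto
    have ind: "has_int (indicator ?S) x ?y" by (rule has_int_indicator) simp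
    have hi: "(\<lambda>a. ?h a * indicator ?S a) = ?h" by (auto simp: indicator_def)
    have uy: "has_int ?h ?y u"
      by (rule has_int_comp[OF ind]) (use u in \<open>auto simp: hi\<close>)
    have hh: "(\<lambda>a. ?h a * ?h a) = (\<lambda>a. - 1 * (complex_of_real a * indicator ?S a))"
    proof
      fix a
      have "complex_of_real (sqrt (- a)) * complex_of_real (sqrt (- a)) = - complex_of_real a" if "a \<in> ?S"
        using that \<epsilon> by (simp flip: of_real_mult)
      then show "?h a * ?h a = - 1 * (complex_of_real a * indicator ?S a)"
        by (auto simp: indicator_def)
    qed
    have "has_int ?h u (- 1 *\<^sub>C A ?y)"
      by (rule has_int_comp[OF u]) (use has_int_cmult[OF h(2), of "- 1"] in \<open>auto simp only: hh, measurable\<close>)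
    moreover have "(\<lambda>a. cnj (?h a)) = ?h" by (auto simp: indicator_def)
    ultimately have "cinner u u = cinner ?y (- 1 *\<^sub>C A ?y)"
      using has_int_adjoint[OF uy, of u "- 1 *\<^sub>C A ?y"] by simp
    then have "(norm u)\<^sup>2 = - Re (cinner ?y (A ?y))"
      by (simp add: cinner_scaleC_right power2_norm_eq_inner inner_eq_Re_cinner)
    then have "u = 0" using pos[OF h(1)] by (smt (verit) zero_less_norm_iff zero_less_power2)
    then have "sq x ?h = 0" using has_int_norm[OF u] by simp
    \<comment> \<open>The squared modulus of \<open>?h\<close> is \<open>- a\<close>, which is at
      least \<open>\<epsilon>\<close> on \<open>?S\<close>; a vanishing integral thus forces measure
      zero.\<close>
    moreover have "ennreal \<epsilon> * emeasure (\<mu> x) ?S \<le> sq x ?h"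
    proof -
      have "ennreal \<epsilon> * emeasure (\<mu> x) ?S = (\<integral>\<^sup>+ a. ennreal \<epsilon> * indicator ?S a \<partial>\<mu> x)"
        by (simp add: nn_integral_cmult_indicator)
      also have "\<dots> \<le> sq x ?h"
        unfolding sq_def by (intro nn_integral_mono) (use \<epsilon> in \<open>auto simp: indicator_def intro!: ennreal_leI\<close>)
      finally show ?thesis .
    qed
    ultimately show ?thesis
      using \<epsilon> by (simp add: emeasure_mu)
  qed
  have null: "S \<in> null_sets (\<mu> x)" if "S \<in> sets borel" "E S x = 0" for S
    using that by (simp add: null_sets_def emeasure_mu)
  have "{- \<epsilon><..<\<epsilon>} \<union> (\<Union>n. {- real n..- \<epsilon>}) \<in> null_sets (\<mu> x)"
    by (intro null_sets.Un null_sets_UN null null1 null2) auto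
  moreover have "{- \<epsilon><..<\<epsilon>} \<union> (\<Union>n. {- real n..- \<epsilon>}) = - {\<epsilon>..}"
  proof -
    have "\<exists>n. - real n \<le> a" for a using real_arch_simple[of "- a"] by (auto simp: minus_le_iff)
    then show ?thesis using \<epsilon> by force
  qed
  ultimately show ?thesis
    using emeasure_mu[of "- {\<epsilon>..}" x] by (simp add: null_sets_def \<epsilon>_def)
qed

lemma positive_operator_gap:
  assumes pos: "positive_operator D A" and z: "0 \<notin> spectrum D A"
  shows "bij_betw A D UNIV" "\<exists>\<epsilon>>0. \<forall>x. spectral_measure D A (- {\<epsilon>..}) x = 0"
proof -
  have sa: "self_adjoint D A" using pos by (simp add: positive_operator_def)
  interpret projection_valued_measure "spectral_measure D A"
    by standard (rule spectral_theorem(1)[OF sa])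
  have A0: "(\<lambda>x. A x - 0 *\<^sub>C x) = A" by (simp add: scaleC.zero_left)
  from z have bij: "bij_betw A D UNIV" and bl: "bounded_linear (inv_into D A)"
    by (auto simp: spectrum_def resolvent_set_def resolvent_def A0)
  show "bij_betw A D UNIV" by (rule bij)
  obtain M where M: "M > 0" "\<And>y. norm (inv_into D A y) \<le> norm y * M"
    using bounded_linear.pos_bounded[OF bl] by blast
  have "norm x \<le> M * norm (A x)" if "x \<in> D" for x
    using M(2)[of "A x"] inv_into_f_f[OF bij_betw_imp_inj_on[OF bij] that] by (simp add: mult.commute)
  then have "spectral_measure D A (- {1 / (2 * M)..}) x = 0" for x
    using positive_spectral_gap[OF spectral_theorem(2)[OF sa] _ M(1)] pos
    by (auto simp: positive_operator_def)
  then show "\<exists>\<epsilon>>0. \<forall>x. spectral_measure D A (- {\<epsilon>..}) x = 0"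
    using M(1) by (intro exI[of _ "1 / (2 * M)"]) auto
qed

section \<open>Assembly of the two parts for concrete operators\<close>

lemma self_adjoint_part:
  assumes sa: "self_adjoint D A" and m: "m > 0" and \<sigma>: "\<sigma> * \<sigma> = 1"
  defines "U \<equiv> unitary_evolution D A"
  shows "\<i> * complex_of_real (\<sigma> * m) \<in> resolvent_set D A"
    "is_adjoint (resolvent D A (\<i> * complex_of_real (\<sigma> * m))) (resolvent D A (\<i> * complex_of_real (- (\<sigma> * m))))"
    "is_adjoint (U t) (U (- t))"
    "bij (blinfun_apply (id_blinfun - exp (- m) *\<^sub>R U \<sigma>))"
    "bij (blinfun_apply (id_blinfun + exp (- m / 2 ^ k) *\<^sub>R U (\<sigma> * (1 / 2 ^ k))))"
    "summable (\<lambda>k. (1 / 2 ^ Suc k) *\<^sub>R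
      blinfun_inv (id_blinfun + exp (- m / 2 ^ Suc k) *\<^sub>R U (\<sigma> * (1 / 2 ^ Suc k))) x)"
    "resolvent D A (\<i> * complex_of_real (\<sigma> * m)) x =
      (\<i> * complex_of_real \<sigma>) *\<^sub>C blinfun_inv (id_blinfun - exp (- m) *\<^sub>R U \<sigma>) x -
      (\<i> * complex_of_real \<sigma>) *\<^sub>C (\<Sum>k. (1 / 2 ^ Suc k) *\<^sub>R
        blinfun_inv (id_blinfun + exp (- m / 2 ^ Suc k) *\<^sub>R U (\<sigma> * (1 / 2 ^ Suc k))) x)"
    "summable (\<lambda>j. exp (- real j * m) *\<^sub>R U (\<sigma> * real j) x)"
    "summable (\<lambda>j. ((1 / 2 ^ k) * (- 1) ^ j * exp (- real j * m / 2 ^ k)) *\<^sub>R U (\<sigma> * (real j / 2 ^ k)) x)"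
    "convergent (\<lambda>n. \<Sum>k=1..n. \<Sum>j.
      ((1 / 2 ^ k) * (- 1) ^ j * exp (- real j * m / 2 ^ k)) *\<^sub>R U (\<sigma> * (real j / 2 ^ k)) x)"
    "resolvent D A (\<i> * complex_of_real (\<sigma> * m)) x =
      (\<i> * complex_of_real \<sigma>) *\<^sub>C (\<Sum>j. exp (- real j * m) *\<^sub>R U (\<sigma> * real j) x) -
      (\<i> * complex_of_real \<sigma>) *\<^sub>C lim (\<lambda>n. \<Sum>k=1..n. \<Sum>j.
        ((1 / 2 ^ k) * (- 1) ^ j * exp (- real j * m / 2 ^ k)) *\<^sub>R U (\<sigma> * (real j / 2 ^ k)) x)"
proof -
  \<comment> \<open>The exponentials and resolvent functions here are bounded on the entire line, so
    the spectral support may be taken to be \<open>UNIV\<close>.\<close>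
  interpret spectral_calculus "spectral_measure D A" UNIV
    by unfold_locales (auto intro: spectral_theorem(1)[OF sa] projection_valued_measure.E_empty
        simp: projection_valued_measure_def spectral_theorem(1)[OF sa])
  have U: "U = evol"
    by (simp add: U_def fun_eq_iff unitary_evolution_def evol_def Psi_def op_fun_def[abs_def] Phi_def[abs_def])
  have \<sigma>0: "\<sigma> \<noteq> 0" using \<sigma> by auto
  have bounds: "bdd (\<lambda>a. 1 / (complex_of_real a - \<i> * complex_of_real l))"
    "bdd (\<lambda>a. complex_of_real a * (1 / (complex_of_real a - \<i> * complex_of_real l)))"
    "\<And>a. complex_of_real a \<noteq> \<i> * complex_of_real l" if l: "l \<noteq> 0" for l
  proof -
    have im: "\<bar>l\<bar> \<le> cmod (complex_of_real a - \<i> * complex_of_real l)"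
      and re: "\<bar>a\<bar> \<le> cmod (complex_of_real a - \<i> * complex_of_real l)" for a
      using abs_Im_le_cmod[of "complex_of_real a - \<i> * complex_of_real l"]
        abs_Re_le_cmod[of "complex_of_real a - \<i> * complex_of_real l"] by auto
    have pos: "0 < cmod (complex_of_real a - \<i> * complex_of_real l)" for a
      using im[of a] l by linarith
    show "bdd (\<lambda>a. 1 / (complex_of_real a - \<i> * complex_of_real l))"
      by (rule bddI[of _ "1 / \<bar>l\<bar>"]) (use im l in \<open>auto simp: norm_divide frac_le\<close>)
    show "bdd (\<lambda>a. complex_of_real a * (1 / (complex_of_real a - \<i> * complex_of_real l)))"
      by (rule bddI[of _ 1]) (use re pos in \<open>auto simp: norm_mult norm_divide divide_le_eq_1\<close>)
    show "complex_of_real a \<noteq> \<i> * complex_of_real l" for a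
      using pos[of a] by auto
  qed
  note res = resolvent_eq[OF spectral_theorem(2)[OF sa] bounds]
  have lm: "\<sigma> * m \<noteq> 0" "- (\<sigma> * m) \<noteq> 0" using \<sigma>0 m by auto
  show "\<i> * complex_of_real (\<sigma> * m) \<in> resolvent_set D A" by (rule res(3)[OF lm(1) lm(1) lm(1)])
  have R: "resolvent D A (\<i> * complex_of_real l) = Psi (\<lambda>a. 1 / (complex_of_real a - \<i> * complex_of_real l))"
    if "l \<noteq> 0" for l by (rule res(2)[OF that that that])
  show "is_adjoint (resolvent D A (\<i> * complex_of_real (\<sigma> * m))) (resolvent D A (\<i> * complex_of_real (- (\<sigma> * m))))"
    unfolding R[OF lm(1)] R[OF lm(2)] using Psi_adjoint[OF bounds(1)[OF lm(1)]] by simp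
  show "is_adjoint (U t) (U (- t))" unfolding U by (rule evol_adjoint)
  note F = evolution_formulas[OF m \<sigma>, folded U]
  show "bij (blinfun_apply (id_blinfun - exp (- m) *\<^sub>R U \<sigma>))"
    "bij (blinfun_apply (id_blinfun + exp (- m / 2 ^ k) *\<^sub>R U (\<sigma> * (1 / 2 ^ k))))"
    by (rule F)+
  from F(3)[of x] obtain y where y: "(\<lambda>k. (1 / 2 ^ Suc k) *\<^sub>R
      blinfun_inv (id_blinfun + exp (- m / 2 ^ Suc k) *\<^sub>R U (\<sigma> * (1 / 2 ^ Suc k))) x) sums y"
    "resolvent D A (\<i> * complex_of_real (\<sigma> * m)) x =
      (\<i> * complex_of_real \<sigma>) *\<^sub>C blinfun_inv (id_blinfun - exp (- m) *\<^sub>R U \<sigma>) x - (\<i> * complex_of_real \<sigma>) *\<^sub>C y"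
    "(\<lambda>n. \<Sum>k=1..n. \<Sum>j. (((1 / 2 ^ k) * (- 1) ^ j * exp (- real j * m / 2 ^ k)) *\<^sub>R U (\<sigma> * (real j / 2 ^ k))) x) \<longlonglongrightarrow> y"
    unfolding R[OF lm(1)] by blast
  note y3 = y(3)[unfolded blinfun.scaleR_left]
  show "summable (\<lambda>k. (1 / 2 ^ Suc k) *\<^sub>R
      blinfun_inv (id_blinfun + exp (- m / 2 ^ Suc k) *\<^sub>R U (\<sigma> * (1 / 2 ^ Suc k))) x)"
    using y(1) by (rule sums_summable)
  show "resolvent D A (\<i> * complex_of_real (\<sigma> * m)) x =
      (\<i> * complex_of_real \<sigma>) *\<^sub>C blinfun_inv (id_blinfun - exp (- m) *\<^sub>R U \<sigma>) x -
      (\<i> * complex_of_real \<sigma>) *\<^sub>C (\<Sum>k. (1 / 2 ^ Suc k) *\<^sub>R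
        blinfun_inv (id_blinfun + exp (- m / 2 ^ Suc k) *\<^sub>R U (\<sigma> * (1 / 2 ^ Suc k))) x)"
    unfolding sums_unique[OF y(1), symmetric] by (rule y(2))
  note F4 = F(4)[of x]
  show "summable (\<lambda>j. exp (- real j * m) *\<^sub>R U (\<sigma> * real j) x)"
    using F4 by (rule sums_summable)
  show "summable (\<lambda>j. ((1 / 2 ^ k) * (- 1) ^ j * exp (- real j * m / 2 ^ k)) *\<^sub>R U (\<sigma> * (real j / 2 ^ k)) x)"
    using F(5)[of k x] unfolding blinfun.scaleR_left .
  show "convergent (\<lambda>n. \<Sum>k=1..n. \<Sum>j.
      ((1 / 2 ^ k) * (- 1) ^ j * exp (- real j * m / 2 ^ k)) *\<^sub>R U (\<sigma> * (real j / 2 ^ k)) x)"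
    using y3 by (rule convergentI)
  show "resolvent D A (\<i> * complex_of_real (\<sigma> * m)) x =
      (\<i> * complex_of_real \<sigma>) *\<^sub>C (\<Sum>j. exp (- real j * m) *\<^sub>R U (\<sigma> * real j) x) -
      (\<i> * complex_of_real \<sigma>) *\<^sub>C lim (\<lambda>n. \<Sum>k=1..n. \<Sum>j.
        ((1 / 2 ^ k) * (- 1) ^ j * exp (- real j * m / 2 ^ k)) *\<^sub>R U (\<sigma> * (real j / 2 ^ k)) x)"
    unfolding limI[OF y3] sums_unique[OF F4, symmetric] by (rule y(2))
qed

lemma positive_part:
  assumes pos: "positive_operator D A" and z: "0 \<notin> spectrum D A"
  defines "T \<equiv> op_semigroup D A" and "V \<equiv> Blinfun (inv_into D A)"
  shows "bij_betw A D UNIV"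
    "bij (blinfun_apply (id_blinfun - T 1))"
    "bij (blinfun_apply (id_blinfun + T (1 / 2 ^ k)))"
    "(\<lambda>k. (1 / 2 ^ Suc k) *\<^sub>R blinfun_inv (id_blinfun + T (1 / 2 ^ Suc k))) sums (blinfun_inv (id_blinfun - T 1) - V)"
    "(\<lambda>j. T (real (Suc j))) sums (blinfun_inv (id_blinfun - T 1) - id_blinfun)"
    "summable (\<lambda>j. ((1 / 2 ^ k) * (- 1) ^ Suc j) *\<^sub>R T (real (Suc j) / 2 ^ k))"
    "(\<lambda>n. \<Sum>k=1..n. \<Sum>j. ((1 / 2 ^ k) * (- 1) ^ Suc j) *\<^sub>R T (real (Suc j) / 2 ^ k))
      \<longlonglongrightarrow> blinfun_inv (id_blinfun - T 1) - V - id_blinfun"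
    "t > 0 \<Longrightarrow> norm (T t) < 1"
    "s < 1 \<Longrightarrow> (\<lambda>k. 2 powr (- real (Suc k) * (1 - s)) *\<^sub>R op_polylog s (- T (1 / 2 ^ Suc k)))
      sums (op_polylog s (T 1) - Gamma (1 - s) *\<^sub>R op_powr D A (s - 1))"
proof -
  have sa: "self_adjoint D A" using pos by (simp add: positive_operator_def)
  obtain \<epsilon> where \<epsilon>: "\<epsilon> > 0" "\<And>x. spectral_measure D A (- {\<epsilon>..}) x = 0"
    using positive_operator_gap(2)[OF pos z] by blast
  \<comment> \<open>The gap makes \<open>1 / a\<close> bounded and \<open>exp (- t * a)\<close> at
    most \<open>exp (- t * \<epsilon>)\<close>, which is below 1 for positive
    \<open>t\<close>.\<close>
  interpret spectral_calculus "spectral_measure D A" "{\<epsilon>..}"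
    by unfold_locales (use \<epsilon>(2) spectral_theorem(1)[OF sa] in auto)
  have T: "T = heat"
    by (simp add: T_def fun_eq_iff op_semigroup_def heat_def Psi_def op_fun_def[abs_def] Phi_def[abs_def])
  have P: "op_powr D A p = Psi (\<lambda>a. complex_of_real (a powr p))" for p
    by (simp add: op_powr_def Psi_def op_fun_def[abs_def] Phi_def[abs_def])
  show "bij_betw A D UNIV" by (rule positive_operator_gap(1)[OF pos z])
  have "resolvent D A 0 = blinfun_apply (Psi (\<lambda>a. 1 / (complex_of_real a - 0)))"
  proof (rule resolvent_eq(2)[OF spectral_theorem(2)[OF sa]])
    show "bdd (\<lambda>a. 1 / (complex_of_real a - 0))"
      by (rule bddI[of _ "1 / \<epsilon>"]) (use \<epsilon> in \<open>auto simp: norm_divide frac_le\<close>)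
    show "bdd (\<lambda>a. complex_of_real a * (1 / (complex_of_real a - 0)))"
      by (rule bddI[of _ 1]) (use \<epsilon> in \<open>auto simp: norm_mult norm_divide\<close>)
    show "complex_of_real a \<noteq> 0" if "a \<in> {\<epsilon>..}" for a using that \<epsilon> by auto
  qed
  then have V: "V = Psi (\<lambda>a. 1 / complex_of_real a)"
    by (simp add: V_def resolvent_def scaleC.zero_left blinfun_apply_inverse)
  note F = semigroup_formulas[OF \<epsilon>(1) refl, folded T V]
  show "bij (blinfun_apply (id_blinfun - T 1))" "bij (blinfun_apply (id_blinfun + T (1 / 2 ^ k)))"
    "(\<lambda>k. (1 / 2 ^ Suc k) *\<^sub>R blinfun_inv (id_blinfun + T (1 / 2 ^ Suc k))) sums (blinfun_inv (id_blinfun - T 1) - V)"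
    "(\<lambda>j. T (real (Suc j))) sums (blinfun_inv (id_blinfun - T 1) - id_blinfun)"
    "summable (\<lambda>j. ((1 / 2 ^ k) * (- 1) ^ Suc j) *\<^sub>R T (real (Suc j) / 2 ^ k))"
    "(\<lambda>n. \<Sum>k=1..n. \<Sum>j. ((1 / 2 ^ k) * (- 1) ^ Suc j) *\<^sub>R T (real (Suc j) / 2 ^ k))
      \<longlonglongrightarrow> blinfun_inv (id_blinfun - T 1) - V - id_blinfun"
    by (rule F)+
  show "norm (T t) < 1" if "t > 0" using that by (rule F(7))
  show "(\<lambda>k. 2 powr (- real (Suc k) * (1 - s)) *\<^sub>R op_polylog s (- T (1 / 2 ^ Suc k)))
      sums (op_polylog s (T 1) - Gamma (1 - s) *\<^sub>R op_powr D A (s - 1))" if "s < 1"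
    using polylog_formula[OF \<epsilon>(1) refl that, folded T P] .
qed

theorem proposition11:
  fixes D :: "'a::chilbert_space set" and A :: "'a \<Rightarrow> 'a"
  shows
   "(self_adjoint D A \<longrightarrow>
      (let U = unitary_evolution D A; R = (\<lambda>l::real. resolvent D A (\<i> * complex_of_real l)) in
        (\<forall>l>0.
           \<i> * complex_of_real l \<in> resolvent_set D A \<and>
           bij (blinfun_apply (id_blinfun - exp (- l) *\<^sub>R U 1)) \<and>
           (\<forall>k\<ge>1. bij (blinfun_apply (id_blinfun + exp (- l / 2 ^ k) *\<^sub>R U (1 / 2 ^ k)))) \<and>
           (\<forall>x.
              summable (\<lambda>k. (1 / 2 ^ Suc k) *\<^sub>R
                blinfun_inv (id_blinfun + exp (- l / 2 ^ Suc k) *\<^sub>R U (1 / 2 ^ Suc k)) x) \<and>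
              R l x =
                \<i> *\<^sub>C blinfun_inv (id_blinfun - exp (- l) *\<^sub>R U 1) x -
                \<i> *\<^sub>C (\<Sum>k. (1 / 2 ^ Suc k) *\<^sub>R
                  blinfun_inv (id_blinfun + exp (- l / 2 ^ Suc k) *\<^sub>R U (1 / 2 ^ Suc k)) x) \<and>
              summable (\<lambda>j. exp (- real j * l) *\<^sub>R U (real j) x) \<and>
              (\<forall>k\<ge>1. summable (\<lambda>j. ((1 / 2 ^ k) * (- 1) ^ j * exp (- real j * l / 2 ^ k)) *\<^sub>R
                U (real j / 2 ^ k) x)) \<and>
              convergent (\<lambda>n. \<Sum>k=1..n. \<Sum>j.
                ((1 / 2 ^ k) * (- 1) ^ j * exp (- real j * l / 2 ^ k)) *\<^sub>R U (real j / 2 ^ k) x) \<and>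
              R l x =
                \<i> *\<^sub>C (\<Sum>j. exp (- real j * l) *\<^sub>R U (real j) x) -
                \<i> *\<^sub>C lim (\<lambda>n. \<Sum>k=1..n. \<Sum>j.
                  ((1 / 2 ^ k) * (- 1) ^ j * exp (- real j * l / 2 ^ k)) *\<^sub>R
                    U (real j / 2 ^ k) x))) \<and>
        (\<forall>t. is_adjoint (blinfun_apply (U t)) (blinfun_apply (U (- t)))) \<and>
        (\<forall>l<0.
           is_adjoint (R \<bar>l\<bar>) (R l) \<and>
           \<i> * complex_of_real l \<in> resolvent_set D A \<and>
           bij (blinfun_apply (id_blinfun - exp (- \<bar>l\<bar>) *\<^sub>R U (- 1))) \<and>
           (\<forall>k\<ge>1. bij (blinfun_apply (id_blinfun + exp (- \<bar>l\<bar> / 2 ^ k) *\<^sub>R U (- (1 / 2 ^ k))))) \<and>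
           (\<forall>x.
              summable (\<lambda>k. (1 / 2 ^ Suc k) *\<^sub>R
                blinfun_inv (id_blinfun + exp (- \<bar>l\<bar> / 2 ^ Suc k) *\<^sub>R U (- (1 / 2 ^ Suc k))) x) \<and>
              R l x =
                (- \<i>) *\<^sub>C blinfun_inv (id_blinfun - exp (- \<bar>l\<bar>) *\<^sub>R U (- 1)) x +
                \<i> *\<^sub>C (\<Sum>k. (1 / 2 ^ Suc k) *\<^sub>R
                  blinfun_inv (id_blinfun + exp (- \<bar>l\<bar> / 2 ^ Suc k) *\<^sub>R U (- (1 / 2 ^ Suc k))) x) \<and>
              summable (\<lambda>j. exp (- real j * \<bar>l\<bar>) *\<^sub>R U (- real j) x) \<and>
              (\<forall>k\<ge>1. summable (\<lambda>j. ((1 / 2 ^ k) * (- 1) ^ j * exp (- real j * \<bar>l\<bar> / 2 ^ k)) *\<^sub>R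
                U (- (real j / 2 ^ k)) x)) \<and>
              convergent (\<lambda>n. \<Sum>k=1..n. \<Sum>j.
                ((1 / 2 ^ k) * (- 1) ^ j * exp (- real j * \<bar>l\<bar> / 2 ^ k)) *\<^sub>R
                  U (- (real j / 2 ^ k)) x) \<and>
              R l x =
                (- \<i>) *\<^sub>C (\<Sum>j. exp (- real j * \<bar>l\<bar>) *\<^sub>R U (- real j) x) +
                \<i> *\<^sub>C lim (\<lambda>n. \<Sum>k=1..n. \<Sum>j.
                  ((1 / 2 ^ k) * (- 1) ^ j * exp (- real j * \<bar>l\<bar> / 2 ^ k)) *\<^sub>R
                    U (- (real j / 2 ^ k)) x))))) \<and>
    (positive_operator D A \<and> 0 \<notin> spectrum D A \<longrightarrow>
      (let T = op_semigroup D A; A_inv = Blinfun (inv_into D A) in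
        bij_betw A D UNIV \<and>
        bij (blinfun_apply (id_blinfun - T 1)) \<and>
        (\<forall>k\<ge>1. bij (blinfun_apply (id_blinfun + T (1 / 2 ^ k)))) \<and>
        summable (\<lambda>k. (1 / 2 ^ Suc k) *\<^sub>R blinfun_inv (id_blinfun + T (1 / 2 ^ Suc k))) \<and>
        A_inv =
          blinfun_inv (id_blinfun - T 1) -
          (\<Sum>k. (1 / 2 ^ Suc k) *\<^sub>R blinfun_inv (id_blinfun + T (1 / 2 ^ Suc k))) \<and>
        summable (\<lambda>j. T (real (Suc j))) \<and>
        (\<forall>k\<ge>1. summable (\<lambda>j. ((1 / 2 ^ k) * (- 1) ^ Suc j) *\<^sub>R T (real (Suc j) / 2 ^ k))) \<and>
        convergent (\<lambda>n. \<Sum>k=1..n. \<Sum>j.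
          ((1 / 2 ^ k) * (- 1) ^ Suc j) *\<^sub>R T (real (Suc j) / 2 ^ k)) \<and>
        A_inv =
          (\<Sum>j. T (real (Suc j))) -
          lim (\<lambda>n. \<Sum>k=1..n. \<Sum>j.
            ((1 / 2 ^ k) * (- 1) ^ Suc j) *\<^sub>R T (real (Suc j) / 2 ^ k)) \<and>
        (\<forall>t>0. norm (T t) < 1) \<and>
        (\<forall>s::real. s < 1 \<and> s \<notin> \<int> \<longrightarrow>
           summable (\<lambda>k. (2 powr (- real (Suc k) * (1 - s))) *\<^sub>R
             op_polylog s (- T (1 / 2 ^ Suc k))) \<and>
           pi *\<^sub>R op_powr D A (s - 1) =
             (Gamma s * sin (pi * s)) *\<^sub>R
               (op_polylog s (T 1) -
                (\<Sum>k. (2 powr (- real (Suc k) * (1 - s))) *\<^sub>R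
                  op_polylog s (- T (1 / 2 ^ Suc k)))))))"
proof (intro conjI impI, goal_cases)
  case 1
  \<comment> \<open>Both half planes are instances of one lemma: \<open>\<sigma> = 1\<close> and
    \<open>m = l\<close> here, \<open>\<sigma> = - 1\<close> and \<open>m = \<bar>l\<bar>\<close>
    for negative \<open>l\<close>.\<close>
  note upper = self_adjoint_part[OF 1 _ mult_1_left[of 1], unfolded mult_1_left of_real_1 mult_1_right]
  have lower_sign: "- 1 * - 1 = (1::real)" "\<i> * complex_of_real (- 1) = - \<i>"
    and lower_diff: "x - (- \<i>) *\<^sub>C y = x + \<i> *\<^sub>C y" for x y :: 'a
    by (simp_all add: scaleC.minus_left)
  { fix l :: real assume "l < 0"
    then have l: "0 < \<bar>l\<bar>" "complex_of_real (- \<bar>l\<bar>) = complex_of_real l" by simp_all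
    note self_adjoint_part[OF 1 l(1) lower_sign(1), unfolded mult_minus1 lower_sign(2) lower_diff l(2)]
      upper(2)[OF l(1), unfolded l(2)] }
  note lower = this
  show ?case
    unfolding Let_def by (intro conjI allI impI; (rule upper lower, assumption | rule upper(3)[OF zero_less_one]))
next
  case 2
  then have pos: "positive_operator D A" "0 \<notin> spectrum D A" by auto
  note P = positive_part[OF pos]
  let ?T = "op_semigroup D A" and ?V = "Blinfun (inv_into D A)"
  have V1: "?V = blinfun_inv (id_blinfun - ?T 1) -
      (\<Sum>k. (1 / 2 ^ Suc k) *\<^sub>R blinfun_inv (id_blinfun + ?T (1 / 2 ^ Suc k)))"
    unfolding sums_unique[OF P(4), symmetric] by simp
  have V2: "?V = (\<Sum>j. ?T (real (Suc j))) -
      lim (\<lambda>n. \<Sum>k=1..n. \<Sum>j. ((1 / 2 ^ k) * (- 1) ^ Suc j) *\<^sub>R ?T (real (Suc j) / 2 ^ k))"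
    unfolding sums_unique[OF P(5), symmetric] limI[OF P(7)] by simp
  have polylog: "pi *\<^sub>R op_powr D A (s - 1) = (Gamma s * sin (pi * s)) *\<^sub>R (op_polylog s (?T 1) -
      (\<Sum>k. (2 powr (- real (Suc k) * (1 - s))) *\<^sub>R op_polylog s (- ?T (1 / 2 ^ Suc k))))"
    if "s < 1 \<and> s \<notin> \<int>" for s
  proof -
    have s: "s < 1" "s \<notin> \<int>" using that by auto
    \<comment> \<open>Inside the bracket only \<open>Gamma (1 - s)\<close> times the power of
      \<open>A\<close> remains; reflection turns the product of the scalar factors into
      \<open>pi\<close>.\<close>
    show ?thesis
      unfolding sums_unique[OF P(9)[OF s(1)], symmetric]
      by (simp add: Gamma_reflection_real[OF s(2)])
  qed
  have summ: "summable (\<lambda>k. (2 powr (- real (Suc k) * (1 - s))) *\<^sub>R op_polylog s (- ?T (1 / 2 ^ Suc k)))"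
    if "s < 1 \<and> s \<notin> \<int>" for s
    using sums_summable[OF P(9)] that by blast
  show ?case
    unfolding Let_def
    by (intro conjI allI impI)
      (rule P(1-3,6) sums_summable[OF P(4)] V1 sums_summable[OF P(5)] convergentI[OF P(7)] V2
        | rule P(8) polylog summ, assumption)+
qed

end
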